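(* In each of the two cases (odd case and even case), there is an isomorphism $\iota_*:\mathcal{A}^c_{BCR}\to\mathcal{A}_{BCR}$ of $\mathbb{Q}$-vector spaces, namely the linear map $\iota_*$ induced on quotients by the inclusion $\iota:\mathcal{D}^c\to\mathcal{D}$ which regards a colored BCR chord diagram as a colored BCR graph without internal vertices.
   Context: All graphs are finite; loops and multiple edges are allowed unless excluded, and a loop at a vertex counts twice among the edges at that vertex. **BCR graphs.** A BCR graph is a connected graph such that: (1) there are (at most) two types of vertices, external and internal, and there is at least one external vertex; (2) there are (at most) two types of edges, dashed and solid; (3) each internal vertex has exactly three dashed edges and no solid edge; (4) each external vertex has exactly one dashed edge and at most two solid edges; (5) the subgraph formed by the external vertices and the solid edges is a disjoint union of broken lines, i.e. of paths (a single vertex is allowed); in particular there are no solid cycles, no solid loops and no double solid edges. A BCR chord diagram is a BCR graph without internal vertices. **Colorings.** Fix one of two cases. Odd case: a coloring is an orientation of every edge together with a labelling of the vertices by $1,\dots,n$ ($n$ the number of vertices). Even case: a coloring is a numbering of all edges (solid and dashed) by $1,\dots,m$ ($m$ the number of edges). Two colorings of isomorphic underlying graphs (isomorphisms preserve the types of vertices and edges) have the same (resp. opposite) orientation if they are related by an even (resp. odd) change, where the parity is the parity of the permutation of vertex labels plus the number of edges whose orientation is reversed (odd case), or the parity of the permutation of edge numbers (even case). $\mathcal{D}$ (resp. $\mathcal{D}^c$) is the $\mathbb{Q}$-vector space generated by colored BCR graphs (resp. colored BCR chord diagrams). Orientation relations: $D=D'$ if $D,D'$ have isomorphic underlying graphs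 and the same orientation; $D=-D'$ if they have opposite orientation. **Contraction.** For a non-loop edge $e$, the contraction of a colored graph along $e$ is defined, up to orientation relations, as follows. Odd case: change the coloring, recording the sign, so that $e$ is oriented from vertex $1$ to vertex $2$; collapse $e$, label the merged vertex $1$, decrease the labels of the vertices $3,4,\dots$ by one, and keep the orientations of the other edges. Even case: change the coloring, recording the sign, so that $e$ has number $1$; collapse $e$ and decrease all other edge numbers by one. **IHX relations.** Let $e$ be a dashed edge joining two distinct internal vertices. Contracting $e$ gives a vertex with four dashed half-edges. Let $D_1,D_2,D_3$ be the three graphs obtained by expanding this vertex into two internal vertices joined by a dashed edge (one graph for each partition of the four half-edges into two pairs), colored so that contracting the new edge gives the same oriented graph in all three cases. The IHX relation is $D_1+D_2+D_3=0$ (also written $D_1=D_2-D_3$ with the sign absorbed in the coloring). **STU relations.** Let $S$ be a colored BCR graph with a dashed edge $e$ joining an external vertex $v$ and an internal vertex $w$, and let $x,y$ be the other two dashed half-edges at $w$. (I) Suppose $v$ has one or two solid edges. Let $T,U$ be obtained from the contraction of $S$ along $e$ by replacing the merged vertex by two external vertices $p,q$ joined by a new solid edge; if $v$ has two solid half-edges $a,b$, then $a$ is attached to $p$ and $b$ to $q$; if $v$ has a single solid half-edge $a$, it is attached to $p$. In $T$, $x$ is attached to $p$ and $y$ to $q$; in $U$, $y$ is attached to $p$ and $x$ to $q$. Color $T$ and $U$ so that the contraction of each along the edge $pq$ gives the same oriented graph as the contraction of $S$ along $e$. The relation is $S+T+U=0$ (also written $S=T-U$ with the signs absorbed in the colorings).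 (II) Suppose $v$ has no solid edge. Let $T$ be obtained by replacing the merged vertex by two external vertices $p,q$ joined by a new solid edge, with $x$ attached to $p$ and $y$ to $q$, colored by the same rule. The relation is $S+T=0$ (also written $S=T$ with the sign absorbed). **4T relations.** Let $S$ be a colored BCR graph with exactly one internal vertex $w$, and let $e\neq e'$ be two dashed edges at $w$ each joining $w$ to an external vertex. The STU relations at $e$ and at $e'$ express $S$ as linear combinations $H_e$ and $H_{e'}$ of one or two BCR chord diagrams each (so $S=D_1-D_2$ and $S=D_3-D_4$ are STU relations, where $D_2$ and/or $D_4$ is absent if the corresponding external vertex has no solid edge). The 4T relation is $H_e=H_{e'}$ (i.e. $D_1-D_2=D_3-D_4$). **Quotients.** $\mathcal{A}_{BCR}$ is the quotient of $\mathcal{D}$ by the IHX, STU and orientation relations. $\mathcal{A}^c_{BCR}$ is the quotient of $\mathcal{D}^c$ by the orientation and 4T relations. *)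

theory Defs
  imports Complex_Main "HOL-Library.Poly_Mapping" "HOL-Library.Set_Algebras"
    "HOL-Combinatorics.Permutations"
begin

section \<open>BCR graphs\<close>

text \<open>
  Graphs are given by half-edges, so that loops and multiple edges make sense: an edge is an
  unordered pair of half-edges, and \<open>att\<close> is the vertex to which a half-edge is attached. A loop is
  an edge whose two half-edges are attached to the same vertex, and it is counted twice there.
  Finite graphs being considered up to isomorphism, vertices and half-edges are natural numbers.
  The values of \<open>att\<close> outside the half-edges are irrelevant. Vertices not in \<open>ext\<close> are internal,
  edges not in \<open>solid\<close> are dashed.
\<close>

record graph =
  verts :: "nat set"
  ext :: "nat set"
  edges :: "nat set set"
  solid :: "nat set set"
  att :: "nat \<Rightarrow> nat"

definition int_verts :: "graph \<Rightarrow> nat set" where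
  "int_verts G = verts G - ext G"

definition dashed :: "graph \<Rightarrow> nat set set" where
  "dashed G = edges G - solid G"

definition halves_at :: "graph \<Rightarrow> nat set set \<Rightarrow> nat \<Rightarrow> nat set" where
  "halves_at G F v = {h \<in> \<Union>F. att G h = v}"

definition wf_graph :: "graph \<Rightarrow> bool" where
  "wf_graph G \<longleftrightarrow>
     finite (verts G) \<and> ext G \<subseteq> verts G \<and>
     finite (edges G) \<and> solid G \<subseteq> edges G \<and>
     (\<forall>e\<in>edges G. card e = 2) \<and>
     (\<forall>e\<in>edges G. \<forall>e'\<in>edges G. e \<noteq> e' \<longrightarrow> e \<inter> e' = {}) \<and>
     att G ` \<Union>(edges G) \<subseteq> verts G"

definition connected_graph :: "graph \<Rightarrow> bool" where
  "connected_graph G \<longleftrightarrow>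
     (\<forall>u\<in>verts G. \<forall>v\<in>verts G. (u, v) \<in> (\<Union>e\<in>edges G. att G ` e \<times> att G ` e)\<^sup>*)"

text \<open>
  The members of \<open>P\<close> are the vertex sequences of the paths; a path with a single vertex is allowed.
  The bijection excludes solid loops, double solid edges and solid cycles.
\<close>

definition union_of_broken_lines :: "graph \<Rightarrow> bool" where
  "union_of_broken_lines G \<longleftrightarrow>
     (\<exists>P :: nat list set.
        (\<forall>p\<in>P. p \<noteq> [] \<and> distinct p) \<and>
        (\<forall>p\<in>P. \<forall>q\<in>P. p \<noteq> q \<longrightarrow> set p \<inter> set q = {}) \<and>
        \<Union>(set ` P) = ext G \<and>
        bij_betw (\<lambda>e. att G ` e) (solid G)
          {{p ! i, p ! Suc i} | p i. p \<in> P \<and> Suc i < length p})"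

definition BCR_graph :: "graph \<Rightarrow> bool" where
  "BCR_graph G \<longleftrightarrow>
     wf_graph G \<and> connected_graph G \<and> ext G \<noteq> {} \<and>
     (\<forall>v\<in>int_verts G. card (halves_at G (dashed G) v) = 3 \<and> halves_at G (solid G) v = {}) \<and>
     (\<forall>v\<in>ext G. card (halves_at G (dashed G) v) = 1 \<and> card (halves_at G (solid G) v) \<le> 2) \<and>
     union_of_broken_lines G"

definition chord_diagram :: "graph \<Rightarrow> bool" where
  "chord_diagram G \<longleftrightarrow> BCR_graph G \<and> int_verts G = {}"

section \<open>Colorings and orientations\<close>

datatype parity_case = Odd_Case | Even_Case

text \<open>
  Odd case: a vertex labelling and, for every edge, the half-edge at its tail.
  Even case: an edge numbering.
\<close>

datatype coloring =
  Odd_Col (vlabel: "nat \<Rightarrow> nat") (tail: "nat set \<Rightarrow> nat")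
| Even_Col (enum: "nat set \<Rightarrow> nat")

fun is_coloring :: "parity_case \<Rightarrow> graph \<Rightarrow> coloring \<Rightarrow> bool" where
  "is_coloring Odd_Case G (Odd_Col l t) \<longleftrightarrow>
     bij_betw l (verts G) {1..card (verts G)} \<and> (\<forall>e\<in>edges G. t e \<in> e)"
| "is_coloring Even_Case G (Even_Col n) \<longleftrightarrow> bij_betw n (edges G) {1..card (edges G)}"
| "is_coloring _ _ _ \<longleftrightarrow> False"

type_synonym colored_graph = "graph \<times> coloring"

definition colored_BCR :: "parity_case \<Rightarrow> colored_graph set" where
  "colored_BCR \<kappa> = {(G, c). BCR_graph G \<and> is_coloring \<kappa> G c}"

definition colored_chord :: "parity_case \<Rightarrow> colored_graph set" where
  "colored_chord \<kappa> = {(G, c). chord_diagram G \<and> is_coloring \<kappa> G c}"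

definition graph_iso :: "graph \<Rightarrow> graph \<Rightarrow> (nat \<Rightarrow> nat) \<Rightarrow> (nat \<Rightarrow> nat) \<Rightarrow> bool" where
  "graph_iso G G' f g \<longleftrightarrow>
     bij_betw f (verts G) (verts G') \<and> f ` ext G = ext G' \<and>
     bij_betw g (\<Union>(edges G)) (\<Union>(edges G')) \<and>
     (`) g ` edges G = edges G' \<and> (`) g ` solid G = solid G' \<and>
     (\<forall>h\<in>\<Union>(edges G). att G' (g h) = f (att G h))"

text \<open>The permutation of labels sending the label \<open>l a\<close> to the label \<open>l' a\<close> for all \<open>a \<in> A\<close>.\<close>

definition relabelling :: "'a set \<Rightarrow> ('a \<Rightarrow> nat) \<Rightarrow> ('a \<Rightarrow> nat) \<Rightarrow> nat \<Rightarrow> nat" where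
  "relabelling A l l' i = (if i \<in> l ` A then l' (inv_into A l i) else i)"

text \<open>
  The sign \<open>\<plusminus>1\<close> of the change from the coloring \<open>c\<close> of \<open>G\<close> to the coloring \<open>c'\<close> of a graph
  identified with \<open>G\<close> by the isomorphism given by \<open>f\<close> on vertices and \<open>g\<close> on half-edges.
\<close>

fun change_sign :: "graph \<Rightarrow> (nat \<Rightarrow> nat) \<Rightarrow> (nat \<Rightarrow> nat) \<Rightarrow> coloring \<Rightarrow> coloring \<Rightarrow> int" where
  "change_sign G f g (Odd_Col l t) (Odd_Col l' t') =
     sign (relabelling (verts G) l (\<lambda>v. l' (f v))) * (-1) ^ card {e \<in> edges G. t' (g ` e) \<noteq> g (t e)}"
| "change_sign G f g (Even_Col n) (Even_Col n') =
     sign (relabelling (edges G) n (\<lambda>e. n' (g ` e)))"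
| "change_sign _ _ _ _ _ = 0"

section \<open>Contraction\<close>

text \<open>
  The merged vertex is named by the smaller endpoint, and it is external if and only if one of the
  endpoints is. This makes the contractions compared in the IHX and STU relations graphs on the same
  vertices and half-edges.
\<close>

definition merged :: "graph \<Rightarrow> nat set \<Rightarrow> nat" where
  "merged G e = Min (att G ` e)"

definition collapse :: "graph \<Rightarrow> nat set \<Rightarrow> graph" where
  "collapse G e =
     \<lparr>verts = insert (merged G e) (verts G - att G ` e),
      ext = (if att G ` e \<inter> ext G = {} then ext G else insert (merged G e) (ext G - att G ` e)),
      edges = edges G - {e},
      solid = solid G - {e},
      att = (\<lambda>h. if att G h \<in> att G ` e then merged G e else att G h)\<rparr>"

fun adapted :: "graph \<Rightarrow> nat set \<Rightarrow> coloring \<Rightarrow> bool" where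
  "adapted G e (Odd_Col l t) \<longleftrightarrow> l (att G (t e)) = 1 \<and> l ` att G ` e = {1, 2}"
| "adapted G e (Even_Col n) \<longleftrightarrow> n e = 1"

fun collapse_coloring :: "graph \<Rightarrow> nat set \<Rightarrow> coloring \<Rightarrow> coloring" where
  "collapse_coloring G e (Odd_Col l t) =
     Odd_Col (\<lambda>v. if v = merged G e then 1 else l v - 1) t"
| "collapse_coloring G e (Even_Col n) = Even_Col (\<lambda>e'. n e' - 1)"

text \<open>The contraction of the first colored graph along \<open>e\<close> is \<open>s\<close> times the last colored graph.\<close>

definition contraction ::
    "parity_case \<Rightarrow> nat set \<Rightarrow> colored_graph \<Rightarrow> int \<Rightarrow> colored_graph \<Rightarrow> bool" where
  "contraction \<kappa> e = (\<lambda>(G, c) s (K, d).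
     \<exists>c'. is_coloring \<kappa> G c' \<and> adapted G e c' \<and> s = change_sign G id id c c' \<and>
          K = collapse G e \<and> d = collapse_coloring G e c')"

text \<open>
  The contractions along \<open>e\<close> are the same oriented graph, where both are identified by the identity
  of the remaining half-edges (and not by an arbitrary isomorphism, which could reverse orientation).
\<close>

definition same_contraction ::
    "parity_case \<Rightarrow> nat set \<Rightarrow> colored_graph \<Rightarrow> colored_graph \<Rightarrow> bool" where
  "same_contraction \<kappa> e X Y \<longleftrightarrow>
     (\<exists>s K d s' K' d'.
        contraction \<kappa> e X s (K, d) \<and> contraction \<kappa> e Y s' (K', d') \<and>
        graph_iso K K' id id \<and> s * s' * change_sign K id id d d' = 1)"

section \<open>The vector spaces generated by colored graphs\<close>

text \<open>
  Formal \<open>\<rat>\<close>-linear combinations of colored graphs are finitely supported functions.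
\<close>

type_synonym comb = "colored_graph \<Rightarrow>\<^sub>0 rat"

definition scale :: "rat \<Rightarrow> comb \<Rightarrow> comb" where
  "scale r p = Poly_Mapping.map ((*) r) p"

lemma lookup_scale [simp]: "Poly_Mapping.lookup (scale r p) X = r * Poly_Mapping.lookup p X"
  by (simp add: scale_def Poly_Mapping.map.rep_eq when_def)

interpretation comb: vector_space scale
  by unfold_locales (auto intro!: poly_mapping_eqI simp: lookup_add algebra_simps)

definition gen :: "colored_graph \<Rightarrow> comb" where
  "gen X = Poly_Mapping.single X 1"

definition D_BCR :: "parity_case \<Rightarrow> comb set" where
  "D_BCR \<kappa> = comb.span (gen ` colored_BCR \<kappa>)"

definition Dc_BCR :: "parity_case \<Rightarrow> comb set" where
  "Dc_BCR \<kappa> = comb.span (gen ` colored_chord \<kappa>)"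

section \<open>Relations\<close>

text \<open>Orientation relators among the colored graphs in \<open>\<X>\<close>.\<close>

definition orientation_rel :: "colored_graph set \<Rightarrow> comb set" where
  "orientation_rel \<X> =
     {gen (G, c) - scale (of_int (change_sign G f g c c')) (gen (G', c')) | G c G' c' f g.
        (G, c) \<in> \<X> \<and> (G', c') \<in> \<X> \<and> graph_iso G G' f g}"

definition reattach :: "graph \<Rightarrow> nat set \<Rightarrow> nat \<Rightarrow> nat set \<Rightarrow> nat \<Rightarrow> graph" where
  "reattach G P p Q q = G\<lparr>att := (\<lambda>k. if k \<in> P then p else if k \<in> Q then q else att G k)\<rparr>"

text \<open>
  As graphs are considered up to isomorphism, the new vertices and the new edge replacing a
  contracted edge \<open>e\<close> can be given the names of \<open>e\<close> and of its endpoints.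
\<close>

definition IHX_rel :: "parity_case \<Rightarrow> comb set" where
  "IHX_rel \<kappa> =
     {gen D1 + gen D2 + gen D3 | D1 D2 D3 G e h h' u w x y z t.
        D1 \<in> colored_BCR \<kappa> \<and> D2 \<in> colored_BCR \<kappa> \<and> D3 \<in> colored_BCR \<kappa> \<and>
        e = {h, h'} \<and> e \<in> dashed G \<and> u \<in> int_verts G \<and> w \<in> int_verts G \<and> u \<noteq> w \<and>
        att G h = u \<and> att G h' = w \<and> distinct [h, x, y, h', z, t] \<and>
        halves_at G (edges G) u = {h, x, y} \<and> halves_at G (edges G) w = {h', z, t} \<and>
        fst D1 = G \<and>
        fst D2 = reattach G {x, z} u {y, t} w \<and>
        fst D3 = reattach G {x, t} u {y, z} w \<and>
        same_contraction \<kappa> e D1 D2 \<and> same_contraction \<kappa> e D1 D3}"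

text \<open>
  \<open>STU_leg G e v w x y\<close>: the dashed edge \<open>e\<close> joins the external vertex \<open>v\<close> and the internal
  vertex \<open>w\<close>, and \<open>x\<close>, \<open>y\<close> are the other two half-edges at \<open>w\<close>.
\<close>

definition STU_leg ::
    "graph \<Rightarrow> nat set \<Rightarrow> nat \<Rightarrow> nat \<Rightarrow> nat \<Rightarrow> nat \<Rightarrow> bool" where
  "STU_leg G e v w x y \<longleftrightarrow>
     e \<in> dashed G \<and> v \<in> ext G \<and> w \<in> int_verts G \<and>
     (\<exists>h h'. e = {h, h'} \<and> att G h = v \<and> att G h' = w \<and>
             distinct [h', x, y] \<and> halves_at G (edges G) w = {h', x, y})"

text \<open>
  The merged vertex is replaced by the external vertices \<open>v\<close>, \<open>w\<close> (\<open>p\<close>, \<open>q\<close> in the usual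
  description) joined by \<open>e\<close>, which becomes solid; the half-edges in \<open>P\<close> are attached to \<open>v\<close> and
  those in \<open>Q\<close> to \<open>w\<close>.
\<close>

definition STU_resolve ::
    "graph \<Rightarrow> nat set \<Rightarrow> nat \<Rightarrow> nat \<Rightarrow> nat set \<Rightarrow> nat set \<Rightarrow> graph" where
  "STU_resolve G e v w P Q =
     (reattach G P v Q w)\<lparr>ext := insert w (ext G), solid := insert e (solid G)\<rparr>"

text \<open>
  \<open>STU \<kappa> S e H\<close>: an STU relation at \<open>e\<close> expresses \<open>S\<close> as \<open>H\<close>. In the first rule \<open>B\<close> is empty
  or consists of the second solid half-edge at \<open>v\<close>.
\<close>

inductive STU :: "parity_case \<Rightarrow> colored_graph \<Rightarrow> nat set \<Rightarrow> comb \<Rightarrow> bool" for \<kappa> where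
  STU_I: "STU \<kappa> S e (- gen T - gen U)"
  if "S \<in> colored_BCR \<kappa>" "T \<in> colored_BCR \<kappa>" "U \<in> colored_BCR \<kappa>"
    "STU_leg (fst S) e v w x y"
    "halves_at (fst S) (solid (fst S)) v = insert a B" "a \<notin> B" "B = {} \<or> (\<exists>b. B = {b})"
    "fst T = STU_resolve (fst S) e v w {a, x} (insert y B)"
    "fst U = STU_resolve (fst S) e v w {a, y} (insert x B)"
    "same_contraction \<kappa> e S T" "same_contraction \<kappa> e S U"
| STU_II: "STU \<kappa> S e (- gen T)"
  if "S \<in> colored_BCR \<kappa>" "T \<in> colored_BCR \<kappa>"
    "STU_leg (fst S) e v w x y"
    "halves_at (fst S) (solid (fst S)) v = {}"
    "fst T = STU_resolve (fst S) e v w {x} {y}"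
    "same_contraction \<kappa> e S T"

definition STU_rel :: "parity_case \<Rightarrow> comb set" where
  "STU_rel \<kappa> = {gen S - H | S e H. STU \<kappa> S e H}"

definition FourT_rel :: "parity_case \<Rightarrow> comb set" where
  "FourT_rel \<kappa> =
     {H - H' | S e e' H H'.
        card (int_verts (fst S)) = 1 \<and> e \<noteq> e' \<and> STU \<kappa> S e H \<and> STU \<kappa> S e' H'}"

definition R_BCR :: "parity_case \<Rightarrow> comb set" where
  "R_BCR \<kappa> = comb.span (orientation_rel (colored_BCR \<kappa>) \<union> IHX_rel \<kappa> \<union> STU_rel \<kappa>)"

definition Rc_BCR :: "parity_case \<Rightarrow> comb set" where
  "Rc_BCR \<kappa> = comb.span (orientation_rel (colored_chord \<kappa>) \<union> FourT_rel \<kappa>)"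

section \<open>Quotient spaces\<close>

text \<open>
  The elements of the quotient of \<open>V\<close> by a subspace \<open>W\<close> are the cosets \<open>x +o W\<close>. Their addition is
  the elementwise addition of sets. In the scalar multiplication, adding \<open>W\<close> only matters for the
  scalar \<open>0\<close>.
\<close>

definition quotient_space :: "comb set \<Rightarrow> comb set \<Rightarrow> comb set set" where
  "quotient_space V W = (\<lambda>x. x +o W) ` V"

definition coset_scale :: "comb set \<Rightarrow> rat \<Rightarrow> comb set \<Rightarrow> comb set" where
  "coset_scale W r C = scale r ` C + W"

lemma coset_add:
  assumes "comb.subspace W"
  shows "(x +o W) + (y +o W) = (x + y) +o W"
proof -
  have "W + W = W"
  proof
    show "W + W \<subseteq> W"
      using comb.subspace_add[OF assms] by (auto elim!: set_plus_elim)
    show "W \<subseteq> W + W"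
      using comb.subspace_0[OF assms] by (rule set_zero_plus2)
  qed
  then show ?thesis
    by (simp only: set_plus_rearrange)
qed

lemma coset_scale_coset:
  assumes "comb.subspace W"
  shows "coset_scale W r (x +o W) = scale r x +o W"
proof
  show "coset_scale W r (x +o W) \<subseteq> scale r x +o W"
  proof
    fix z assume "z \<in> coset_scale W r (x +o W)"
    then obtain u v where "u \<in> W" "v \<in> W" "z = scale r (x + u) + v"
      unfolding coset_scale_def elt_set_plus_def by (auto elim!: set_plus_elim)
    then have "z = scale r x + (scale r u + v)" "scale r u + v \<in> W"
      using comb.subspace_add[OF assms] comb.subspace_scale[OF assms]
      by (simp_all add: comb.scale_right_distrib add.assoc)
    then show "z \<in> scale r x +o W"
      unfolding elt_set_plus_def by blast
  qed
  show "scale r x +o W \<subseteq> coset_scale W r (x +o W)"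
  proof
    fix z assume "z \<in> scale r x +o W"
    then obtain v where v: "v \<in> W" "z = scale r x + v"
      unfolding elt_set_plus_def by blast
    have "x \<in> x +o W"
      using comb.subspace_0[OF assms] unfolding elt_set_plus_def by force
    then show "z \<in> coset_scale W r (x +o W)"
      unfolding coset_scale_def v(2) by (intro set_plus_intro imageI v(1))
  qed
qed

definition A_BCR :: "parity_case \<Rightarrow> comb set set" where
  "A_BCR \<kappa> = quotient_space (D_BCR \<kappa>) (R_BCR \<kappa>)"

definition Ac_BCR :: "parity_case \<Rightarrow> comb set set" where
  "Ac_BCR \<kappa> = quotient_space (Dc_BCR \<kappa>) (Rc_BCR \<kappa>)"

definition linear_iso ::
    "comb set set \<Rightarrow> (rat \<Rightarrow> comb set \<Rightarrow> comb set) \<Rightarrow>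
     comb set set \<Rightarrow> (rat \<Rightarrow> comb set \<Rightarrow> comb set) \<Rightarrow> (comb set \<Rightarrow> comb set) \<Rightarrow> bool" where
  "linear_iso Q sc Q' sc' \<phi> \<longleftrightarrow>
     bij_betw \<phi> Q Q' \<and>
     (\<forall>A\<in>Q. \<forall>B\<in>Q. \<phi> (A + B) = \<phi> A + \<phi> B) \<and>
     (\<forall>r. \<forall>A\<in>Q. \<phi> (sc r A) = sc' r (\<phi> A))"

end

theory Submission
  imports Defs
begin

text \<open>
  Surjectivity is the usual induction: by connectedness a graph with internal vertices has a dashed
  edge (a \<^emph>\<open>leg\<close>) between an external and an internal vertex, and the STU relation there
  removes one internal vertex.

  Injectivity says that \<open>Dc_BCR \<inter> R_BCR \<subseteq> Rc_BCR\<close>. Dually, every linear functional on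
  chord diagrams that vanishes on the orientation and 4T relations must extend to all graphs and vanish
  on all relations. The extension is forced: resolve the internal vertices one after the other by STU
  relations. The point is that the result does not depend on the legs chosen. By induction this reduces to
  two legs of one graph. If they end at different internal vertices, the two resolutions commute. If they
  end at the same vertex \<open>w\<close> and there is no other internal vertex, this is the 4T relation. If the third
  half-edge at \<open>w\<close> leads to an external vertex and there are further internal vertices, compare both
  legs with a leg ending elsewhere. Finally, if it leads to an internal vertex, resolving at \<open>w\<close> and then there
  gives a double commutator; the Jacobi identity expresses the resolution at either leg by the
  resolutions of the two other graphs of the IHX triple, for which the legs end at different vertices. The
  same Jacobi identity shows that the extension vanishes on the IHX relations.

  Signs are under control because a resolved graph has the same vertices and edges as the original one, and
  comparing contractions along the resolved edge amounts to keeping the coloring.\<close>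

section \<open>Signs of changes of coloring\<close>


text \<open>Independence of the legs (\<open>resolvable n\<close>: all STU relations for graphs with
  \<open>Suc n\<close> internal vertices) cannot be proved alone. The data of a leg leave choices,
  namely the order of \<open>x\<close>, \<open>y\<close> and the solid half-edge that moves, and
  different choices give graphs that are only isomorphic. So it is proved together with
  compatibility with isomorphisms (\<open>invariant n\<close>). Conversely
  \<open>invariant (Suc n)\<close> rests on \<open>resolvable n\<close>, because an isomorphism need
  not match the legs picked in the two graphs. IHX is deduced after this induction; inside it the
  Jacobi identity takes its place. Once contractions are compared, two sign facts suffice, and they
  agree in the odd and the even case: reversing an edge together with exchanging its endpoints is an
  even change, exchanging two edges together with two vertices is an odd one. The first gives the
  symmetries of a new solid edge and of an internal edge, the second the cancellation in the Jacobi
  identity.\<close>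

lemma card_2_other:
  assumes "card A = 2" "a \<in> A"
  obtains b where "A = {a, b}" "a \<noteq> b"
  using assms by (metis card_2_iff insert_commute insert_iff singletonD)

text \<open>\<open>relabelling A l l'\<close> is the conjugate of \<pi> by the labelling
  \<open>l\<close>, extended by the identity, and conjugation keeps the sign. This moves sign
  computations from labels to vertices or edges.\<close>

lemma sign_relabelling:
  assumes "finite A" "inj_on l A" "\<pi> permutes A" "\<And>a. a \<in> A \<Longrightarrow> l' a = l (\<pi> a)"
  shows "sign (relabelling A l l') = sign \<pi>"
proof -
  have "relabelling A l l' = map_permutation A l \<pi>"
    using assms(4) by (auto simp: fun_eq_iff relabelling_def map_permutation_def restrict_id_def
        inv_into_into)
  then show ?thesis
    using sign_map_permutation[OF assms(2,3,1)] by simp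
qed

lemma relabelling_permutation:
  assumes "bij_betw l A B" "bij_betw l' A B"
  obtains \<pi> where "\<pi> permutes A" "\<And>a. a \<in> A \<Longrightarrow> l' a = l (\<pi> a)"
proof
  let ?\<pi> = "\<lambda>a. if a \<in> A then inv_into A l (l' a) else a"
  have "bij_betw (inv_into A l \<circ> l') A A"
    using bij_betw_trans[OF assms(2) bij_betw_inv_into[OF assms(1)]] .
  then have "bij_betw ?\<pi> A A"
    by (subst bij_betw_cong[where g = "inv_into A l \<circ> l'"]) auto
  then show "?\<pi> permutes A"
    by (rule bij_imp_permutes) auto
  show "l' a = l (?\<pi> a)" if "a \<in> A" for a
  proof -
    have "l' a \<in> l ` A"
      using that assms by (auto simp: bij_betw_def)
    then show ?thesis
      using that by (simp add: f_inv_into_f)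
  qed
qed

lemma permutes_sign_compose:
  assumes "finite A" "\<pi> permutes A" "\<rho> permutes A"
  shows "sign (\<pi> \<circ> \<rho>) = sign \<pi> * sign \<rho>"
  using assms permutation_permutes sign_compose by blast

lemma sign_relabelling_trans:
  assumes "finite A" "bij_betw l A B" "bij_betw l' A B" "bij_betw l'' A B"
  shows "sign (relabelling A l l'') = sign (relabelling A l l') * sign (relabelling A l' l'')"
proof -
  obtain \<pi> where \<pi>: "\<pi> permutes A" "\<And>a. a \<in> A \<Longrightarrow> l' a = l (\<pi> a)"
    using relabelling_permutation assms by blast
  obtain \<rho> where \<rho>: "\<rho> permutes A" "\<And>a. a \<in> A \<Longrightarrow> l'' a = l' (\<rho> a)"
    using relabelling_permutation assms by blast
  have "l'' a = l ((\<pi> \<circ> \<rho>) a)" if "a \<in> A" for a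
    using that \<rho> \<pi>(2) permutes_in_image[OF \<rho>(1)] by auto
  then have "sign (relabelling A l l'') = sign (\<pi> \<circ> \<rho>)"
    using assms \<pi> \<rho> by (intro sign_relabelling) (auto simp: bij_betw_def permutes_compose)
  moreover have "sign (relabelling A l l') = sign \<pi>" "sign (relabelling A l' l'') = sign \<rho>"
    using assms \<pi> \<rho> by (auto intro!: sign_relabelling simp: bij_betw_def)
  ultimately show ?thesis
    using permutes_sign_compose[OF assms(1) \<pi>(1) \<rho>(1)] by simp
qed

lemma minus_one_power_card:
  assumes "finite E"
  shows "(- 1 :: int) ^ card {e \<in> E. P e} = (\<Prod>e\<in>E. if P e then - 1 else 1)"
  using assms by (simp add: prod.If_cases Int_def)

text \<open>An edge has only two half-edges, so its tail differs between the first and the last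
  choice exactly when it changes in one of the two steps and not in the other.\<close>

lemma minus_one_power_card_trans:
  assumes "finite E" "\<And>e. e \<in> E \<Longrightarrow> card e = 2"
    and "\<And>e. e \<in> E \<Longrightarrow> t e \<in> e" "\<And>e. e \<in> E \<Longrightarrow> t' e \<in> e" "\<And>e. e \<in> E \<Longrightarrow> t'' e \<in> e"
  shows "(- 1 :: int) ^ card {e \<in> E. t'' e \<noteq> t e} =
    (- 1) ^ card {e \<in> E. t' e \<noteq> t e} * (- 1) ^ card {e \<in> E. t'' e \<noteq> t' e}"
  unfolding minus_one_power_card[OF assms(1)] prod.distrib[symmetric]
proof (rule prod.cong[OF refl])
  fix e assume e: "e \<in> E"
  obtain a b where "e = {a, b}"
    using assms(2)[OF e] by (auto simp: card_2_iff)
  then have "t e = a \<or> t e = b" "t' e = a \<or> t' e = b" "t'' e = a \<or> t'' e = b"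
    using assms(3-5)[OF e] by auto
  then show "(if t'' e \<noteq> t e then - 1 else 1 :: int) =
      (if t' e \<noteq> t e then - 1 else 1) * (if t'' e \<noteq> t' e then - 1 else 1)"
    by auto
qed

lemma is_coloring_cong:
  assumes "verts G' = verts G" "edges G' = edges G"
  shows "is_coloring \<kappa> G' c = is_coloring \<kappa> G c"
  using assms by (cases \<kappa>; cases c) auto

lemma change_sign_cong:
  assumes "verts G' = verts G" "edges G' = edges G"
  shows "change_sign G' f g c c' = change_sign G f g c c'"
  using assms by (cases c; cases c') auto

lemma is_coloring_cases:
  assumes "is_coloring \<kappa> G c"
  obtains l t where "\<kappa> = Odd_Case" "c = Odd_Col l t"
    "bij_betw l (verts G) {1..card (verts G)}" "\<And>e. e \<in> edges G \<Longrightarrow> t e \<in> e"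
  | n where "\<kappa> = Even_Case" "c = Even_Col n" "bij_betw n (edges G) {1..card (edges G)}"
  using assms by (cases \<kappa>; cases c) auto

lemma wf_graph_att:
  assumes "wf_graph G" "e \<in> edges G"
  shows "att G ` e \<subseteq> verts G"
proof -
  have "att G ` e \<subseteq> att G ` \<Union>(edges G)"
    using assms(2) by (intro image_mono) auto
  also have "\<dots> \<subseteq> verts G"
    using assms(1) by (simp add: wf_graph_def)
  finally show ?thesis .
qed

lemma change_sign_trans:
  assumes "wf_graph G" "is_coloring \<kappa> G c" "is_coloring \<kappa> G c'" "is_coloring \<kappa> G c''"
  shows "change_sign G id id c c'' = change_sign G id id c c' * change_sign G id id c' c''"
proof -
  have fin: "finite (verts G)" "finite (edges G)" "\<And>e. e \<in> edges G \<Longrightarrow> card e = 2"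
    using assms(1) by (auto simp: wf_graph_def)
  show ?thesis
  proof (cases \<kappa>)
    case Odd_Case
    with assms obtain l t l' t' l'' t'' where c: "c = Odd_Col l t" "c' = Odd_Col l' t'" "c'' = Odd_Col l'' t''"
      by (cases c; cases c'; cases c'') auto
    show ?thesis
      using assms(2-4) sign_relabelling_trans[OF fin(1), of l "{1..card (verts G)}" l' l'']
        minus_one_power_card_trans[OF fin(2,3), of t t' t'']
      by (simp add: Odd_Case c)
  next
    case Even_Case
    with assms obtain n n' n'' where c: "c = Even_Col n" "c' = Even_Col n'" "c'' = Even_Col n''"
      by (cases c; cases c'; cases c'') auto
    show ?thesis
      using assms(2-4) sign_relabelling_trans[OF fin(2), of n "{1..card (edges G)}" n' n'']
      by (simp add: Even_Case c)
  qed
qed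

lemma change_sign_squared:
  assumes "is_coloring \<kappa> G c" "is_coloring \<kappa> G c'"
  shows "change_sign G f g c c' * change_sign G f g c c' = 1"
proof -
  have "(- 1 :: int) ^ k * (- 1) ^ k = 1" for k :: nat
    by (simp flip: power_add)
  then show ?thesis
    using assms by (cases \<kappa>; cases c; cases c') (auto simp: algebra_simps)
qed

lemma change_sign_refl:
  assumes "wf_graph G" "is_coloring \<kappa> G c"
  shows "change_sign G id id c c = 1"
  using change_sign_trans[OF assms assms(2,2)] change_sign_squared[OF assms(2,2)] by metis

lemma change_sign_sym:
  assumes "wf_graph G" "is_coloring \<kappa> G c" "is_coloring \<kappa> G c'"
  shows "change_sign G id id c' c = change_sign G id id c c'"
proof -
  have "change_sign G id id c c' * change_sign G id id c' c = 1"
    using change_sign_trans[OF assms assms(2)] change_sign_refl[OF assms(1,2)] by simp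
  moreover have "change_sign G id id c c' * change_sign G id id c c' = 1"
    using change_sign_squared[OF assms(2,3)] .
  ultimately show ?thesis
    by (metis mult_left_cancel zero_neq_one mult_zero_left)
qed

section \<open>Signs under contraction\<close>

lemma minus_one_power_card_remove:
  assumes "finite E" "e \<in> E"
  shows "(- 1 :: int) ^ card {d \<in> E. P d} = (if P e then - 1 else 1) * (- 1) ^ card {d \<in> E - {e}. P d}"
  using assms by (simp add: minus_one_power_card prod.remove)

text \<open>Both colorings single out the same two endpoints, or the same edge, so the permutation
  relating them descends to the collapsed graph. In the odd case it may exchange the endpoints. The
  contraction loses this sign, but then the tail of \<open>e\<close> changes as well, and the
  contraction loses that sign too.\<close>

lemma change_sign_collapse:
  assumes "wf_graph G" "is_coloring \<kappa> G c" "is_coloring \<kappa> G c'" "e \<in> edges G"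
    and "adapted G e c" "adapted G' e c'" "\<And>k. k \<in> e \<Longrightarrow> att G' k = att G k" "card (att G ` e) = 2"
  shows "change_sign (collapse G e) id id (collapse_coloring G e c) (collapse_coloring G' e c') =
    change_sign G id id c c'"
proof -
  have fin: "finite (verts G)" "finite (edges G)"
    using assms(1) by (auto simp: wf_graph_def)
  have im: "att G' ` e = att G ` e" and mg: "merged G' e = merged G e"
    using assms(7) by (auto simp: merged_def)
  define m where "m = merged G e"
  obtain v w where vw: "att G ` e = {v, w}" "v \<noteq> w" "m = v"
  proof -
    have "finite (att G ` e)" "att G ` e \<noteq> {}"
      using assms(8) by (auto intro: card_ge_0_finite)
    then have "m \<in> att G ` e"
      unfolding m_def merged_def by (rule Min_in)
    then show ?thesis
      using that card_2_other[OF assms(8)] m_def by metis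
  qed
  have V: "v \<in> verts G" "w \<in> verts G"
    using vw(1) wf_graph_att[OF assms(1,4)] by auto
  show ?thesis
  proof (cases \<kappa>)
    case Odd_Case
    with assms(2,3) obtain l t l' t' where c: "c = Odd_Col l t" "c' = Odd_Col l' t'"
      by (cases c; cases c') auto
    have l: "bij_betw l (verts G) {1..card (verts G)}" "bij_betw l' (verts G) {1..card (verts G)}"
      and t: "t e \<in> e" "t' e \<in> e"
      using assms(2-4) by (auto simp: c Odd_Case)
    obtain \<pi> where \<pi>: "\<pi> permutes verts G" "\<And>a. a \<in> verts G \<Longrightarrow> l' a = l (\<pi> a)"
      using relabelling_permutation l by blast
    have ad: "l (att G (t e)) = 1" "l ` {v, w} = {1, 2}" "l' (att G (t' e)) = 1" "l' ` {v, w} = {1, 2}"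
      using assms(5,6) t assms(7) by (auto simp: c im vw)
    have att_t: "att G (t e) \<in> {v, w}" "att G (t' e) \<in> {v, w}"
      using t vw by auto
    have lv: "(l v = 1 \<and> l w = 2) \<or> (l v = 2 \<and> l w = 1)" "(l' v = 1 \<and> l' w = 2) \<or> (l' v = 2 \<and> l' w = 1)"
      using ad by (auto simp: doubleton_eq_iff)
    have inj: "l a = l b \<longleftrightarrow> a = b" if "a \<in> verts G" "b \<in> verts G" for a b
      using l(1) that by (auto simp: bij_betw_def inj_on_def)
    \<comment> \<open>The permutation corrected so that it fixes both endpoints; only then does it
      restrict to the vertices of the collapsed graph, where \<open>w\<close> is missing.\<close>
    define \<pi>' where "\<pi>' = (if \<pi> v = v then \<pi> else \<pi> \<circ> transpose v w)"
    have \<pi>in: "\<pi> a \<in> verts G" if "a \<in> verts G" for a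
      using that permutes_in_image[OF \<pi>(1)] by auto
    have pv: "(\<pi> v = v \<and> \<pi> w = w) \<or> (\<pi> v = w \<and> \<pi> w = v)"
    proof -
      have "l (\<pi> v) = l v \<or> l (\<pi> v) = l w" "l (\<pi> w) = l v \<or> l (\<pi> w) = l w"
        using lv \<pi>(2)[OF V(1)] \<pi>(2)[OF V(2)] by auto
      then have "\<pi> v = v \<or> \<pi> v = w" "\<pi> w = v \<or> \<pi> w = w"
        using inj \<pi>in V by auto
      moreover have "\<pi> v \<noteq> \<pi> w"
        using permutes_inj[OF \<pi>(1)] vw(2) by (auto simp: inj_def)
      ultimately show ?thesis by auto
    qed
    have fix': "\<pi>' v = v" "\<pi>' w = w"
      using pv vw(2) by (auto simp: \<pi>'_def)
    have off: "\<pi>' a = \<pi> a" if "a \<noteq> v" "a \<noteq> w" for a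
      using that by (auto simp: \<pi>'_def transpose_def)
    have "\<pi>' permutes verts G"
      using \<pi>(1) V by (auto simp: \<pi>'_def intro: permutes_compose permutes_swap_id)
    moreover define V' where "V' = insert m (verts G - {v, w})"
    ultimately have \<pi>': "\<pi>' permutes V'"
      using fix' vw(3) by (auto intro: permutes_superset)
    have sgn: "sign \<pi>' = (if \<pi> v = v then 1 else - 1) * sign \<pi>"
      using permutes_sign_compose[OF fin(1) \<pi>(1) permutes_swap_id[OF V]] vw(2)
      by (auto simp: \<pi>'_def sign_swap_id)
    let ?d = "\<lambda>v. if v = merged G e then 1 else l v - 1"
    let ?d' = "\<lambda>v. if v = merged G e then 1 else l' v - 1"
    \<comment> \<open>The merged vertex gets label 1 and any other vertex \<open>l a - 1\<close>. As
      \<open>l a\<close> is at least 3, the shifted labels are at least 2 and cannot collide with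
      it.\<close>
    have ge: "l a \<ge> 3" if "a \<in> verts G" "a \<noteq> v" "a \<noteq> w" for a
    proof -
      have "l a \<noteq> 1" "l a \<noteq> 2"
        using lv inj[OF that(1) V(1)] inj[OF that(1) V(2)] that(2,3) by auto
      moreover have "l a \<ge> 1"
        using l(1) that(1) by (auto simp: bij_betw_def)
      ultimately show ?thesis by linarith
    qed
    have inj': "inj_on ?d V'"
    proof (rule inj_onI)
      fix a b assume ab: "a \<in> V'" "b \<in> V'" "?d a = ?d b"
      consider "a = v" "b = v" | "a \<in> verts G - {v,w}" "b = v" | "a = v" "b \<in> verts G - {v,w}"
        | "a \<in> verts G - {v,w}" "b \<in> verts G - {v,w}"
        using ab vw(3) by (auto simp: V'_def)
      then show "a = b"
      proof cases
        case 4
        then have "l a = l b"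
          using ab(3) ge[of a] ge[of b] vw(3) by (auto simp: m_def)
        then show ?thesis using inj 4 by auto
      qed (use ab ge[of a] ge[of b] vw(3) in \<open>auto simp: m_def\<close>)
    qed
    have "sign (relabelling V' ?d ?d') = sign \<pi>'"
    proof (rule sign_relabelling[OF _ inj' \<pi>'])
      show "finite V'" using fin by (auto simp: V'_def)
      fix a assume a: "a \<in> V'"
      show "?d' a = ?d (\<pi>' a)"
      proof (cases "a = v")
        case True
        then show ?thesis using fix' vw(3) by (simp add: m_def)
      next
        case False
        then have "a \<in> verts G" "a \<noteq> w"
          using a vw(3) by (auto simp: V'_def)
        moreover have "\<pi>' a \<noteq> v"
          using False fix'(1) permutes_inj[OF \<pi>'] by (metis injD)
        ultimately show ?thesis
          using False \<pi>(2) off vw(3) by (auto simp: m_def)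
      qed
    qed
    moreover have "sign (relabelling (verts G) l l') = sign \<pi>"
      using l \<pi> fin by (auto intro!: sign_relabelling simp: bij_betw_def)
    \<comment> \<open>An adapted coloring has the tail of \<open>e\<close> at the vertex labelled 1,
      so the tail is reversed exactly when the endpoints exchange labels. This factor cancels the
      one in \<open>sgn\<close>.\<close>
    moreover have "t' e = t e \<longleftrightarrow> \<pi> v = v"
    proof -
      have "card e = 2"
        using assms(1,4) by (auto simp: wf_graph_def)
      then have "inj_on (att G) e"
        using assms(8) by (intro eq_card_imp_inj_on) (auto intro: card_ge_0_finite)
      then have "t' e = t e \<longleftrightarrow> att G (t' e) = att G (t e)"
        using t by (auto simp: inj_on_def)
      also have "\<dots> \<longleftrightarrow> \<pi> v = v"
        using ad(1,3) att_t lv pv \<pi>(2)[OF V(1)] \<pi>(2)[OF V(2)] vw(2) by auto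
      finally show ?thesis .
    qed
    ultimately show ?thesis
      using minus_one_power_card_remove[OF fin(2) assms(4), of "\<lambda>d. t' d \<noteq> t d"] sgn vw(1)
      by (auto simp: c collapse_def V'_def m_def im mg id_def)
  next
    case Even_Case
    with assms(2,3) obtain n n' where c: "c = Even_Col n" "c' = Even_Col n'"
      by (cases c; cases c') auto
    have n: "bij_betw n (edges G) {1..card (edges G)}" "bij_betw n' (edges G) {1..card (edges G)}"
      using assms(2,3) by (auto simp: c Even_Case)
    obtain \<pi> where \<pi>: "\<pi> permutes edges G" "\<And>a. a \<in> edges G \<Longrightarrow> n' a = n (\<pi> a)"
      using relabelling_permutation n by blast
    have ad: "n e = 1" "n' e = 1"
      using assms(5,6) by (auto simp: c)
    have inj: "n a = n b \<longleftrightarrow> a = b" if "a \<in> edges G" "b \<in> edges G" for a b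
      using n(1) that by (auto simp: bij_betw_def inj_on_def)
    have "n (\<pi> e) = n e"
      using \<pi>(2)[OF assms(4)] ad by simp
    then have \<pi>e: "\<pi> e = e"
      using inj assms(4) permutes_in_image[OF \<pi>(1)] by blast
    have \<pi>': "\<pi> permutes (edges G - {e})"
      using \<pi>(1) \<pi>e unfolding permutes_def by auto
    have pos: "n a \<ge> 1" if "a \<in> edges G" for a
      using n(1) that by (auto simp: bij_betw_def)
    have "sign (relabelling (edges G - {e}) (\<lambda>e. n e - 1) (\<lambda>e. n' e - 1)) = sign \<pi>"
    proof (rule sign_relabelling[OF _ _ \<pi>'])
      show "inj_on (\<lambda>e. n e - 1) (edges G - {e})"
        using inj pos by (intro inj_onI) (metis DiffD1 diff_add_inverse2 le_add_diff_inverse2)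
    qed (use fin \<pi> in auto)
    moreover have "sign (relabelling (edges G) n n') = sign \<pi>"
      using n \<pi> fin by (auto intro!: sign_relabelling simp: bij_betw_def)
    ultimately show ?thesis
      by (auto simp: c collapse_def)
  qed
qed

lemma contractionI:
  assumes "is_coloring \<kappa> G c'" "adapted G e c'"
  shows "contraction \<kappa> e (G, c) (change_sign G id id c c') (collapse G e, collapse_coloring G e c')"
  using assms unfolding contraction_def by auto

text \<open>
  In the relations all graphs may therefore be given the same coloring.\<close>

lemma same_contractionD:
  assumes "wf_graph G" "verts G' = verts G" "edges G' = edges G"
    and "is_coloring \<kappa> G c" "is_coloring \<kappa> G' c'" "e \<in> edges G" "card (att G ` e) = 2"
    and att: "\<And>k. k \<in> e \<Longrightarrow> att G' k = att G k"
    and same: "same_contraction \<kappa> e (G, c) (G', c')"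
  shows "change_sign G id id c c' = 1"
proof -
  obtain d d' where d: "is_coloring \<kappa> G d" "adapted G e d" "is_coloring \<kappa> G' d'" "adapted G' e d'"
    and s: "change_sign G id id c d * change_sign G' id id c' d' *
      change_sign (collapse G e) id id (collapse_coloring G e d) (collapse_coloring G' e d') = 1"
    using same unfolding same_contraction_def contraction_def by fast
  have col: "is_coloring \<kappa> G c'" "is_coloring \<kappa> G d'"
    using assms d is_coloring_cong by metis+
  have "change_sign (collapse G e) id id (collapse_coloring G e d) (collapse_coloring G' e d') =
      change_sign G id id d d'"
    using change_sign_collapse[OF assms(1) d(1) col(2) assms(6) d(2,4) att assms(7)] by simp
  then have "1 = change_sign G id id c d * change_sign G id id c' d' * change_sign G id id d d'"
    using s change_sign_cong[OF assms(2,3)] by simp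
  also have "\<dots> = change_sign G id id c c'"
    using change_sign_trans[OF assms(1,4) d(1) col(1)] change_sign_trans[OF assms(1) d(1) col(2) col(1)]
      change_sign_sym[OF assms(1) col(1) col(2)] by (simp add: algebra_simps)
  finally show ?thesis by simp
qed

text \<open>Only adaptedness is at stake: the sign of the change to the new coloring is recorded by
  \<open>contraction\<close>. In the odd case the tails are kept and the vertices relabelled; in the
  even case \<open>e\<close> trades numbers with the edge numbered 1.\<close>

lemma adapted_coloring_exists:
  assumes "wf_graph G" "is_coloring \<kappa> G c" "e \<in> edges G" "card (att G ` e) = 2"
  obtains d where "is_coloring \<kappa> G d" "adapted G e d"
proof -
  have fin: "finite (verts G)" "finite (edges G)"
    using assms(1) by (auto simp: wf_graph_def)
  show ?thesis
  proof (cases \<kappa>)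
    case Odd_Case
    with assms(2) obtain l t where c: "c = Odd_Col l t"
      by (cases c) auto
    have l: "bij_betw l (verts G) {1..card (verts G)}" and t: "\<And>e. e \<in> edges G \<Longrightarrow> t e \<in> e"
      using assms(2) by (auto simp: c Odd_Case)
    define v where "v = att G (t e)"
    have "v \<in> att G ` e"
      using t[OF assms(3)] by (auto simp: v_def)
    then obtain w where vw: "att G ` e = {v, w}" "v \<noteq> w"
      using card_2_other[OF assms(4)] by metis
    have V: "v \<in> verts G" "w \<in> verts G"
      using vw(1) wf_graph_att[OF assms(1,3)] by auto
    have "card {v, w} \<le> card (verts G)"
      using V fin by (intro card_mono) auto
    then have n: "2 \<le> card (verts G)"
      using vw(2) by simp
    have "card (verts G - {v, w}) = card {3..card (verts G)}"
      using V vw(2) n by (simp add: card_Diff_subset)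
    then obtain f where f: "bij_betw f (verts G - {v, w}) {3..card (verts G)}"
      using fin by (meson finite_Diff finite_atLeastAtMost finite_same_card_bij)
    let ?l = "\<lambda>a. if a = v then 1 else if a = w then 2 else f a"
    have "bij_betw ?l (verts G - {v, w}) {3..card (verts G)}"
      using f by (subst bij_betw_cong[where g = f]) auto
    moreover have "bij_betw ?l {v, w} {1, 2}"
      using vw(2) by (auto simp: bij_betw_def)
    ultimately have "bij_betw ?l ((verts G - {v, w}) \<union> {v, w}) ({3..card (verts G)} \<union> {1, 2})"
      by (rule bij_betw_combine) auto
    moreover have "(verts G - {v, w}) \<union> {v, w} = verts G" "{3..card (verts G)} \<union> {1, 2} = {1..card (verts G)}"
      using V n by auto
    ultimately have "bij_betw ?l (verts G) {1..card (verts G)}"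
      by metis
    then show ?thesis
      using that[of "Odd_Col ?l t"] t vw by (auto simp: Odd_Case v_def)
  next
    case Even_Case
    with assms(2) obtain n where c: "c = Even_Col n"
      by (cases c) auto
    have n: "bij_betw n (edges G) {1..card (edges G)}"
      using assms(2) by (auto simp: c Even_Case)
    have "1 \<in> {1..card (edges G)}"
      using assms(3) fin(2) by (auto simp: Suc_le_eq card_gt_0_iff)
    then obtain e1 where e1: "e1 \<in> edges G" "n e1 = 1"
      using n unfolding bij_betw_def by (metis imageE)
    have "bij_betw (n \<circ> transpose e e1) (edges G) {1..card (edges G)}"
      using permutes_imp_bij[OF permutes_swap_id[OF assms(3) e1(1)]] n by (rule bij_betw_trans)
    then show ?thesis
      using that[of "Even_Col (n \<circ> transpose e e1)"] e1 by (auto simp: Even_Case)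
  qed
qed

text \<open>One coloring \<open>d\<close> adapted to \<open>e\<close> in both graphs serves for both
  contractions; the two recoloring signs are equal and cancel.\<close>

lemma same_contractionI:
  assumes "wf_graph G" "verts G' = verts G" "edges G' = edges G"
    and "is_coloring \<kappa> G c" "e \<in> edges G" "card (att G ` e) = 2"
    and att: "\<And>k. k \<in> e \<Longrightarrow> att G' k = att G k"
    and iso: "graph_iso (collapse G e) (collapse G' e) id id"
  shows "same_contraction \<kappa> e (G, c) (G', c)"
proof -
  obtain d where d: "is_coloring \<kappa> G d" "adapted G e d"
    using adapted_coloring_exists[OF assms(1,4,5,6)] .
  have im: "att G' ` e = att G ` e"
    using att by auto
  have t: "tail d e \<in> e" if "\<kappa> = Odd_Case"
    using that d(1) assms(5) by (cases d) auto
  have d': "is_coloring \<kappa> G' d" "adapted G' e d"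
    using d is_coloring_cong[OF assms(2,3)] t att im by (cases d; cases \<kappa>; auto)+
  have "change_sign G id id c d * change_sign G' id id c d *
      change_sign (collapse G e) id id (collapse_coloring G e d) (collapse_coloring G' e d) = 1"
    using change_sign_collapse[OF assms(1) d(1,1) assms(5) d(2) d'(2) att assms(6)]
      change_sign_refl[OF assms(1) d(1)] change_sign_squared[OF assms(4) d(1)]
      change_sign_cong[OF assms(2,3)] by simp
  then show ?thesis
    unfolding same_contraction_def using contractionI[OF d] contractionI[OF d'] iso by blast
qed


section \<open>Half-edges, legs and resolutions\<close>

text \<open>
  Vertices and half-edges are numbers, so the simplifier would otherwise run linear arithmetic on the many
  disequalities between them.\<close>

declare [[linarith_neq_limit = 1, simproc del: fast_arith_nat]]

lemma wf_graph_edge_unique: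
  assumes "wf_graph G" "e \<in> edges G" "e' \<in> edges G" "k \<in> e" "k \<in> e'"
  shows "e = e'"
  using assms unfolding wf_graph_def by blast

lemma wf_graph_solid_dashed:
  assumes "wf_graph G" "k \<in> \<Union>(solid G)"
  shows "k \<notin> \<Union>(dashed G)"
proof
  assume "k \<in> \<Union>(dashed G)"
  then obtain e e' where "k \<in> e" "k \<in> e'" "e \<in> solid G" "e' \<in> edges G" "e' \<notin> solid G"
    using assms(2) by (auto simp: dashed_def)
  moreover have "e \<in> edges G"
    using assms(1) \<open>e \<in> solid G\<close> by (auto simp: wf_graph_def)
  ultimately show False
    using wf_graph_edge_unique[OF assms(1)] by metis
qed

lemma wf_graph_edges_Un: "wf_graph G \<Longrightarrow> edges G = dashed G \<union> solid G"
  by (auto simp: wf_graph_def dashed_def)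

lemma halves_at_edges: "wf_graph G \<Longrightarrow> halves_at G (edges G) v = halves_at G (dashed G) v \<union> halves_at G (solid G) v"
  using wf_graph_edges_Un[of G] by (auto simp: halves_at_def)

lemma wf_graph_edgeE:
  assumes "wf_graph G" "k \<in> \<Union>(edges G)"
  obtains k' where "{k, k'} \<in> edges G" "k \<noteq> k'"
proof -
  obtain e where e: "e \<in> edges G" "k \<in> e"
    using assms(2) by blast
  then have "card e = 2"
    using assms(1) by (auto simp: wf_graph_def)
  then show ?thesis
    using e that card_2_other[of e k] by metis
qed

lemma wf_graph_edge_neq:
  assumes "wf_graph G" "{k, k'} \<in> edges G"
  shows "k \<noteq> k'"
  using assms by (auto simp: wf_graph_def)

lemma wf_graph_finite_halves:
  assumes "wf_graph G" "F \<subseteq> edges G"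
  shows "finite (halves_at G F v)"
proof -
  have "finite e" if "e \<in> edges G" for e
    using assms(1) that by (intro card_ge_0_finite) (auto simp: wf_graph_def)
  then have "finite (\<Union>(edges G))"
    using assms(1) by (auto simp: wf_graph_def)
  then show ?thesis
    using assms(2) by (elim rev_finite_subset) (auto simp: halves_at_def)
qed

lemma BCR_wf: "BCR_graph G \<Longrightarrow> wf_graph G"
  by (simp add: BCR_graph_def)

lemma BCR_internal_dashed:
  assumes "BCR_graph G" "k \<in> \<Union>(edges G)" "att G k \<in> int_verts G"
  shows "k \<in> \<Union>(dashed G)" "k \<notin> \<Union>(solid G)"
proof -
  have "halves_at G (solid G) (att G k) = {}"
    using assms(1,3) by (auto simp: BCR_graph_def)
  then show "k \<notin> \<Union>(solid G)"
    by (auto simp: halves_at_def)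
  then show "k \<in> \<Union>(dashed G)"
    using assms(2) wf_graph_edges_Un[OF BCR_wf[OF assms(1)]] by auto
qed

lemma BCR_dashed_unique:
  assumes "BCR_graph G" "k \<in> \<Union>(dashed G)" "k' \<in> \<Union>(dashed G)" "att G k = att G k'" "att G k \<in> ext G"
  shows "k = k'"
proof -
  have "card (halves_at G (dashed G) (att G k)) = 1"
    using assms by (auto simp: BCR_graph_def)
  then obtain z where "halves_at G (dashed G) (att G k) = {z}"
    by (auto simp: card_1_singleton_iff)
  then have "k \<in> {z}" "k' \<in> {z}"
    using assms by (auto simp: halves_at_def)
  then show ?thesis by simp
qed

text \<open>Half-edges move only between the two ends of \<open>{h, h'}\<close>, and this edge stays
  in place, so every old edge is replaced by a walk that may also use \<open>{h, h'}\<close>. This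
  covers resolutions as well as the exchanges of an IHX triple.\<close>

lemma connected_reattach:
  assumes "connected_graph G" "verts G' = verts G" "edges G' = edges G" "{h, h'} \<in> edges G"
    and "att G' h = att G h" "att G' h' = att G h'"
    and "\<And>k. k \<in> \<Union>(edges G) \<Longrightarrow> att G' k = att G k \<or> {att G k, att G' k} \<subseteq> {att G h, att G h'}"
  shows "connected_graph G'"
proof -
  let ?R = "\<lambda>G. \<Union>e\<in>edges G. att G ` e \<times> att G ` e"
  have hh: "(p, q) \<in> ?R G'" if "{p, q} \<subseteq> {att G h, att G h'}" for p q
    using that assms(3-6) by (auto intro!: bexI[of _ "{h, h'}"])
  have step: "(att G k, att G' k) \<in> (?R G')\<^sup>*" "(att G' k, att G k) \<in> (?R G')\<^sup>*" if "k \<in> \<Union>(edges G)" for k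
    using assms(7)[OF that] hh[of "att G k" "att G' k"] hh[of "att G' k" "att G k"] by auto
  have "?R G \<subseteq> (?R G')\<^sup>*"
  proof clarify
    fix e k l assume e: "e \<in> edges G" "k \<in> e" "l \<in> e"
    have "(att G' k, att G' l) \<in> ?R G'"
      using e assms(3) by auto
    then show "(att G k, att G l) \<in> (?R G')\<^sup>*"
      using step(1)[of k] step(2)[of l] e by (meson UnionI rtrancl_trans rtrancl_into_rtrancl)
  qed
  then have "(?R G)\<^sup>* \<subseteq> (?R G')\<^sup>*"
    using rtrancl_subset_rtrancl by blast
  then show ?thesis
    using assms(1,2) unfolding connected_graph_def by blast
qed

text \<open>A walk from \<open>u\<close> to \<open>v\<close> starts in \<open>C\<close> and ends
  outside, so one of its edges leaves \<open>C\<close>.\<close>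

lemma connected_boundary_edge:
  assumes "connected_graph G" "wf_graph G" "u \<in> C" "u \<in> verts G" "v \<in> verts G" "v \<notin> C"
  obtains k k' where "{k, k'} \<in> edges G" "att G k \<in> C" "att G k' \<notin> C"
proof -
  let ?R = "\<Union>e\<in>edges G. att G ` e \<times> att G ` e"
  have "(u, v) \<in> ?R\<^sup>*"
    using assms by (auto simp: connected_graph_def)
  then have "\<exists>p q. (p, q) \<in> ?R \<and> p \<in> C \<and> q \<notin> C"
    using assms(3,6) by (induction rule: rtrancl_induct) blast+
  then obtain e k l where e: "e \<in> edges G" "k \<in> e" "l \<in> e" "att G k \<in> C" "att G l \<notin> C"
    by auto
  moreover have "e = {k, l}"
    using e assms(2) card_2_other[of e k] by (auto simp: wf_graph_def)
  ultimately show ?thesis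
    using that by auto
qed

section \<open>Broken lines as vertex lists\<close>

fun path_edges :: "nat list \<Rightarrow> nat set set" where
  "path_edges [] = {}"
| "path_edges [u] = {}"
| "path_edges (u # v # p) = insert {u, v} (path_edges (v # p))"

text \<open>Links the indexed pairs used to define broken lines with the recursive form, which is
  suited to splitting and reversing a path.\<close>

lemma path_edges_conv_nth: "path_edges p = {{p ! i, p ! Suc i} | i. Suc i < length p}"
proof (induction p rule: path_edges.induct)
  case (3 u v p)
  have "{{(u # v # p) ! i, (u # v # p) ! Suc i} | i. Suc i < length (u # v # p)} =
      insert {u, v} {{(v # p) ! i, (v # p) ! Suc i} | i. Suc i < length (v # p)}" (is "?A = insert _ ?B")
  proof (intro equalityI subsetI)
    fix z assume "z \<in> ?A"
    then obtain i where i: "Suc i < length (u # v # p)" "z = {(u # v # p) ! i, (u # v # p) ! Suc i}"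
      by blast
    then show "z \<in> insert {u, v} ?B"
      by (cases i) auto
  next
    fix z assume "z \<in> insert {u, v} ?B"
    then consider "z = {u, v}" | i where "Suc i < length (v # p)" "z = {(v # p) ! i, (v # p) ! Suc i}"
      by blast
    then show "z \<in> ?A"
    proof cases
      case 1
      then show ?thesis by (auto intro!: exI[of _ 0])
    next
      case 2
      then show ?thesis by (auto intro!: exI[of _ "Suc i"])
    qed
  qed
  then show ?case
    using 3 by simp
qed auto

lemma path_edges_append: "path_edges (l @ v # r) = path_edges (l @ [v]) \<union> path_edges (v # r)"
  by (induction l rule: path_edges.induct) auto

lemma path_edges_rev: "path_edges (rev p) = path_edges p"
proof (induction p rule: path_edges.induct)
  case (3 u v p)
  then show ?case
    using path_edges_append[of "rev p" v "[u]"] by (auto simp: insert_commute)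
qed auto

lemma path_edges_subset: "e \<in> path_edges p \<Longrightarrow> e \<subseteq> set p"
  by (induction p rule: path_edges.induct) auto

lemma path_edges_hd: "e \<in> path_edges (v # r) \<Longrightarrow> v \<in> e \<Longrightarrow> v \<notin> set r \<Longrightarrow> r \<noteq> [] \<and> e = {v, hd r}"
  using path_edges_subset[of e r] by (cases r) auto

lemma path_edges_last: "e \<in> path_edges (l @ [v]) \<Longrightarrow> v \<in> e \<Longrightarrow> v \<notin> set l \<Longrightarrow> l \<noteq> [] \<and> e = {v, last l}"
  using path_edges_hd[of e v "rev l"] path_edges_rev[of "l @ [v]"] by (auto simp: hd_rev)

lemma path_edges_hd_in: "r \<noteq> [] \<Longrightarrow> {v, hd r} \<in> path_edges (l @ v # r)"
  by (subst path_edges_append, cases r) auto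

lemma path_edges_last_in: "l \<noteq> [] \<Longrightarrow> {v, last l} \<in> path_edges (l @ v # r)"
  using path_edges_hd_in[of "rev l" v "rev r"] path_edges_rev[of "l @ v # r"] by (simp add: hd_rev)

lemma union_of_broken_lines_iff:
  "union_of_broken_lines G \<longleftrightarrow>
     (\<exists>P. (\<forall>p\<in>P. p \<noteq> [] \<and> distinct p) \<and>
        (\<forall>p\<in>P. \<forall>q\<in>P. p \<noteq> q \<longrightarrow> set p \<inter> set q = {}) \<and>
        \<Union>(set ` P) = ext G \<and> bij_betw (\<lambda>e. att G ` e) (solid G) (\<Union>(path_edges ` P)))"
proof -
  have "{{p ! i, p ! Suc i} | p i. p \<in> P \<and> Suc i < length p} = \<Union>(path_edges ` P)" for P :: "nat list set"
    by (auto simp: path_edges_conv_nth)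
  then show ?thesis
    unfolding union_of_broken_lines_def by simp
qed

lemma union_of_broken_lines_cong:
  assumes "union_of_broken_lines G" "ext G' = ext G" "solid G' = solid G"
    and "\<And>k. k \<in> \<Union>(solid G) \<Longrightarrow> att G' k = att G k"
  shows "union_of_broken_lines G'"
proof -
  have "att G' ` e = att G ` e" if "e \<in> solid G" for e
    using assms(4) that by (intro image_cong) auto
  then have "bij_betw (\<lambda>e. att G' ` e) (solid G') A = bij_betw (\<lambda>e. att G ` e) (solid G) A" for A
    unfolding assms(3) by (rule bij_betw_cong)
  then show ?thesis
    using assms(1,2) unfolding union_of_broken_lines_def by simp
qed

text \<open>
  The graph \<open>T\<close> of the STU relation at the dashed edge \<open>{h, h'}\<close>; exchanging the roles of \<open>x\<close> and
  \<open>y\<close> gives \<open>U\<close>. The half-edges \<open>a\<close> and \<open>y\<close> already have the right endpoints.\<close>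

definition res :: "graph \<Rightarrow> nat \<Rightarrow> nat \<Rightarrow> nat \<Rightarrow> nat set \<Rightarrow> graph" where
  "res G h h' x B = G\<lparr>ext := insert (att G h') (ext G), solid := insert {h, h'} (solid G),
     att := (\<lambda>k. if k = x then att G h else if k \<in> B then att G h' else att G k)\<rparr>"

text \<open>\<open>B\<close> is what remains of the solid half-edges at the external vertex when one
  of them, \<open>a\<close>, is set aside: \<open>a\<close> stays there and \<open>B\<close> moves
  to the new external vertex. In a BCR graph \<open>B\<close> has at most one element. If there are
  two solid half-edges, either may be \<open>a\<close>, and the order of \<open>x\<close> and
  \<open>y\<close> is free as well.\<close>

definition leg :: "graph \<Rightarrow> nat \<Rightarrow> nat \<Rightarrow> nat \<Rightarrow> nat \<Rightarrow> nat set \<Rightarrow> bool" where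
  "leg G h h' x y B \<longleftrightarrow>
     {h, h'} \<in> dashed G \<and> att G h \<in> ext G \<and> att G h' \<in> int_verts G \<and>
     distinct [h', x, y] \<and> halves_at G (edges G) (att G h') = {h', x, y} \<and>
     (halves_at G (solid G) (att G h) = {} \<and> B = {} \<or>
      (\<exists>a. a \<notin> B \<and> halves_at G (solid G) (att G h) = insert a B))"

lemma res_simps [simp]:
  "verts (res G h h' x B) = verts G" "edges (res G h h' x B) = edges G"
  "ext (res G h h' x B) = insert (att G h') (ext G)"
  "solid (res G h h' x B) = insert {h, h'} (solid G)"
  "att (res G h h' x B) k = (if k = x then att G h else if k \<in> B then att G h' else att G k)"
  "int_verts (res G h h' x B) = int_verts G - {att G h'}"
  "dashed (res G h h' x B) = dashed G - {{h, h'}}"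
  by (auto simp: res_def int_verts_def dashed_def)

locale BCR_leg =
  fixes G h h' x y B
  assumes BCR: "BCR_graph G" and leg: "leg G h h' x y B"
begin

abbreviation "v \<equiv> att G h"
abbreviation "w \<equiv> att G h'"

lemma wf: "wf_graph G"
  using BCR by (rule BCR_wf)

lemma edge: "{h, h'} \<in> dashed G" "{h, h'} \<in> edges G" "{h, h'} \<notin> solid G"
  using leg by (auto simp: leg_def dashed_def)

lemma v: "v \<in> ext G" "v \<in> verts G" "v \<notin> int_verts G"
  using leg wf by (auto simp: leg_def wf_graph_def int_verts_def)

lemma w: "w \<in> int_verts G" "w \<in> verts G" "w \<notin> ext G" "v \<noteq> w"
  using leg v by (auto simp: leg_def int_verts_def)

lemma halves_w: "halves_at G (edges G) w = {h', x, y}" "h' \<noteq> x" "h' \<noteq> y" "x \<noteq> y"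
  using leg by (auto simp: leg_def)

lemma att_xy [simp]: "att G x = w" "att G y = w"
  using halves_w(1) by (auto simp: halves_at_def)

lemma att_w_iff: "k \<in> \<Union>(edges G) \<Longrightarrow> att G k = w \<longleftrightarrow> k \<in> {h', x, y}"
  using halves_w(1) by (auto simp: halves_at_def)

lemma h_neq: "h \<noteq> h'" "h \<noteq> x" "h \<noteq> y"
  using w(4) att_xy by metis+

lemma in_edges: "h \<in> \<Union>(edges G)" "h' \<in> \<Union>(edges G)" "x \<in> \<Union>(edges G)" "y \<in> \<Union>(edges G)"
  using halves_w(1) edge by (auto simp: halves_at_def)

lemma in_dashed: "h \<in> \<Union>(dashed G)" "h' \<in> \<Union>(dashed G)" "x \<in> \<Union>(dashed G)" "y \<in> \<Union>(dashed G)"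
  using BCR_internal_dashed(1)[OF BCR] in_edges w edge(1) by auto

lemma notin_solid: "h \<notin> \<Union>(solid G)" "h' \<notin> \<Union>(solid G)" "x \<notin> \<Union>(solid G)" "y \<notin> \<Union>(solid G)"
  using wf_graph_solid_dashed[OF wf] in_dashed by metis+

lemma B_subset: "B \<subseteq> halves_at G (solid G) v"
  using leg by (auto simp: leg_def)

lemma B_cases:
  obtains "halves_at G (solid G) v = {}" "B = {}"
  | a where "halves_at G (solid G) v = {a}" "B = {}"
  | a b where "halves_at G (solid G) v = {a, b}" "B = {b}" "a \<noteq> b"
proof -
  have fin: "finite (halves_at G (solid G) v)"
    using wf by (intro wf_graph_finite_halves) (auto simp: wf_graph_def)
  have c2: "card (halves_at G (solid G) v) \<le> 2"
    using BCR v(1) by (auto simp: BCR_graph_def)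
  show ?thesis
  proof (cases "halves_at G (solid G) v = {} \<and> B = {}")
    case False
    then obtain a where a: "a \<notin> B" "halves_at G (solid G) v = insert a B"
      using leg by (auto simp: leg_def)
    have "finite B" "card B \<le> 1"
      using fin c2 a by auto
    then have "B = {} \<or> (\<exists>b. B = {b})"
      by (metis One_nat_def card_0_eq card_1_singletonE le_Suc_eq le_zero_eq)
    then show ?thesis
      using a that by auto
  qed (use that in auto)
qed

lemma B_props: "k \<in> B \<Longrightarrow> att G k = v" "k \<in> B \<Longrightarrow> k \<in> \<Union>(solid G)" "k \<in> B \<Longrightarrow> k \<in> \<Union>(edges G)" 
  "h \<notin> B" "h' \<notin> B" "x \<notin> B" "y \<notin> B"
  using B_subset notin_solid wf_graph_edges_Un[OF wf] by (auto simp: halves_at_def)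

lemma att_v_iff: "k \<in> \<Union>(edges G) \<Longrightarrow> att G k = v \<longleftrightarrow> k = h \<or> k \<in> halves_at G (solid G) v"
  using BCR_dashed_unique[OF BCR _ in_dashed(1), of k] v(1) wf_graph_edges_Un[OF wf]
  by (auto simp: halves_at_def)

lemma solid_at_w: "halves_at G (solid G) w = {}"
  using BCR w(1) by (auto simp: BCR_graph_def)

lemma dashed_at_v: "halves_at G (dashed G) v = {h}"
  using BCR_dashed_unique[OF BCR _ in_dashed(1)] v(1) in_dashed(1) by (auto simp: halves_at_def)

lemma edge_cases: "d \<in> edges G \<Longrightarrow> d = {h, h'} \<or> h \<notin> d \<and> h' \<notin> d"
  using wf_graph_edge_unique[OF wf _ edge(2)] by blast

text \<open>The vertex \<open>v\<close> gives up \<open>B\<close> and gains \<open>h\<close>, while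
  \<open>w\<close> gains \<open>h'\<close> and \<open>B\<close>. As \<open>B\<close> is nonempty
  only if \<open>v\<close> had two solid half-edges, neither vertex ends up with more than
  two.\<close>

lemma solid_after:
  "halves_at (res G h h' x B) (solid (res G h h' x B)) v = insert h (halves_at G (solid G) v - B)"
  "halves_at (res G h h' x B) (solid (res G h h' x B)) w = insert h' B"
  "u \<noteq> v \<Longrightarrow> u \<noteq> w \<Longrightarrow> halves_at (res G h h' x B) (solid (res G h h' x B)) u = halves_at G (solid G) u"
proof -
  obtain U where U_def: "U = \<Union>(solid G)"
    by blast
  have U: "k \<in> \<Union>(insert {h, h'} (solid G)) \<longleftrightarrow> k = h \<or> k = h' \<or> k \<in> U" for k
    unfolding U_def by auto
  have S: "k \<in> U \<longrightarrow> k \<noteq> h \<and> k \<noteq> h' \<and> k \<noteq> x \<and> att G k \<noteq> w" for k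
    using notin_solid solid_at_w unfolding U_def by (auto simp: halves_at_def)
  have hB: "h \<notin> B" "h' \<notin> B" "h \<noteq> x" "h' \<noteq> x"
    using B_props h_neq halves_w by auto
  have BU: "k \<in> B \<longrightarrow> k \<in> U \<and> att G k = v" for k
    using B_props(1,2) unfolding U_def by auto
  have H: "halves_at (res G h h' x B) (solid (res G h h' x B)) u =
      {k. (k = h \<or> k = h' \<or> k \<in> U) \<and> (if k = x then v else if k \<in> B then w else att G k) = u}" for u
    unfolding halves_at_def res_simps U by simp
  show "halves_at (res G h h' x B) (solid (res G h h' x B)) v = insert h (halves_at G (solid G) v - B)"
  proof (rule set_eqI)
    fix k show "k \<in> halves_at (res G h h' x B) (solid (res G h h' x B)) v \<longleftrightarrow>
        k \<in> insert h (halves_at G (solid G) v - B)"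
      unfolding H unfolding halves_at_def U_def[symmetric] using hB S[of k] w(4)
      by (cases "k = h"; cases "k = h'"; cases "k \<in> B"; cases "k = x") simp_all
  qed
  show "halves_at (res G h h' x B) (solid (res G h h' x B)) w = insert h' B"
  proof (rule set_eqI)
    fix k show "k \<in> halves_at (res G h h' x B) (solid (res G h h' x B)) w \<longleftrightarrow> k \<in> insert h' B"
      unfolding H using hB S[of k] BU[of k] w(4)
      by (cases "k = h"; cases "k = h'"; cases "k \<in> B"; cases "k = x") simp_all
  qed
  show "halves_at (res G h h' x B) (solid (res G h h' x B)) u = halves_at G (solid G) u"
    if u: "u \<noteq> v" "u \<noteq> w"
  proof (rule set_eqI)
    fix k show "k \<in> halves_at (res G h h' x B) (solid (res G h h' x B)) u \<longleftrightarrow> k \<in> halves_at G (solid G) u"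
      unfolding H unfolding halves_at_def U_def[symmetric] using u S[of k] BU[of k]
      by (cases "k = h"; cases "k = h'"; cases "k \<in> B"; cases "k = x") simp_all
  qed
qed

lemma in_dashed_after: "k \<in> \<Union>(dashed G - {{h, h'}}) \<longleftrightarrow> k \<in> \<Union>(dashed G) \<and> k \<noteq> h \<and> k \<noteq> h'"
  using edge_cases by (auto simp: dashed_def)

lemma dashed_after:
  "halves_at (res G h h' x B) (dashed (res G h h' x B)) v = {x}"
  "halves_at (res G h h' x B) (dashed (res G h h' x B)) w = {y}"
  "u \<noteq> v \<Longrightarrow> u \<noteq> w \<Longrightarrow> halves_at (res G h h' x B) (dashed (res G h h' x B)) u = halves_at G (dashed G) u"
proof -
  have B: "k \<notin> \<Union>(dashed G)" if "k \<in> B" for k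
    using B_props(2)[OF that] wf_graph_solid_dashed[OF wf] by blast
  have vD: "k = h" if "k \<in> \<Union>(dashed G)" "att G k = v" for k
    using dashed_at_v that by (auto simp: halves_at_def)
  have wD: "k \<in> {h', x, y}" if "k \<in> \<Union>(dashed G)" "att G k = w" for k
    using that att_w_iff wf_graph_edges_Un[OF wf] by auto
  show "halves_at (res G h h' x B) (dashed (res G h h' x B)) v = {x}"
    unfolding halves_at_def res_simps(7) in_dashed_after
    using in_dashed h_neq halves_w B vD w(4) B_props(6) by (auto split: if_splits)
  show "halves_at (res G h h' x B) (dashed (res G h h' x B)) w = {y}"
    unfolding halves_at_def res_simps(7) in_dashed_after
    using in_dashed h_neq halves_w B wD w(4) B_props(7) by (auto split: if_splits)
  show "halves_at (res G h h' x B) (dashed (res G h h' x B)) u = halves_at G (dashed G) u"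
    if "u \<noteq> v" "u \<noteq> w"
    unfolding halves_at_def res_simps(7) in_dashed_after
    using that B by (auto split: if_splits)
qed

text \<open>
  The new vertex \<open>w\<close> is inserted after \<open>v\<close> in the path through \<open>v\<close>, which first has to be reversed
  if the half-edge in \<open>B\<close> leads to the predecessor of \<open>v\<close>.\<close>

lemma broken_lines_res: "union_of_broken_lines (res G h h' x B)"
proof -
  have "union_of_broken_lines G"
    using BCR by (simp add: BCR_graph_def)
  then obtain P where P0: "\<forall>p\<in>P. p \<noteq> [] \<and> distinct p"
      "\<forall>p\<in>P. \<forall>q\<in>P. p \<noteq> q \<longrightarrow> set p \<inter> set q = {}"
      "\<Union>(set ` P) = ext G" and bij: "bij_betw (\<lambda>e. att G ` e) (solid G) (\<Union>(path_edges ` P))"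
    unfolding union_of_broken_lines_iff by (elim exE conjE) rule
  have P: "\<And>p. p \<in> P \<Longrightarrow> p \<noteq> []" "\<And>p. p \<in> P \<Longrightarrow> distinct p"
      "\<And>p q. p \<in> P \<Longrightarrow> q \<in> P \<Longrightarrow> p \<noteq> q \<Longrightarrow> set p \<inter> set q = {}" "\<Union>(set ` P) = ext G"
    using P0 by simp_all
  obtain p0 where p0: "p0 \<in> P" "v \<in> set p0"
    using P(4) v(1) by blast
  \<comment> \<open>Says that \<open>r\<close>, the part of the path after \<open>v\<close>, lies on
    the side into which \<open>B\<close> points, so that the new vertex goes between
    \<open>v\<close> and \<open>r\<close>. An empty \<open>B\<close> asks for an empty
    \<open>r\<close>: the path is then prolonged beyond \<open>v\<close>.\<close>
  define good where "good = (\<lambda>r. r = [] \<and> B = {} \<or>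
    r \<noteq> [] \<and> (\<exists>b s. B = {b} \<and> s \<in> solid G \<and> b \<in> s \<and> att G ` s = {v, hd r}))"
  have other: "v \<notin> s" if "s \<in> path_edges q" "q \<in> P" "q \<noteq> p0" for s q
    using path_edges_subset[OF that(1)] P(3)[OF that(2) p0(1) that(3)] p0(2) by auto
  have att_solid: "att G k = v \<Longrightarrow> k \<in> s \<Longrightarrow> s \<in> solid G \<Longrightarrow> k \<in> halves_at G (solid G) v" for k s
    by (auto simp: halves_at_def)
  have half: "\<exists>s k. s \<in> solid G \<and> k \<in> s \<and> k \<in> halves_at G (solid G) v \<and> att G ` s = {v, n}"
    if n: "{v, n} \<in> path_edges p0" for n
  proof -
    have "{v, n} \<in> (\<lambda>e. att G ` e) ` solid G"
      using bij n p0(1) unfolding bij_betw_def by blast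
    then obtain s where s: "s \<in> solid G" "att G ` s = {v, n}"
      by auto
    then have "v \<in> att G ` s"
      by simp
    then show ?thesis
      using s att_solid by (metis imageE)
  qed
  obtain l0 r0 where lr0: "p0 = l0 @ v # r0"
    using p0(2) by (meson split_list)
  have d0: "distinct (l0 @ v # r0)"
    using P(2)[OF p0(1)] lr0 by simp
  have "\<exists>l r. set (l @ v # r) = set p0 \<and> path_edges (l @ v # r) = path_edges p0 \<and>
      distinct (l @ v # r) \<and> good r"
  proof (cases "good r0")
    case True
    then show ?thesis using d0 lr0 by blast
  next
    case bad: False
    \<comment> \<open>If the part after \<open>v\<close> lies on the wrong side, the part before
      \<open>v\<close> lies on the right one, and the path is traversed backwards.\<close>
    have "good (rev l0)"
    proof (rule B_cases)
      assume B: "halves_at G (solid G) v = {}" "B = {}"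
      then have "r0 \<noteq> []"
        using bad by (auto simp: good_def)
      then have "{v, hd r0} \<in> path_edges p0"
        unfolding lr0 by (rule path_edges_hd_in)
      then show ?thesis
        using half B(1) by blast
    next
      fix a assume B: "halves_at G (solid G) v = {a}" "B = {}"
      then have r: "r0 \<noteq> []"
        using bad by (auto simp: good_def)
      then have "{v, hd r0} \<in> path_edges p0"
        unfolding lr0 by (rule path_edges_hd_in)
      then obtain s where s: "s \<in> solid G" "a \<in> s" "att G ` s = {v, hd r0}"
        using half[of "hd r0"] B(1) by auto
      \<comment> \<open>With a single solid half-edge \<open>a\<close>, the vertex \<open>v\<close>
        is an end of its path: neighbours on both sides would be reached through the same edge,
        hence coincide.\<close>
      have "l0 = []"
      proof (rule ccontr)
        assume l: "l0 \<noteq> []"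
        then have "{v, last l0} \<in> path_edges p0"
          unfolding lr0 by (rule path_edges_last_in)
        then obtain s' where s': "s' \<in> solid G" "a \<in> s'" "att G ` s' = {v, last l0}"
          using half[of "last l0"] B(1) by auto
        have "solid G \<subseteq> edges G"
          using wf by (simp add: wf_graph_def)
        then have "s = s'"
          using wf_graph_edge_unique[OF wf, of s s' a] s s' by blast
        then have "hd r0 = last l0"
          using s(3) s'(3) by (auto simp: doubleton_eq_iff)
        moreover have "hd r0 \<in> set r0" "last l0 \<in> set l0"
          using l r by auto
        ultimately show False
          using d0 by auto
      qed
      then show ?thesis
        using B by (simp add: good_def)
    next
      fix a b assume B: "halves_at G (solid G) v = {a, b}" "B = {b}"
      obtain s where s: "s \<in> solid G" "b \<in> s" "att G b = v"
        using B(1) by (auto simp: halves_at_def)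
      have v_s: "v \<in> att G ` s"
        using s by (metis imageI)
      have "att G ` s \<in> \<Union>(path_edges ` P)"
        using bij_betwE[OF bij] s(1) by blast
      then have "att G ` s \<in> path_edges p0"
        using other v_s by blast
      then consider "att G ` s \<in> path_edges (l0 @ [v])" | "att G ` s \<in> path_edges (v # r0)"
        unfolding lr0 by (subst (asm) path_edges_append) auto
      then show ?thesis
      proof cases
        case 1
        then have "l0 \<noteq> []" "att G ` s = {v, last l0}"
          using path_edges_last[OF 1 v_s] d0 by auto
        then show ?thesis
          using s B by (auto simp: good_def hd_rev)
      next
        case 2
        then have "r0 \<noteq> []" "att G ` s = {v, hd r0}"
          using path_edges_hd[OF 2 v_s] d0 by auto
        then show ?thesis
          using s B bad by (auto simp: good_def)
      qed
    qed
    moreover have "path_edges (rev r0 @ v # rev l0) = path_edges p0"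
      using path_edges_rev[of p0] by (simp add: lr0)
    ultimately show ?thesis
      using d0 lr0 by (intro exI[of _ "rev r0"] exI[of _ "rev l0"]) auto
  qed
  then obtain l r where lr: "set (l @ v # r) = set p0" "path_edges (l @ v # r) = path_edges p0"
      "distinct (l @ v # r)" "good r"
    by blast
  define P1 where "P1 = insert (l @ v # w # r) (P - {p0})"
  define X where "X = \<Union>(path_edges ` (P - {p0})) \<union> path_edges (l @ [v])"
  have E: "\<Union>(path_edges ` P) = X \<union> path_edges (v # r)"
    using p0(1) lr(2) path_edges_append[of l v r] by (auto simp: X_def)
  have E1: "\<Union>(path_edges ` P1) = insert {v, w} (X \<union> path_edges (w # r))"
    using path_edges_append[of l v "w # r"] by (auto simp: P1_def X_def)
  have wE: "w \<notin> s" if "s \<in> \<Union>(path_edges ` P)" for s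
    using that path_edges_subset P(4) w(3) by blast
  have wP: "w \<notin> set p" if "p \<in> P" for p
    using that P(4) w(3) by blast
  have P1: "\<forall>p\<in>P1. p \<noteq> [] \<and> distinct p" "\<forall>p\<in>P1. \<forall>q\<in>P1. p \<noteq> q \<longrightarrow> set p \<inter> set q = {}"
    "\<Union>(set ` P1) = insert w (ext G)"
  proof -
    have s: "set (l @ v # w # r) = insert w (set p0)"
      using lr(1) by auto
    have "distinct (l @ v # w # r)"
      using lr(3) wP[OF p0(1)] lr(1)[symmetric] by auto
    then show "\<forall>p\<in>P1. p \<noteq> [] \<and> distinct p"
      using P(1,2) by (auto simp: P1_def)
    have "set p \<inter> set (l @ v # w # r) = {}" if "p \<in> P - {p0}" for p
      unfolding s using P(3)[OF _ p0(1)] wP that by auto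
    then show "\<forall>p\<in>P1. \<forall>q\<in>P1. p \<noteq> q \<longrightarrow> set p \<inter> set q = {}"
      using P(3) unfolding P1_def by (metis DiffD1 Int_commute insertE)
    show "\<Union>(set ` P1) = insert w (ext G)"
      using s P(4) p0(1) unfolding P1_def by auto
  qed
  let ?att1 = "att (res G h h' x B)"
  have same: "?att1 ` s = att G ` s" if "s \<in> solid G" "s \<inter> B = {}" for s
    using that notin_solid(3) by (intro image_cong) auto
  have new: "?att1 ` {h, h'} = {v, w}"
    using h_neq halves_w(2,3) B_props(4,5) by simp
  have ins: "bij_betw f (insert a A) (insert (f a) C)" if "bij_betw f A C" "a \<notin> A" "f a \<notin> C"
    for f :: "nat set \<Rightarrow> nat set" and a A C
    using that by (auto simp: bij_betw_def inj_on_def)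
  have del: "bij_betw f (A - {a}) (C - {f a})" if "bij_betw f A C" "a \<in> A"
    for f :: "nat set \<Rightarrow> nat set" and a A C
    using that by (auto simp: bij_betw_def inj_on_def)
  have "bij_betw (\<lambda>e. ?att1 ` e) (insert {h, h'} (solid G)) (\<Union>(path_edges ` P1))"
  proof (cases "r = []")
    case True
    then have "B = {}"
      using lr(4) by (simp add: good_def)
    then have b: "bij_betw (\<lambda>e. ?att1 ` e) (solid G) (\<Union>(path_edges ` P))"
      using bij same by (subst bij_betw_cong[where g = "\<lambda>e. att G ` e"]) auto
    have "{v, w} \<notin> \<Union>(path_edges ` P)"
      using wE by blast
    then show ?thesis
      using ins[OF b edge(3)] new by (simp add: E1 E True)
  next
    case False
    then obtain b s where s: "B = {b}" "s \<in> solid G" "b \<in> s" "att G ` s = {v, hd r}"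
      using lr(4) by (auto simp: good_def)
    obtain u r' where r: "r = u # r'"
      using False by (cases r) auto
    \<comment> \<open>The path edges that survive. \<open>{v, u}\<close> gives way to
      \<open>{v, w}\<close> and \<open>{w, u}\<close>: the former comes from the new solid edge
      \<open>{h, h'}\<close>, the latter from the old edge \<open>s\<close>, whose half-edge
      \<open>b\<close> now sits at \<open>w\<close>.\<close>
    define Y where "Y = X \<union> path_edges (u # r')"
    have u: "u \<noteq> v" "u \<in> set p0" "u \<noteq> w"
      using lr(3,1) r wP[OF p0(1)] by auto
    have EY: "\<Union>(path_edges ` P) = insert {v, u} Y"
      unfolding E r Y_def by auto
    have E1Y: "\<Union>(path_edges ` P1) = insert {v, w} (insert {w, u} Y)"
      unfolding E1 r Y_def by auto
    have "{v, u} \<notin> Y"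
    proof -
      have "{v, u} \<notin> \<Union>(path_edges ` (P - {p0}))"
        using other by blast
      moreover have "{v, u} \<notin> path_edges (l @ [v])"
        using path_edges_subset[of "{v, u}" "l @ [v]"] lr(3) r by auto
      moreover have "{v, u} \<notin> path_edges (u # r')"
        using path_edges_subset[of "{v, u}" "u # r'"] lr(3) r by auto
      ultimately show ?thesis by (auto simp: Y_def X_def)
    qed
    have sub: "s' \<inter> B = {}" if "s' \<in> solid G - {s}" for s'
      using that s(1-3) wf wf_graph_edge_unique[OF wf, of s s' b] by (auto simp: wf_graph_def)
    have "bij_betw (\<lambda>e. att G ` e) (solid G - {s}) (insert {v, u} Y - {att G ` s})"
      using del[OF bij s(2)] unfolding EY .
    moreover have "insert {v, u} Y - {att G ` s} = Y"
      using \<open>{v, u} \<notin> Y\<close> s(4) r by auto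
    ultimately have b1: "bij_betw (\<lambda>e. ?att1 ` e) (solid G - {s}) Y"
      using same sub by (subst bij_betw_cong[where g = "\<lambda>e. att G ` e"]) auto
    have wY: "{w, u} \<notin> Y" "{v, w} \<notin> insert {w, u} Y"
      using wE EY u by (auto simp: doubleton_eq_iff)
    have "?att1 ` s = {w, u}"
    proof -
      have "card s = 2"
        using s(2) wf by (auto simp: wf_graph_def)
      then obtain b' where b': "s = {b, b'}" "b \<noteq> b'"
        using s(3) card_2_other by metis
      have "att G b = v"
        using s(1) B_props(1) by auto
      moreover have "b \<noteq> x" "b' \<noteq> x"
        using notin_solid(3) s(2) b' by auto
      ultimately show ?thesis
        using s(1,4) b' u r by (auto simp: doubleton_eq_iff)
    qed
    then have "bij_betw (\<lambda>e. ?att1 ` e) (insert s (solid G - {s})) (insert {w, u} Y)"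
      using ins[OF b1, of s] wY by simp
    then have "bij_betw (\<lambda>e. ?att1 ` e) (solid G) (insert {w, u} Y)"
      using s(2) by (simp add: insert_absorb)
    from ins[OF this edge(3)] show ?thesis
      using wY new E1Y by simp
  qed
  then show ?thesis
    unfolding union_of_broken_lines_iff res_simps(3,4) using P1 by blast
qed

lemma BCR_res: "BCR_graph (res G h h' x B)"
proof -
  have "wf_graph (res G h h' x B)"
  proof -
    have "att G ` \<Union>(edges G) \<subseteq> verts G"
      using wf by (simp add: wf_graph_def)
    then have "att (res G h h' x B) k \<in> verts G" if "k \<in> \<Union>(edges G)" for k
    proof -
      have "att G k \<in> verts G"
        using that \<open>att G ` \<Union>(edges G) \<subseteq> verts G\<close> by blast
      then show ?thesis
        using v(2) w(2) by simp
    qed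
    then have "att (res G h h' x B) ` \<Union>(edges G) \<subseteq> verts G"
      by blast
    then show ?thesis
      using wf w(2) edge(2) by (simp add: wf_graph_def)
  qed
  moreover have "connected_graph (res G h h' x B)"
  proof (rule connected_reattach[of G _ h h'])
    show "connected_graph G"
      using BCR by (simp add: BCR_graph_def)
    fix k
    show "att (res G h h' x B) k = att G k \<or> {att G k, att (res G h h' x B) k} \<subseteq> {v, w}"
      using B_props(1)[of k] by (cases "k \<in> B"; cases "k = x") simp_all
  qed (use edge(2) h_neq halves_w(2) B_props(4,5) in simp_all)
  moreover have "card (halves_at (res G h h' x B) (dashed (res G h h' x B)) u) = 3 \<and>
      halves_at (res G h h' x B) (solid (res G h h' x B)) u = {}"
    if "u \<in> int_verts (res G h h' x B)" for u
  proof -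
    have u: "u \<noteq> v" "u \<noteq> w" "u \<in> int_verts G"
      using that v by auto
    show ?thesis
      unfolding dashed_after(3)[OF u(1,2)] solid_after(3)[OF u(1,2)]
      using BCR u(3) by (auto simp: BCR_graph_def)
  qed
  moreover have "card (halves_at (res G h h' x B) (dashed (res G h h' x B)) u) = 1 \<and>
      card (halves_at (res G h h' x B) (solid (res G h h' x B)) u) \<le> 2"
    if u: "u \<in> ext (res G h h' x B)" for u
  proof -
    consider "u = v" | "u = w" | "u \<noteq> v" "u \<noteq> w" "u \<in> ext G"
      using u by auto
    then show ?thesis
    proof cases
      case 1
      show ?thesis
        unfolding 1 dashed_after(1) solid_after(1)
        by (rule B_cases) (auto simp: card_insert_if)
    next
      case 2
      show ?thesis
        unfolding 2 dashed_after(2) solid_after(2)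
        by (rule B_cases) (auto simp: card_insert_if)
    next
      case 3
      show ?thesis
        unfolding dashed_after(3)[OF 3(1,2)] solid_after(3)[OF 3(1,2)]
        using BCR 3(3) by (auto simp: BCR_graph_def)
    qed
  qed
  ultimately show ?thesis
    using broken_lines_res unfolding BCR_graph_def by auto
qed

lemma card_int_res: "card (int_verts (res G h h' x B)) = card (int_verts G) - 1"
  using w(1) by simp

end

lemma leg_swap: "leg G h h' x y B \<Longrightarrow> leg G h h' y x B"
  unfolding leg_def by auto

lemma leg_exists:
  assumes "BCR_graph G" "{h, h'} \<in> edges G" "att G h \<in> ext G" "att G h' \<in> int_verts G"
  obtains x y B where "leg G h h' x y B"
proof -
  have wf: "wf_graph G"
    using assms(1) by (rule BCR_wf)
  have "h' \<in> \<Union>(edges G)"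
    using assms(2) by blast
  then have hd: "h' \<in> \<Union>(dashed G)" "h' \<notin> \<Union>(solid G)"
    using BCR_internal_dashed[OF assms(1) _ assms(4)] by auto
  then have "{h, h'} \<in> dashed G"
    using assms(2) by (auto simp: dashed_def)
  moreover have "card (halves_at G (edges G) (att G h')) = 3"
    using assms(1,4) halves_at_edges[OF wf] by (auto simp: BCR_graph_def)
  then obtain a b c where abc: "halves_at G (edges G) (att G h') = {a, b, c}" "a \<noteq> b" "b \<noteq> c" "a \<noteq> c"
    by (auto simp: card_3_iff)
  have "h' \<in> {a, b, c}"
    using assms(2) unfolding abc(1)[symmetric] by (auto simp: halves_at_def)
  then consider "h' = a" | "h' = b" | "h' = c"
    by blast
  then obtain x y where "halves_at G (edges G) (att G h') = {h', x, y}" "distinct [h', x, y]"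
  proof cases
    case 1 then show ?thesis using abc that[of b c] by simp
  next
    case 2 then show ?thesis using abc that[of a c] by (simp add: insert_commute)
  next
    case 3 then show ?thesis using abc that[of a b] by (simp add: insert_commute)
  qed
  moreover obtain B where "halves_at G (solid G) (att G h) = {} \<and> B = {} \<or>
      (\<exists>a. a \<notin> B \<and> halves_at G (solid G) (att G h) = insert a B)"
    by (metis Set.set_insert all_not_in_conv)
  ultimately show ?thesis
    using that[of x y B] assms(3,4) unfolding leg_def by simp
qed

text \<open>By connectedness some edge leaves \<open>C\<close>, and by hypothesis it ends at an
  external vertex. Allowing a set \<open>C\<close> smaller than \<open>int_verts G\<close> makes it
  possible to find a leg that avoids a given internal vertex.\<close>

lemma leg_exists_in:
  assumes "BCR_graph G" "C \<subseteq> int_verts G" "C \<noteq> {}"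
    and "\<And>k k'. {k, k'} \<in> edges G \<Longrightarrow> att G k \<in> C \<Longrightarrow> att G k' \<notin> C \<Longrightarrow> att G k' \<in> ext G"
  obtains h h' x y B where "leg G h h' x y B" "att G h' \<in> C"
proof -
  have G: "connected_graph G" "wf_graph G" "ext G \<noteq> {}" "ext G \<subseteq> verts G"
    using assms(1) by (auto simp: BCR_graph_def wf_graph_def)
  obtain u v where uv: "u \<in> C" "v \<in> ext G"
    using assms(3) G by auto
  then have "u \<in> verts G" "v \<in> verts G" "v \<notin> C"
    using assms(2) G(4) by (auto simp: int_verts_def)
  then obtain k k' where k: "{k, k'} \<in> edges G" "att G k \<in> C" "att G k' \<notin> C"
    using connected_boundary_edge[OF G(1,2) uv(1)] by blast
  have "{k', k} \<in> edges G"
    using k(1) by (simp add: insert_commute)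
  moreover have "att G k' \<in> ext G" "att G k \<in> int_verts G"
    using assms(2,4) k by blast+
  ultimately obtain x y B where "leg G k' k x y B"
    using leg_exists[OF assms(1)] by blast
  then show ?thesis
    using k that by blast
qed

lemma some_leg_exists:
  assumes "BCR_graph G" "int_verts G \<noteq> {}"
  obtains h h' x y B where "leg G h h' x y B"
proof (rule leg_exists_in[OF assms(1) order.refl assms(2)])
  fix k k' assume "{k, k'} \<in> edges G" "att G k' \<notin> int_verts G"
  then show "att G k' \<in> ext G"
    using wf_graph_att[OF BCR_wf[OF assms(1)], of "{k, k'}"] by (auto simp: int_verts_def)
qed


context BCR_leg
begin

lemma att_res_other: "u \<noteq> v \<Longrightarrow> u \<noteq> w \<Longrightarrow> att (res G h h' x B) k = u \<longleftrightarrow> att G k = u"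
  using B_props(1)[of k] by (cases "k = x"; cases "k \<in> B") auto

lemma swap: "BCR_leg G h h' y x B"
  using BCR leg_swap[OF leg] by unfold_locales

end

section \<open>Commuting resolutions, IHX exchanges and isomorphisms\<close>

locale two_BCR_legs = one: BCR_leg G h h' x y B + two: BCR_leg G k k' p q C
  for G h h' x y B k k' p q C +
  assumes w_neq: "att G h' \<noteq> att G k'"
begin

lemma swap: "two_BCR_legs G k k' p q C h h' x y B"
  using w_neq by unfold_locales simp

text \<open>An external vertex has only one dashed half-edge, so two legs at the same external
  vertex are the same edge and have the same internal end.\<close>

lemma v_neq: "att G h \<noteq> att G k"
proof
  assume "att G h = att G k"
  then have "h = k"
    using BCR_dashed_unique[OF one.BCR one.in_dashed(1) two.in_dashed(1)] one.v(1) by simp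
  then have "{h, h'} = {h, k'}"
    using wf_graph_edge_unique[OF one.wf one.edge(2) two.edge(2), of h] by simp
  then show False
    using w_neq by (auto simp: doubleton_eq_iff)
qed

lemma vw_neq: "att G h \<noteq> att G k'" "att G k \<noteq> att G h'"
  using one.v two.v one.w two.w by auto

lemma solid_at_other:
  "halves_at (res G h h' x B) (solid (res G h h' x B)) (att G k) = halves_at G (solid G) (att G k)"
  using one.solid_after(3) v_neq vw_neq by metis

lemma leg_res: "leg (res G h h' x B) k k' p q C"
proof -
  have "{k, k'} \<noteq> {h, h'}"
    using w_neq vw_neq by (auto simp: doubleton_eq_iff)
  moreover have a: "att (res G h h' x B) k = att G k" "att (res G h h' x B) k' = att G k'"
    using one.att_res_other v_neq vw_neq w_neq by metis+
  moreover have "halves_at (res G h h' x B) (edges G) (att G k') = halves_at G (edges G) (att G k')"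
    unfolding halves_at_def using one.att_res_other[of "att G k'"] vw_neq w_neq by auto
  moreover have "leg G k k' p q C"
    by (rule two.leg)
  ultimately show ?thesis
    unfolding leg_def a res_simps(2,3,6,7) solid_at_other using w_neq by simp
qed

lemma disjoint:
  "k \<noteq> x" "k' \<noteq> x" "p \<noteq> x" "k \<notin> B" "k' \<notin> B" "p \<notin> B" "j \<in> C \<Longrightarrow> j \<noteq> x" "j \<in> C \<Longrightarrow> j \<notin> B"
  using one.att_xy two.att_xy one.B_props(1) two.B_props(1) w_neq v_neq vw_neq by metis+

text \<open>The two resolutions move disjoint sets of half-edges, and each leaves the other leg in
  place. The resulting graphs are therefore equal, not merely isomorphic.\<close>

lemma res_commute: "res (res G h h' x B) k k' p C = res (res G k k' p C) h h' x B"
proof -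
  interpret sw: two_BCR_legs G k k' p q C h h' x y B
    by (rule swap)
  have "att (res (res G h h' x B) k k' p C) = att (res (res G k k' p C) h h' x B)"
  proof
    fix j show "att (res (res G h h' x B) k k' p C) j = att (res (res G k k' p C) h h' x B) j"
      using disjoint sw.disjoint by (cases "j \<in> C"; cases "j \<in> B") simp_all
  qed
  then show ?thesis
    using disjoint sw.disjoint by (intro graph.equality) (simp_all add: insert_commute)
qed

end

text \<open>
  Minus the value that an STU relation gives to \<open>G\<close>; the second summand is absent in an STU relation of
  type (II).\<close>

definition val :: "(graph \<Rightarrow> rat) \<Rightarrow> graph \<Rightarrow> nat \<Rightarrow> nat \<Rightarrow> nat \<Rightarrow> nat \<Rightarrow> nat set \<Rightarrow> rat" where
  "val F G h h' x y B = F (res G h h' x B) +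
     (if halves_at G (solid G) (att G h) = {} then 0 else F (res G h h' y B))"

text \<open>Resolving one leg does not change the solid half-edges at the external end of the other,
  so the same double resolutions are present on both sides.\<close>

lemma (in two_BCR_legs) val_commute:
  "val (\<lambda>T. val F T k k' p q C) G h h' x y B = val (\<lambda>T. val F T h h' x y B) G k k' p q C"
proof -
  interpret a: two_BCR_legs G h h' y x B k k' p q C
    using one.swap two.BCR_leg_axioms w_neq by (intro two_BCR_legs.intro two_BCR_legs_axioms.intro)
  interpret b: two_BCR_legs G h h' x y B k k' q p C
    using one.BCR_leg_axioms two.swap w_neq by (intro two_BCR_legs.intro two_BCR_legs_axioms.intro)
  interpret c: two_BCR_legs G h h' y x B k k' q p C
    using one.swap two.swap w_neq by (intro two_BCR_legs.intro two_BCR_legs_axioms.intro)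
  interpret s: two_BCR_legs G k k' p q C h h' x y B
    by (rule swap)
  interpret s': two_BCR_legs G k k' q p C h h' x y B
    by (rule b.swap)
  have att: "att (res G h h' x B) k = att G k" "att (res G h h' y B) k = att G k"
    "att (res G k k' p C) h = att G h" "att (res G k k' q C) h = att G h"
    using one.att_res_other BCR_leg.att_res_other[OF one.swap]
      two.att_res_other BCR_leg.att_res_other[OF two.swap]
      v_neq vw_neq by metis+
  show ?thesis
    unfolding val_def att solid_at_other a.solid_at_other s.solid_at_other s'.solid_at_other
      res_commute a.res_commute b.res_commute c.res_commute by simp
qed

text \<open>
  If \<open>y\<close> and \<open>z\<close> are half-edges at the two ends of an internal edge, this is a graph of the IHX triple
  of \<open>G\<close>.\<close>

definition exch :: "graph \<Rightarrow> nat \<Rightarrow> nat \<Rightarrow> graph" where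
  "exch G y z = G\<lparr>att := att G \<circ> transpose y z\<rparr>"

lemma exch_simps [simp]:
  "verts (exch G y z) = verts G" "edges (exch G y z) = edges G" "ext (exch G y z) = ext G"
  "solid (exch G y z) = solid G" "att (exch G y z) k = att G (transpose y z k)"
  "int_verts (exch G y z) = int_verts G" "dashed (exch G y z) = dashed G"
  by (auto simp: exch_def int_verts_def dashed_def)

text \<open>The setting of an IHX relation. Exchanging \<open>y\<close> with \<open>z\<close>, or
  \<open>y\<close> with \<open>t\<close>, gives the two other splittings of
  \<open>{x, y, z, t}\<close> into pairs.\<close>

locale BCR_int_edge =
  fixes G h h' x y z t
  assumes BCR: "BCR_graph G" and edge: "{h, h'} \<in> edges G"
    and int: "att G h \<in> int_verts G" "att G h' \<in> int_verts G" "att G h \<noteq> att G h'"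
    and halves: "distinct [h, x, y]" "halves_at G (edges G) (att G h) = {h, x, y}"
      "distinct [h', z, t]" "halves_at G (edges G) (att G h') = {h', z, t}"
begin

lemma wf: "wf_graph G"
  using BCR by (rule BCR_wf)

lemma att_halves [simp]: "att G x = att G h" "att G y = att G h" "att G z = att G h'" "att G t = att G h'"
  using halves(2,4) by (auto simp: halves_at_def)

lemma in_edges: "h \<in> \<Union>(edges G)" "x \<in> \<Union>(edges G)" "y \<in> \<Union>(edges G)"
  "h' \<in> \<Union>(edges G)" "z \<in> \<Union>(edges G)" "t \<in> \<Union>(edges G)"
  using halves(2,4) by (auto simp: halves_at_def)

lemma neq: "h \<noteq> x" "h \<noteq> y" "x \<noteq> y" "h' \<noteq> z" "h' \<noteq> t" "z \<noteq> t"
  "h \<noteq> h'" "h \<noteq> z" "h \<noteq> t" "x \<noteq> h'" "x \<noteq> z" "x \<noteq> t" "y \<noteq> h'" "y \<noteq> z" "y \<noteq> t"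
  using halves(1,3) int(3) att_halves by (auto, metis+)

lemma in_dashed: "{h, h'} \<in> dashed G"
  "x \<in> \<Union>(dashed G)" "y \<in> \<Union>(dashed G)" "z \<in> \<Union>(dashed G)" "t \<in> \<Union>(dashed G)"
proof -
  have "h \<in> \<Union>(dashed G)" "x \<in> \<Union>(dashed G)" "y \<in> \<Union>(dashed G)" "z \<in> \<Union>(dashed G)" "t \<in> \<Union>(dashed G)"
    using BCR_internal_dashed(1)[OF BCR] in_edges int by auto
  moreover from this have "{h, h'} \<in> dashed G"
    using wf_graph_solid_dashed[OF wf, of h] edge by (auto simp: dashed_def)
  ultimately show "{h, h'} \<in> dashed G"
    "x \<in> \<Union>(dashed G)" "y \<in> \<Union>(dashed G)" "z \<in> \<Union>(dashed G)" "t \<in> \<Union>(dashed G)"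
    by auto
qed

lemma notin_solid: "y \<notin> \<Union>(solid G)" "z \<notin> \<Union>(solid G)"
  using wf_graph_solid_dashed[OF wf] in_dashed by metis+

lemma halves_exch_dashed: "halves_at (exch G y z) (dashed G) u = transpose y z ` halves_at G (dashed G) u"
proof (rule set_eqI)
  fix k
  have "transpose y z k \<in> \<Union>(dashed G) \<longleftrightarrow> k \<in> \<Union>(dashed G)"
    using in_dashed(3,4) by (metis transpose_apply_first transpose_apply_second transpose_apply_other)
  then show "k \<in> halves_at (exch G y z) (dashed G) u \<longleftrightarrow> k \<in> transpose y z ` halves_at G (dashed G) u"
    unfolding halves_at_def by (auto simp: image_iff)
qed

lemma halves_exch_solid: "halves_at (exch G y z) (solid G) u = halves_at G (solid G) u"
  using notin_solid unfolding halves_at_def by (auto simp: transpose_def)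

lemma halves_exch_other:
  "u \<noteq> att G h \<Longrightarrow> u \<noteq> att G h' \<Longrightarrow> halves_at (exch G y z) F u = halves_at G F u"
  unfolding halves_at_def by (auto simp: transpose_def)

lemma halves_exch:
  "halves_at (exch G y z) (edges G) (att G h) = {h, x, z}"
  "halves_at (exch G y z) (edges G) (att G h') = {h', y, t}"
proof -
  have h: "k \<in> \<Union>(edges G) \<and> att G k = att G h \<longleftrightarrow> k \<in> {h, x, y}"
    "k \<in> \<Union>(edges G) \<and> att G k = att G h' \<longleftrightarrow> k \<in> {h', z, t}" for k
    using halves(2,4) by (auto simp: halves_at_def)
  show "halves_at (exch G y z) (edges G) (att G h) = {h, x, z}"
  proof (rule set_eqI)
    fix k show "k \<in> halves_at (exch G y z) (edges G) (att G h) \<longleftrightarrow> k \<in> {h, x, z}"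
      unfolding halves_at_def using h(1)[of k] in_edges neq int
      by (cases "k = y"; cases "k = z") simp_all
  qed
  show "halves_at (exch G y z) (edges G) (att G h') = {h', y, t}"
  proof (rule set_eqI)
    fix k show "k \<in> halves_at (exch G y z) (edges G) (att G h') \<longleftrightarrow> k \<in> {h', y, t}"
      unfolding halves_at_def using h(2)[of k] in_edges neq int
      by (cases "k = y"; cases "k = z") simp_all
  qed
qed

lemma BCR_exch: "BCR_graph (exch G y z)"
proof -
  have "wf_graph (exch G y z)"
  proof -
    have "att G k \<in> verts G" if "k \<in> \<Union>(edges G)" for k
      using that wf by (auto simp: wf_graph_def image_subset_iff)
    then have "att G (transpose y z k) \<in> verts G" if "k \<in> \<Union>(edges G)" for k
      using that in_edges by (cases "k = y"; cases "k = z") simp_all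
    then have "att (exch G y z) ` \<Union>(edges G) \<subseteq> verts G"
      by (intro image_subsetI) simp
    then show ?thesis
      using wf by (simp add: wf_graph_def)
  qed
  moreover have "connected_graph (exch G y z)"
  proof (rule connected_reattach[of G _ h h'])
    show "connected_graph G"
      using BCR by (simp add: BCR_graph_def)
    fix k
    show "att (exch G y z) k = att G k \<or> {att G k, att (exch G y z) k} \<subseteq> {att G h, att G h'}"
      by (cases "k = y"; cases "k = z") simp_all
  qed (use edge neq in simp_all)
  moreover have "union_of_broken_lines (exch G y z)"
  proof (rule union_of_broken_lines_cong[of G])
    show "union_of_broken_lines G"
      using BCR by (simp add: BCR_graph_def)
    show "att (exch G y z) k = att G k" if "k \<in> \<Union>(solid G)" for k
    proof -
      have "k \<noteq> y" "k \<noteq> z"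
        using that notin_solid by metis+
      then show ?thesis by simp
    qed
  qed simp_all
  ultimately show ?thesis
    using BCR unfolding BCR_graph_def exch_simps halves_exch_solid halves_exch_dashed
    by (simp add: card_image)
qed

lemma exch_int_edge: "BCR_int_edge (exch G y z) h h' x z y t"
  by unfold_locales (use BCR_exch edge int neq halves_exch in auto)

lemma swap: "BCR_int_edge G h h' x y t z"
  by unfold_locales (use BCR edge int halves in auto)

lemma swap': "BCR_int_edge G h h' y x z t"
  by unfold_locales (use BCR edge int halves in auto)

lemma sym: "BCR_int_edge G h' h z t x y"
  by unfold_locales (use BCR edge int halves in \<open>auto simp: insert_commute\<close>)

declare att_halves [simp del]

end

text \<open>A leg that ends away from the internal edge \<open>{h, h'}\<close>: resolving it
  commutes with the exchanges at that edge and leaves the edge internal. This is the setting of the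
  inductive case of the IHX relation.\<close>

locale BCR_int_edge_leg = BCR_int_edge G h h' x y z t + far: BCR_leg G k k' p q C
  for G h h' x y z t k k' p q C +
  assumes k'_far: "att G k' \<noteq> att G h" "att G k' \<noteq> att G h'"
begin

lemma k_far: "att G k \<noteq> att G h" "att G k \<noteq> att G h'"
  using int(1,2) far.v(3) by auto

lemma y_z_far: "y \<noteq> k" "z \<noteq> k" "y \<noteq> k'" "z \<noteq> k'" "y \<noteq> p" "z \<noteq> p" "y \<noteq> q" "z \<noteq> q"
  using att_halves far.att_xy k'_far k_far by metis+

lemma y_z_notin: "y \<notin> C" "z \<notin> C"
  using far.B_props(1) att_halves k_far by metis+

lemma att_exch: "att (exch G y z) k = att G k" "att (exch G y z) k' = att G k'"
  using y_z_far by (simp_all add: transpose_def)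

lemma leg_exch: "leg (exch G y z) k k' p q C"
  using far.leg unfolding leg_def att_exch exch_simps(2,3,4,6,7) halves_exch_solid
    halves_exch_other[OF k'_far] .

lemma solid_exch: "halves_at (exch G y z) (solid (exch G y z)) (att (exch G y z) k) = halves_at G (solid G) (att G k)"
  unfolding att_exch exch_simps(4) halves_exch_solid ..

lemma res_exch: "res (exch G y z) k k' p C = exch (res G k k' p C) y z"
proof -
  have "att (res (exch G y z) k k' p C) j = att (exch (res G k k' p C) y z) j" for j
    using y_z_far y_z_notin by (cases "j = y"; cases "j = z"; cases "j = p") (simp_all add: transpose_def)
  then have "att (res (exch G y z) k k' p C) = att (exch (res G k k' p C) y z)"
    by blast
  then show ?thesis
    using att_exch by (intro graph.equality) (simp_all del: exch_simps(5) add: exch_def res_def)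
qed

lemma int_edge_res: "BCR_int_edge (res G k k' p C) h h' x y z t"
proof -
  have a: "att (res G k k' p C) j = att G j" if "att G j = att G h \<or> att G j = att G h'" for j
    using that far.att_res_other k_far k'_far by metis
  have ha: "halves_at (res G k k' p C) (edges G) u = halves_at G (edges G) u"
    if u: "u = att G h \<or> u = att G h'" for u
  proof -
    have "att (res G k k' p C) j = u \<longleftrightarrow> att G j = u" for j
      by (rule far.att_res_other) (use u k_far k'_far in auto)
    then show ?thesis
      unfolding halves_at_def by blast
  qed
  have att: "att (res G k k' p C) h = att G h" "att (res G k k' p C) h' = att G h'"
    using a by blast+
  show ?thesis
    by (unfold_locales; (unfold att res_simps(2,6))?)
      (use far.BCR_res edge int halves ha k'_far in auto)
qed

end

section \<open>Reversing an edge, exchanging two edges, and the signs of these isomorphisms\<close>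

lemma image_transpose_edge:
  assumes "wf_graph G" "{h, h'} \<in> edges G" "e \<in> edges G"
  shows "transpose h h' ` e = e"
  using wf_graph_edge_unique[OF assms(1,2,3)] by (cases "e = {h, h'}") (auto simp: transpose_def image_iff)

text \<open>An edge other than \<open>{h, h'}\<close> contains neither of its half-edges, so every
  edge is fixed as a set. Hence only the attachments remain as a condition.\<close>

lemma graph_iso_flip:
  assumes "wf_graph G" "verts G' = verts G" "ext G' = ext G" "edges G' = edges G" "solid G' = solid G"
    and "{h, h'} \<in> edges G" "att G h \<in> ext G \<longleftrightarrow> att G h' \<in> ext G"
    and att: "\<And>k. k \<in> \<Union>(edges G) \<Longrightarrow>
      att G' (transpose h h' k) = transpose (att G h) (att G h') (att G k)"
  shows "graph_iso G G' (transpose (att G h) (att G h')) (transpose h h')"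
proof -
  have V: "att G h \<in> verts G" "att G h' \<in> verts G"
    using wf_graph_att[OF assms(1,6)] by auto
  have sol: "solid G \<subseteq> edges G"
    using assms(1) by (simp add: wf_graph_def)
  have "(`) (transpose h h') ` F = F" if "F \<subseteq> edges G" for F
  proof -
    have "(`) (transpose h h') ` F = id ` F"
      using image_transpose_edge[OF assms(1,6)] that by (intro image_cong) auto
    then show ?thesis by simp
  qed
  then have "(`) (transpose h h') ` edges G = edges G" "(`) (transpose h h') ` solid G = solid G"
    using sol by auto
  moreover have "bij_betw (transpose (att G h) (att G h')) (verts G) (verts G)"
    using permutes_imp_bij[OF permutes_swap_id[OF V]] .
  moreover have "bij_betw (transpose h h') (\<Union>(edges G)) (\<Union>(edges G))"
    using assms(6) by (intro permutes_imp_bij permutes_swap_id) auto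
  moreover have "transpose (att G h) (att G h') ` ext G = ext G"
    using assms(7) by (auto simp: transpose_image_eq)
  ultimately show ?thesis
    using att assms(2-5) by (simp add: graph_iso_def)
qed

text \<open>In the odd case the transposition of the endpoints and the reversal of
  \<open>{h, h'}\<close> contribute -1 each; in the even case no edge moves.\<close>

lemma change_sign_flip:
  assumes "wf_graph G" "{h, h'} \<in> edges G" "att G h \<noteq> att G h'" "is_coloring \<kappa> G c"
  shows "change_sign G (transpose (att G h) (att G h')) (transpose h h') c c = 1"
proof -
  have V: "att G h \<in> verts G" "att G h' \<in> verts G"
    using wf_graph_att[OF assms(1,2)] by auto
  have fin: "finite (verts G)" "finite (edges G)"
    using assms(1) by (auto simp: wf_graph_def)
  have hh: "h \<noteq> h'"
    using assms(3) by auto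
  show ?thesis
    using assms(4)
  proof (cases rule: is_coloring_cases)
    case (1 l t)
    have "sign (relabelling (verts G) l (\<lambda>u. l (transpose (att G h) (att G h') u))) =
        sign (transpose (att G h) (att G h'))"
      using 1 fin by (intro sign_relabelling permutes_swap_id V) (auto simp: bij_betw_def)
    moreover have "{e \<in> edges G. t (transpose h h' ` e) \<noteq> transpose h h' (t e)} = {{h, h'}}"
    proof (rule set_eqI)
      fix e
      show "e \<in> {e \<in> edges G. t (transpose h h' ` e) \<noteq> transpose h h' (t e)} \<longleftrightarrow> e \<in> {{h, h'}}"
      proof (cases "e \<in> edges G")
        case True
        have "t e \<in> e"
          using 1 True by simp
        moreover have "e = {h, h'} \<or> h \<notin> e \<and> h' \<notin> e"
          using wf_graph_edge_unique[OF assms(1,2) True] by blast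
        ultimately show ?thesis
          using True hh image_transpose_edge[OF assms(1,2) True] by (auto simp: transpose_def)
      qed (use assms(2) in auto)
    qed
    ultimately show ?thesis
      using 1 assms(3) by (simp add: sign_swap_id)
  next
    case (2 n)
    have "sign (relabelling (edges G) n (\<lambda>e. n (transpose h h' ` e))) = sign (id :: nat set \<Rightarrow> _)"
      using 2 fin image_transpose_edge[OF assms(1,2)]
      by (intro sign_relabelling) (auto simp: bij_betw_def permutes_id)
    then show ?thesis
      using 2 by simp
  qed
qed

text \<open>For the sign: in the odd case the transposition of \<open>u\<close> and \<open>s\<close>
  contributes -1, while either both exchanged edges are reversed or none is, the map on half-edges
  being an involution. In the even case the edge numbers undergo one transposition.\<close>

lemma graph_iso_swap:
  assumes "wf_graph G" "verts G' = verts G" "ext G' = ext G" "edges G' = edges G" "solid G' = solid G"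
    and "{a, a'} \<in> solid G" "{b, b'} \<in> solid G" "{a, a'} \<noteq> {b, b'}" "u \<in> ext G" "s \<in> ext G"
    and att: "\<And>k. k \<in> \<Union>(edges G) \<Longrightarrow>
      att G' (transpose a b (transpose a' b' k)) = transpose u s (att G k)"
  shows "graph_iso G G' (transpose u s) (\<lambda>k. transpose a b (transpose a' b' k))" (is ?iso)
    and "u \<noteq> s \<Longrightarrow> is_coloring \<kappa> G c \<Longrightarrow>
      change_sign G (transpose u s) (\<lambda>k. transpose a b (transpose a' b' k)) c c = - 1" (is "_ \<Longrightarrow> _ \<Longrightarrow> ?sgn")
proof -
  define g where "g = (\<lambda>k. transpose a b (transpose a' b' k))"
  let ?e = "{a, a'}" and ?d = "{b, b'}"
  have sol: "solid G \<subseteq> edges G" "ext G \<subseteq> verts G" and fin: "finite (verts G)" "finite (edges G)"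
    using assms(1) by (auto simp: wf_graph_def)
  have ed: "?e \<in> edges G" "?d \<in> edges G"
    using assms(6,7) sol by auto
  have neq: "a \<noteq> a'" "b \<noteq> b'"
    using wf_graph_edge_neq[OF assms(1)] ed by auto
  have disj: "?e \<inter> ?d = {}"
    using assms(1,8) ed by (auto simp: wf_graph_def)
  then have neq': "a \<noteq> b" "a \<noteq> b'" "a' \<noteq> b" "a' \<noteq> b'"
    by auto
  have g: "g a = b" "g a' = b'" "g b = a" "g b' = a'" "k \<notin> ?e \<Longrightarrow> k \<notin> ?d \<Longrightarrow> g k = k" for k
    using neq neq' by (auto simp: g_def transpose_def)
  have gg: "g (g k) = k" for k
    using g by (cases "k \<in> ?e \<union> ?d") auto
  have ge: "g ` ?e = ?d" "g ` ?d = ?e"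
    using g by auto
  have other: "e \<inter> ?e = {}" "e \<inter> ?d = {}" "g ` e = e" if "e \<in> edges G" "e \<noteq> ?e" "e \<noteq> ?d" for e
  proof -
    have dis: "e \<inter> e' = {}" if "e' \<in> edges G" "e \<noteq> e'" for e'
      using assms(1) \<open>e \<in> edges G\<close> that by (simp add: wf_graph_def)
    show "e \<inter> ?e = {}" "e \<inter> ?d = {}"
      using dis ed that by simp_all
    then have "g k = k" if "k \<in> e" for k
      using that g(5)[of k] by blast
    then show "g ` e = e"
      by simp
  qed
  have tr: "g ` e = transpose ?e ?d e" if "e \<in> edges G" for e
    using other(3)[OF that] ge by (cases "e = ?e"; cases "e = ?d") auto
  have "(`) g ` F = F" if "F \<subseteq> edges G" "?e \<in> F" "?d \<in> F" for F
  proof -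
    have "(`) g ` F = transpose ?e ?d ` F"
      using tr that(1) by (intro image_cong) auto
    then show ?thesis
      using that by (simp add: transpose_image_eq)
  qed
  then have "(`) g ` edges G = edges G" "(`) g ` solid G = solid G"
    using sol ed assms(6,7) by auto
  moreover have "bij_betw (transpose u s) (verts G) (verts G)"
    using assms(9,10) sol by (intro permutes_imp_bij permutes_swap_id) auto
  moreover have "bij_betw g (\<Union>(edges G)) (\<Union>(edges G))"
  proof -
    have "g k \<in> \<Union>(edges G)" if "k \<in> \<Union>(edges G)" for k
      using that g(5)[of k] g(1-4) ed by (cases "k \<in> ?e"; cases "k \<in> ?d") auto
    then show ?thesis
      using gg by (intro bij_betwI[where g = g]) auto
  qed
  moreover have "transpose u s ` ext G = ext G"
    using assms(9,10) by (auto simp: transpose_image_eq)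
  ultimately show ?iso
    using att assms(2-5) unfolding g_def by (simp add: graph_iso_def)
  assume us: "u \<noteq> s" and col: "is_coloring \<kappa> G c"
  have "change_sign G (transpose u s) g c c = - 1"
    using col
  proof (cases rule: is_coloring_cases)
    case (1 l t)
    have "sign (relabelling (verts G) l (\<lambda>v. l (transpose u s v))) = sign (transpose u s)"
      using 1 fin assms(9,10) sol
      by (intro sign_relabelling permutes_swap_id) (auto simp: bij_betw_def)
    moreover have "{e \<in> edges G. t (g ` e) \<noteq> g (t e)} = (if t ?d = g (t ?e) then {} else {?e, ?d})"
    proof -
      have "t e \<in> e" if "e \<in> edges G" for e
        using 1 that by simp
      then have "g (t e) = t e" if "e \<in> edges G" "e \<noteq> ?e" "e \<noteq> ?d" for e
        using that other(1,2)[OF that] g(5)[of "t e"] by blast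
      then have "t (g ` e) \<noteq> g (t e) \<longleftrightarrow> e \<in> {?e, ?d} \<and> t ?d \<noteq> g (t ?e)" if "e \<in> edges G" for e
      proof -
        consider "e = ?e" | "e = ?d" | "e \<noteq> ?e" "e \<noteq> ?d"
          by blast
        then show ?thesis
        proof cases
          case 1
          show ?thesis
            unfolding 1 ge by simp
        next
          case 2
          have "t ?e = g (t ?d) \<longleftrightarrow> t ?d = g (t ?e)"
            using gg by metis
          then show ?thesis
            unfolding 2 ge by simp
        next
          case 3
          then show ?thesis
            using other(3)[OF that] \<open>\<And>e. e \<in> edges G \<Longrightarrow> e \<noteq> ?e \<Longrightarrow> e \<noteq> ?d \<Longrightarrow> g (t e) = t e\<close>[OF that]
            by simp
        qed
      qed
      then show ?thesis
        using ed by auto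
    qed
    moreover have "(- 1 :: int) ^ card (if t ?d = g (t ?e) then {} else {?e, ?d}) = 1"
      using assms(8) by simp
    ultimately show ?thesis
      using 1 us by (simp add: sign_swap_id)
  next
    case (2 n)
    have "sign (relabelling (edges G) n (\<lambda>e. n (g ` e))) = sign (transpose ?e ?d)"
      using 2 fin tr by (intro sign_relabelling permutes_swap_id ed) (auto simp: bij_betw_def)
    then show ?thesis
      using 2 assms(8) by (simp add: sign_swap_id)
  qed
  then show ?sgn
    unfolding g_def .
qed

lemma halves_at_iso:
  assumes "graph_iso G G' f g" "wf_graph G" "F \<subseteq> edges G" "F' = (`) g ` F" "u \<in> verts G"
  shows "halves_at G' F' (f u) = g ` halves_at G F u"
proof -
  have U: "\<Union>F' = g ` \<Union>F"
    using assms(4) by auto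
  have sub: "\<Union>F \<subseteq> \<Union>(edges G)"
    using assms(3) by auto
  have "att G' (g k) = f (att G k)" "att G k \<in> verts G" if "k \<in> \<Union>F" for k
    using that assms(1,2) sub by (auto simp: graph_iso_def wf_graph_def image_subset_iff)
  moreover have "inj_on f (verts G)"
    using assms(1) by (auto simp: graph_iso_def bij_betw_def)
  ultimately have "att G' (g k) = f u \<longleftrightarrow> att G k = u" if "k \<in> \<Union>F" for k
    using that assms(5) by (metis inj_onD)
  then show ?thesis
    unfolding halves_at_def U by auto
qed

lemma graph_iso_int_verts:
  assumes "graph_iso G G' f g" "wf_graph G"
  shows "int_verts G' = f ` int_verts G"
proof -
  have "ext G \<subseteq> verts G" "inj_on f (verts G)"
    using assms by (auto simp: graph_iso_def wf_graph_def bij_betw_def)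
  then have "f ` (verts G - ext G) = f ` verts G - f ` ext G"
    by (intro inj_on_image_set_diff[where C = "verts G"]) auto
  then show ?thesis
    using assms(1) by (simp add: graph_iso_def int_verts_def bij_betw_def)
qed

lemma graph_iso_card_int:
  assumes "graph_iso G G' f g" "wf_graph G"
  shows "card (int_verts G') = card (int_verts G)"
proof -
  have "inj_on f (int_verts G)"
    using assms(1) by (auto simp: graph_iso_def bij_betw_def int_verts_def intro: inj_on_subset)
  then show ?thesis
    unfolding graph_iso_int_verts[OF assms] by (rule card_image)
qed

context BCR_leg
begin

lemma leg_iso:
  assumes iso: "graph_iso G G' f g" and "BCR_graph G'"
  shows "leg G' (g h) (g h') (g x) (g y) (g ` B)"
    and "graph_iso (res G h h' x B) (res G' (g h) (g h') (g x) (g ` B)) f g"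
    and "halves_at G' (solid G') (att G' (g h)) = {} \<longleftrightarrow> halves_at G (solid G) v = {}"
proof -
  have f: "bij_betw f (verts G) (verts G')" and fe: "f ` ext G = ext G'"
    and g: "bij_betw g (\<Union>(edges G)) (\<Union>(edges G'))"
    and E: "edges G' = (`) g ` edges G" "solid G' = (`) g ` solid G"
    and att: "\<And>k. k \<in> \<Union>(edges G) \<Longrightarrow> att G' (g k) = f (att G k)"
    using iso by (auto simp: graph_iso_def)
  have sol: "solid G \<subseteq> edges G" "ext G \<subseteq> verts G"
    using wf by (auto simp: wf_graph_def)
  have gi: "inj_on g (\<Union>(edges G))" and fi: "inj_on f (verts G)"
    using f g by (auto simp: bij_betw_def)
  have ih: "att G' (g h) = f v" "att G' (g h') = f w" "att G' (g x) = f w" "att G' (g y) = f w"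
    using att in_edges att_xy by simp_all
  have img: "inj_on ((`) g) (edges G)"
    using gi by (intro inj_onI) (metis Union_upper inj_on_image_eq_iff)
  have D: "dashed G' = (`) g ` dashed G"
    unfolding dashed_def E using img sol by (simp add: inj_on_image_set_diff[where C = "edges G"])
  have I: "int_verts G' = f ` int_verts G"
    using graph_iso_int_verts[OF iso wf] .
  have S: "halves_at G' (solid G') (f v) = g ` halves_at G (solid G) v"
    using halves_at_iso[OF iso wf sol(1) E(2)] v by blast
  have "halves_at G' (edges G') (f w) = g ` {h', x, y}"
    using halves_at_iso[OF iso wf order.refl E(1) w(2)] halves_w(1) by simp
  moreover have "distinct [g h', g x, g y]"
    using gi in_edges halves_w unfolding inj_on_def by auto
  moreover have "{g h, g h'} \<in> dashed G'"
    unfolding D using edge(1) by (auto intro!: image_eqI[of _ _ "{h, h'}"])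
  moreover have "f v \<in> ext G'" "f w \<in> int_verts G'"
    using fe I v w by auto
  moreover have "halves_at G (solid G) v = {} \<and> B = {} \<or>
      (\<exists>a. a \<notin> B \<and> halves_at G (solid G) v = insert a B)"
    using leg by (simp add: leg_def)
  then have "g ` halves_at G (solid G) v = {} \<and> g ` B = {} \<or>
      (\<exists>a. a \<notin> g ` B \<and> g ` halves_at G (solid G) v = insert a (g ` B))"
  proof (elim disjE exE conjE)
    fix a assume a: "a \<notin> B" "halves_at G (solid G) v = insert a B"
    have "halves_at G (solid G) v \<subseteq> \<Union>(edges G)"
      using sol by (auto simp: halves_at_def)
    then have "a \<in> \<Union>(edges G)" "B \<subseteq> \<Union>(edges G)"
      unfolding a(2) by auto
    then have "g a \<notin> g ` B"
      using a(1) inj_on_image_mem_iff[OF gi] by blast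
    then show ?thesis
      using a by auto
  qed simp
  ultimately show "leg G' (g h) (g h') (g x) (g y) (g ` B)"
    unfolding leg_def ih S by simp
  show "halves_at G' (solid G') (att G' (g h)) = {} \<longleftrightarrow> halves_at G (solid G) v = {}"
    unfolding ih S by simp
  have eq: "g k = g x \<longleftrightarrow> k = x" "g k \<in> g ` B \<longleftrightarrow> k \<in> B" if "k \<in> \<Union>(edges G)" for k
  proof -
    show "g k = g x \<longleftrightarrow> k = x"
      using that gi in_edges(3) by (auto simp: inj_on_eq_iff)
    have "B \<subseteq> \<Union>(edges G)"
      using B_props(3) by blast
    then show "g k \<in> g ` B \<longleftrightarrow> k \<in> B"
      using that gi by (simp add: inj_on_image_mem_iff)
  qed
  have "att (res G' (g h) (g h') (g x) (g ` B)) (g k) = f (att (res G h h' x B) k)"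
    if "k \<in> \<Union>(edges G)" for k
    unfolding res_simps eq[OF that] ih using att[OF that] by simp
  then show "graph_iso (res G h h' x B) (res G' (g h) (g h') (g x) (g ` B)) f g"
    using f g fe E ih by (simp add: graph_iso_def)
qed

end


section \<open>The Jacobi identity for chains of three external vertices\<close>

text \<open>The right-hand side of an STU relation in which every graph carries the coloring
  \<open>c\<close> of \<open>G\<close>. This makes sense because a resolution keeps the vertices and
  the edges.\<close>

definition stu :: "graph \<Rightarrow> coloring \<Rightarrow> nat \<Rightarrow> nat \<Rightarrow> nat \<Rightarrow> nat \<Rightarrow> nat set \<Rightarrow> comb" where
  "stu G c h h' x y B = - gen (res G h h' x B, c) -
     (if halves_at G (solid G) (att G h) = {} then 0 else gen (res G h h' y B, c))"

context BCR_leg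
begin

lemma card_att_edge: "card (att G ` {h, h'}) = 2"
  using w(4) by simp

text \<open>The resolution moves half-edges only between the ends of \<open>{h, h'}\<close>, which
  the contraction merges into one vertex, external for either graph.\<close>

lemma collapse_res: "collapse (res G h h' x B) {h, h'} = collapse G {h, h'}"
proof -
  have a: "att (res G h h' x B) h = v" "att (res G h h' x B) h' = w"
    using h_neq halves_w B_props(4,5) by simp_all
  then have im: "att (res G h h' x B) ` {h, h'} = {v, w}"
    by (simp only: image_insert image_empty)
  have im': "att G ` {h, h'} = {v, w}"
    by simp
  have m: "merged (res G h h' x B) {h, h'} = merged G {h, h'}"
    unfolding merged_def im im' ..
  have "(if att (res G h h' x B) k \<in> {v, w} then m else att (res G h h' x B) k) =
      (if att G k \<in> {v, w} then m else att G k)" for k m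
    using B_props(1)[of k] by (cases "k = x"; cases "k \<in> B") simp_all
  then show ?thesis
    unfolding collapse_def m im im' using v w by (intro graph.equality) auto
qed

lemma same_contraction_res:
  assumes "is_coloring \<kappa> G c"
  shows "same_contraction \<kappa> {h, h'} (G, c) (res G h h' x B, c)"
proof (rule same_contractionI[OF wf _ _ assms edge(2) card_att_edge])
  show "graph_iso (collapse G {h, h'}) (collapse (res G h h' x B) {h, h'}) id id"
    unfolding collapse_res by (simp add: graph_iso_def image_iff)
qed (use h_neq halves_w B_props(4,5) in auto)

lemma STU_resolve_eq:
  assumes "A = {} \<or> A = {a}" "\<And>k. k \<in> A \<Longrightarrow> att G k = v" "A \<inter> B = {}"
  shows "STU_resolve G {h, h'} v w (A \<union> {x}) (insert y B) = res G h h' x B"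
proof -
  have "att (STU_resolve G {h, h'} v w (A \<union> {x}) (insert y B)) k = att (res G h h' x B) k" for k
    using assms att_xy(2) by (auto simp: STU_resolve_def reattach_def)
  then have "att (STU_resolve G {h, h'} v w (A \<union> {x}) (insert y B)) = att (res G h h' x B)"
    by blast
  then show ?thesis
    by (intro graph.equality) (simp_all add: STU_resolve_def reattach_def del: res_simps(5))
qed

lemma STU_stu:
  assumes "is_coloring \<kappa> G c"
  shows "STU \<kappa> (G, c) {h, h'} (stu G c h h' x y B)"
proof -
  interpret sw: BCR_leg G h h' y x B
    by (rule swap)
  have col: "(G, c) \<in> colored_BCR \<kappa>" "(res G h h' x B, c) \<in> colored_BCR \<kappa>"
    "(res G h h' y B, c) \<in> colored_BCR \<kappa>"
    using assms BCR BCR_res sw.BCR_res is_coloring_cong[of "res G h h' x B" G \<kappa> c]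
      is_coloring_cong[of "res G h h' y B" G \<kappa> c]
    by (auto simp: colored_BCR_def)
  have sl: "STU_leg G {h, h'} v w x y"
    unfolding STU_leg_def using edge v w halves_w by auto
  show ?thesis
  proof (cases "halves_at G (solid G) v = {}")
    case True
    then have "B = {}"
      using B_subset by simp
    then have "STU_resolve G {h, h'} v w {x} {y} = res G h h' x B"
      using STU_resolve_eq[of "{}"] by simp
    then have "STU \<kappa> (G, c) {h, h'} (- gen (res G h h' x B, c))"
      using col sl True same_contraction_res[OF assms]
      by (intro STU_II[where v = v and w = w and x = x and y = y]) simp_all
    then show ?thesis
      using True by (simp add: stu_def)
  next
    case False
    obtain a where a: "a \<notin> B" "halves_at G (solid G) v = insert a B"
      using leg False by (auto simp: leg_def)
    have av: "att G a = v"
      using a(2) by (auto simp: halves_at_def)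
    have "STU_resolve G {h, h'} v w {a, x} (insert y B) = res G h h' x B"
      "STU_resolve G {h, h'} v w {a, y} (insert x B) = res G h h' y B"
      using STU_resolve_eq[of "{a}" a] sw.STU_resolve_eq[of "{a}" a] a(1) av by (simp_all add: insert_commute)
    moreover have "B = {} \<or> (\<exists>b. B = {b})"
      by (rule B_cases) auto
    ultimately have "STU \<kappa> (G, c) {h, h'} (- gen (res G h h' x B, c) - gen (res G h h' y B, c))"
      using col sl a same_contraction_res[OF assms] sw.same_contraction_res[OF assms]
      by (intro STU_I[where v = v and w = w and x = x and y = y and a = a and B = B]) simp_all
    then show ?thesis
      using False by (simp add: stu_def)
  qed
qed

text \<open>Reversing the new solid edge exchanges the roles of \<open>x\<close> and
  \<open>y\<close> and those of the solid half-edges that stay and that move. It compares the two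
  choices of \<open>B\<close> at a vertex with two solid half-edges, and the two orders of
  \<open>x\<close>, \<open>y\<close> at a vertex with none.\<close>

lemma flip_iso:
  assumes "B' = halves_at G (solid G) v - B"
  shows "graph_iso (res G h h' x B) (res G h h' y B') (transpose v w) (transpose h h')"
proof -
  have a: "att (res G h h' x B) h = v" "att (res G h h' x B) h' = w"
    using h_neq halves_w B_props(4,5) by simp_all
  have hB: "h \<notin> B'" "h' \<notin> B'" "x \<notin> B'" "y \<notin> B'"
    using notin_solid assms by (auto simp: halves_at_def)
  have B'v: "k \<in> B' \<longrightarrow> att G k = v \<and> k \<notin> B" for k
    using assms by (auto simp: halves_at_def)
  have "att (res G h h' y B') (transpose h h' k) = transpose v w (att (res G h h' x B) k)"
    if k: "k \<in> \<Union>(edges G)" for k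
  proof -
    consider "k = h" | "k = h'" | "k = x" | "k = y" | "k \<in> B" | "k \<in> B'"
      | "k \<notin> {h, h', x, y}" "k \<notin> B" "k \<notin> B'" "att G k \<noteq> v" "att G k \<noteq> w"
      using att_v_iff[OF k] att_w_iff[OF k] assms by auto
    then show ?thesis
    proof cases
      case 5
      then have "k \<notin> {h, h', x, y}" "k \<notin> B'" "att G k = v"
        using B_props assms by auto
      then show ?thesis
        using 5 by simp
    next
      case 6
      then have "k \<notin> {h, h', x, y}" "k \<notin> B" "att G k = v"
        using hB B'v by auto
      then show ?thesis
        using 6 by simp
    qed (use a hB h_neq halves_w B_props(4-7) w(4) in simp_all)
  qed
  then show ?thesis
    using graph_iso_flip[of "res G h h' x B" "res G h h' y B'" h h', unfolded a]
      BCR_res[THEN BCR_wf] edge(2) v(1) by simp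
qed

end

context BCR_int_edge
begin

text \<open>Both graphs separate \<open>{x, z}\<close> from \<open>{y, t}\<close>; only the ends of
  \<open>{h, h'}\<close> at which the two pairs sit are interchanged.\<close>

lemma mirror_iso:
  "graph_iso (exch G y z) (exch G x t) (transpose (att G h) (att G h')) (transpose h h')"
proof -
  have a: "att (exch G y z) h = att G h" "att (exch G y z) h' = att G h'"
    using neq by (simp_all add: transpose_def)
  have "att (exch G x t) (transpose h h' k) = transpose (att G h) (att G h') (att (exch G y z) k)"
    if k: "k \<in> \<Union>(edges G)" for k
  proof -
    have "k \<in> {h, x, y} \<longleftrightarrow> att G k = att G h" "k \<in> {h', z, t} \<longleftrightarrow> att G k = att G h'"
      using halves(2,4) k by (auto simp: halves_at_def)
    then consider "k = h" | "k = x" | "k = y" | "k = h'" | "k = z" | "k = t"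
      | "k \<notin> {h, x, y, h', z, t}" "att G k \<noteq> att G h" "att G k \<noteq> att G h'"
      by auto
    then show ?thesis
      by cases (use neq int(3) in \<open>simp_all add: transpose_def att_halves\<close>)
  qed
  then show ?thesis
    using graph_iso_flip[of "exch G y z" "exch G x t" h h', unfolded a]
      BCR_exch[THEN BCR_wf] edge int(1,2) by (simp add: int_verts_def)
qed

end

text \<open>
  The vertices \<open>v\<close>, \<open>w\<close>, \<open>u\<close> carrying the half-edges \<open>h\<close>, \<open>h'\<close>, \<open>y'\<close> become consecutive external vertices
  carrying the dashed half-edges \<open>\<alpha>\<close>, \<open>\<beta>\<close>, \<open>\<gamma>\<close>: in \<open>chain\<close> in the order \<open>v\<close>, \<open>w\<close>, \<open>u\<close>, in \<open>chain'\<close> in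
  the order \<open>v\<close>, \<open>u\<close>, \<open>w\<close>. The two differ by exchanging two solid edges and two vertices, hence by a sign.\<close>

definition chain :: "graph \<Rightarrow> nat \<Rightarrow> nat \<Rightarrow> nat \<Rightarrow> nat \<Rightarrow> nat set \<Rightarrow> nat \<Rightarrow> nat \<Rightarrow> nat \<Rightarrow> graph" where
  "chain G h h' y y' B \<alpha> \<beta> \<gamma> = G\<lparr>ext := insert (att G y') (insert (att G h') (ext G)),
     solid := insert {y, y'} (insert {h, h'} (solid G)),
     att := (\<lambda>k. if k = \<alpha> then att G h else if k = \<beta> then att G h'
       else if k = \<gamma> \<or> k \<in> B then att G y' else att G k)\<rparr>"

definition chain' :: "graph \<Rightarrow> nat \<Rightarrow> nat \<Rightarrow> nat \<Rightarrow> nat \<Rightarrow> nat set \<Rightarrow> nat \<Rightarrow> nat \<Rightarrow> nat \<Rightarrow> graph" where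
  "chain' G h h' y y' B \<alpha> \<beta> \<gamma> = G\<lparr>ext := insert (att G y') (insert (att G h') (ext G)),
     solid := insert {y, y'} (insert {h, h'} (solid G)),
     att := (\<lambda>k. if k = y \<or> k = \<alpha> then att G h else if k = h \<or> k = \<beta> then att G y'
       else if k = \<gamma> \<or> k \<in> B then att G h' else att G k)\<rparr>"

lemma chain_simps [simp]:
  "verts (chain G h h' y y' B \<alpha> \<beta> \<gamma>) = verts G" "edges (chain G h h' y y' B \<alpha> \<beta> \<gamma>) = edges G"
  "verts (chain' G h h' y y' B \<alpha> \<beta> \<gamma>) = verts G" "edges (chain' G h h' y y' B \<alpha> \<beta> \<gamma>) = edges G"
  "ext (chain G h h' y y' B \<alpha> \<beta> \<gamma>) = insert (att G y') (insert (att G h') (ext G))"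
  "ext (chain' G h h' y y' B \<alpha> \<beta> \<gamma>) = insert (att G y') (insert (att G h') (ext G))"
  "solid (chain G h h' y y' B \<alpha> \<beta> \<gamma>) = insert {y, y'} (insert {h, h'} (solid G))"
  "solid (chain' G h h' y y' B \<alpha> \<beta> \<gamma>) = insert {y, y'} (insert {h, h'} (solid G))"
  "att (chain G h h' y y' B \<alpha> \<beta> \<gamma>) k = (if k = \<alpha> then att G h else if k = \<beta> then att G h'
       else if k = \<gamma> \<or> k \<in> B then att G y' else att G k)"
  "att (chain' G h h' y y' B \<alpha> \<beta> \<gamma>) k = (if k = y \<or> k = \<alpha> then att G h else if k = h \<or> k = \<beta> then att G y'
       else if k = \<gamma> \<or> k \<in> B then att G h' else att G k)"
  by (simp_all add: chain_def chain'_def)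

text \<open>The leg \<open>{h, h'}\<close> ends at \<open>w\<close>, and \<open>{y, y'}\<close>
  leads on to the internal vertex \<open>u\<close> with the further half-edges \<open>p\<close> and
  \<open>q\<close>. Resolving \<open>w\<close> and then \<open>u\<close> turns this tree into a
  chain of three external vertices carrying \<open>x\<close>, \<open>p\<close>,
  \<open>q\<close>.\<close>

locale jacobi = BCR_leg G h h' x y B + tri: BCR_int_edge G y y' h' x p q
  for G h h' x y B y' p q
begin

abbreviation "u \<equiv> att G y'"

lemma u: "u \<in> int_verts G" "u \<noteq> v" "u \<noteq> w" "u \<notin> ext G" "u \<in> verts G"
  using tri.int v(3) by (auto simp: int_verts_def)

lemma att_u_iff: "k \<in> \<Union>(edges G) \<Longrightarrow> att G k = u \<longleftrightarrow> k \<in> {y', p, q}"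
  using tri.halves(4) by (auto simp: halves_at_def)

lemma att_pq: "att G p = u" "att G q = u"
  using tri.att_halves by auto

lemma distinct_halves: "distinct [h, h', x, y, y', p, q]"
proof -
  have "h \<noteq> y'" "h \<noteq> p" "h \<noteq> q"
    using u(2) att_pq by metis+
  then show ?thesis
    using h_neq halves_w(2-4) tri.neq by auto
qed

lemma halves_neq:
  "h \<noteq> h'" "h \<noteq> x" "h \<noteq> y" "h \<noteq> y'" "h \<noteq> p"
  "h \<noteq> q" "h' \<noteq> x" "h' \<noteq> y" "h' \<noteq> y'" "h' \<noteq> p"
  "h' \<noteq> q" "x \<noteq> y" "x \<noteq> y'" "x \<noteq> p" "x \<noteq> q"
  "y \<noteq> y'" "y \<noteq> p" "y \<noteq> q" "y' \<noteq> p" "y' \<noteq> q"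
  "p \<noteq> q"
  using distinct_halves by auto

lemma notin_B: "h \<notin> B" "h' \<notin> B" "x \<notin> B" "y \<notin> B" "y' \<notin> B" "p \<notin> B" "q \<notin> B"
  using B_props(4-7) B_props(1)[of y'] B_props(1)[of p] B_props(1)[of q] att_pq u(2) by auto

lemma jacobi_swap: "jacobi G h h' x y B y' q p"
  using BCR_leg_axioms tri.swap by (rule jacobi.intro)

lemma jacobi_exch: "jacobi (exch G x p) h h' p y B y' x q"
proof -
  have a: "att (exch G x p) h = v" "att (exch G x p) h' = w"
    using halves_neq by (simp_all add: transpose_def)
  have "halves_at (exch G x p) (edges G) w = {h', p, y}"
    using tri.halves_exch(1) by (simp add: insert_commute)
  then have "leg (exch G x p) h h' p y B"
    using leg halves_neq unfolding leg_def a exch_simps(2,3,4,6,7) tri.halves_exch_solid by simp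
  then show ?thesis
    using tri.BCR_exch tri.exch_int_edge by (intro jacobi.intro BCR_leg.intro)
qed

text \<open>At the new external vertex \<open>w\<close> the solid half-edge \<open>h'\<close> stays,
  and \<open>B\<close> is passed on to \<open>u\<close>.\<close>

lemma leg_T: "leg (res G h h' x B) y y' p q B"
proof -
  have a: "att (res G h h' x B) y = w" "att (res G h h' x B) y' = u"
    using halves_neq notin_B by simp_all
  have "halves_at (res G h h' x B) (edges G) u = {y', p, q}"
    unfolding tri.halves(4)[symmetric] halves_at_def using att_res_other[OF u(2,3)] by simp
  moreover have "{y, y'} \<noteq> {h, h'}"
    using halves_neq by (auto simp: doubleton_eq_iff)
  ultimately show ?thesis
    unfolding leg_def a solid_after(2) res_simps(2,3,6,7)
    using tri.in_dashed(1) u halves_neq notin_B(2) by auto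
qed

text \<open>Here \<open>y\<close> has moved to \<open>v\<close>, whose solid half-edges are an old
  one and \<open>h\<close>. Letting \<open>h\<close> move inserts \<open>u\<close> between
  \<open>v\<close> and \<open>w\<close>.\<close>

lemma leg_U:
  assumes "halves_at G (solid G) v \<noteq> {}"
  shows "leg (res G h h' y B) y y' p q {h}"
proof -
  interpret sw: BCR_leg G h h' y x B
    by (rule swap)
  obtain a where a: "a \<notin> B" "halves_at G (solid G) v = insert a B"
    using leg assms by (auto simp: leg_def)
  have ha: "a \<noteq> h"
    using a(2) notin_solid(1) by (auto simp: halves_at_def)
  have sv: "halves_at (res G h h' y B) (solid (res G h h' y B)) v = {a, h}"
    unfolding sw.solid_after(1) a(2) using a(1) by auto
  have at: "att (res G h h' y B) y = v" "att (res G h h' y B) y' = u"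
    using halves_neq notin_B by simp_all
  have "halves_at (res G h h' y B) (edges G) u = {y', p, q}"
    unfolding tri.halves(4)[symmetric] halves_at_def using sw.att_res_other[OF u(2,3)] by simp
  moreover have "{y, y'} \<noteq> {h, h'}"
    using halves_neq by (auto simp: doubleton_eq_iff)
  ultimately show ?thesis
    unfolding leg_def at sv res_simps(2,3,6,7)
    using tri.in_dashed(1) u v halves_neq ha by auto
qed

lemma res_T: "res (res G h h' x B) y y' p B = chain G h h' y y' B x p q"
proof -
  have "att (res (res G h h' x B) y y' p B) k = att (chain G h h' y y' B x p q) k" for k
    using halves_neq notin_B att_pq by simp
  then have "att (res (res G h h' x B) y y' p B) = att (chain G h h' y y' B x p q)"
    by blast
  then show ?thesis
    using halves_neq notin_B
    by (intro graph.equality) (simp_all add: chain_def res_def)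
qed

lemma res_U: "res (res G h h' y B) y y' p {h} = chain' G h h' y y' B p q x"
proof -
  have "att (res (res G h h' y B) y y' p {h}) k = att (chain' G h h' y y' B p q x) k" for k
    using halves_neq notin_B att_pq B_props(1)[of k] by (cases "k \<in> B") auto
  then have "att (res (res G h h' y B) y y' p {h}) = att (chain' G h h' y y' B p q x)"
    by blast
  then show ?thesis
    using halves_neq notin_B
    by (intro graph.equality) (simp_all add: chain'_def res_def)
qed

lemma BCR_chain: "BCR_graph (chain G h h' y y' B x p q)"
  using BCR_leg.BCR_res[OF BCR_leg.intro[OF BCR_res leg_T]] unfolding res_T .

lemma BCR_chain':
  assumes "halves_at G (solid G) v \<noteq> {}"
  shows "BCR_graph (chain' G h h' y y' B p q x)"
  using BCR_leg.BCR_res[OF BCR_leg.intro[OF BCR_leg.BCR_res[OF swap] leg_U[OF assms]]]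
  unfolding res_U .

lemma int_chain: "int_verts (chain G h h' y y' B \<alpha> \<beta> \<gamma>) = int_verts G - {w, u}"
  by (auto simp: int_verts_def)

lemma card_int_chain: "card (int_verts G) = Suc (Suc m) \<Longrightarrow> card (int_verts (chain G h h' y y' B \<alpha> \<beta> \<gamma>)) = m"
  unfolding int_chain using w(1) u(1,3) by (simp add: card_Diff_subset)

lemma half_cases:
  assumes "k \<in> \<Union>(edges G)"
  obtains "k = h" | "k = h'" | "k = x" | "k = y" | "k = y'" | "k = p" | "k = q" | "k \<in> B"
    | "k \<notin> {h, h', x, y, y', p, q}" "k \<notin> B" "att G k \<noteq> w" "att G k \<noteq> u"
  using att_w_iff[OF assms] att_u_iff[OF assms] by blast

lemma chain_iso:
  assumes "{\<alpha>, \<beta>, \<gamma>} = {x, p, q}" "distinct [\<alpha>, \<beta>, \<gamma>]" "BCR_graph (chain G h h' y y' B \<alpha> \<beta> \<gamma>)"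
  shows "graph_iso (chain G h h' y y' B \<alpha> \<beta> \<gamma>) (chain' G h h' y y' B \<alpha> \<beta> \<gamma>) (transpose w u)
      (\<lambda>k. transpose h y (transpose h' y' k))"
    and "is_coloring \<kappa> G c \<Longrightarrow> change_sign (chain G h h' y y' B \<alpha> \<beta> \<gamma>) (transpose w u)
      (\<lambda>k. transpose h y (transpose h' y' k)) c c = - 1"
proof -
  let ?N = "chain G h h' y y' B \<alpha> \<beta> \<gamma>" and ?N' = "chain' G h h' y y' B \<alpha> \<beta> \<gamma>"
  have in_abc: "\<alpha> \<in> {x, p, q}" "\<beta> \<in> {x, p, q}" "\<gamma> \<in> {x, p, q}"
    using assms(1) by auto
  have d: "\<alpha> \<noteq> h" "\<alpha> \<noteq> h'" "\<alpha> \<noteq> y" "\<alpha> \<noteq> y'" "\<beta> \<noteq> h" "\<beta> \<noteq> h'" "\<beta> \<noteq> y" "\<beta> \<noteq> y'"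
    "\<gamma> \<noteq> h" "\<gamma> \<noteq> h'" "\<gamma> \<noteq> y" "\<gamma> \<noteq> y'" "\<alpha> \<noteq> \<beta>" "\<alpha> \<noteq> \<gamma>" "\<beta> \<noteq> \<gamma>"
    "\<alpha> \<notin> B" "\<beta> \<notin> B" "\<gamma> \<notin> B"
    using in_abc halves_neq notin_B assms(2) by auto
  have "att ?N' (transpose h y (transpose h' y' k)) = transpose w u (att ?N k)" if k: "k \<in> \<Union>(edges G)" for k
  proof -
    have "k \<in> {x, p, q} \<longleftrightarrow> k \<in> {\<alpha>, \<beta>, \<gamma>}"
      using assms(1) by simp
    with k consider "k = h" | "k = h'" | "k = y" | "k = y'" | "k = \<alpha>" | "k = \<beta>" | "k = \<gamma>" | "k \<in> B"
      | "k \<notin> {h, h', y, y', \<alpha>, \<beta>, \<gamma>}" "k \<notin> B" "att G k \<noteq> w" "att G k \<noteq> u"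
      by (elim half_cases) auto
    then show ?thesis
    proof cases
      case 8
      then have "k \<notin> {h, h', y, y', \<alpha>, \<beta>, \<gamma>}"
        using notin_B d by auto
      then show ?thesis
        using 8 u w(4) by (simp add: transpose_def)
    qed (use d halves_neq notin_B u w(4) in \<open>simp_all add: transpose_def\<close>)
  qed
  then have att: "k \<in> \<Union>(edges ?N) \<Longrightarrow> att ?N' (transpose h y (transpose h' y' k)) = transpose w u (att ?N k)" for k
    by simp
  have e: "{h, h'} \<in> solid ?N" "{y, y'} \<in> solid ?N" "{h, h'} \<noteq> {y, y'}" "w \<in> ext ?N" "u \<in> ext ?N"
    using halves_neq by (auto simp: doubleton_eq_iff)
  note swap = graph_iso_swap[OF BCR_wf[OF assms(3)] _ _ _ _ e att]
  show "graph_iso ?N ?N' (transpose w u) (\<lambda>k. transpose h y (transpose h' y' k))"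
    by (rule swap(1)) simp_all
  show "change_sign ?N (transpose w u) (\<lambda>k. transpose h y (transpose h' y' k)) c c = - 1"
    if "is_coloring \<kappa> G c"
    by (rule swap(2)[where \<kappa> = \<kappa>]) (use that u is_coloring_cong[of ?N G \<kappa> c] in simp_all)
qed

text \<open>Without solid edges at \<open>v\<close> the chain is a whole path. Its reversal
  exchanges its two edges and its two end vertices, an odd change.\<close>

lemma chain_reverse_iso:
  assumes "{\<alpha>, \<beta>, \<gamma>} = {x, p, q}" "distinct [\<alpha>, \<beta>, \<gamma>]" "BCR_graph (chain G h h' y y' B \<alpha> \<beta> \<gamma>)"
    and "halves_at G (solid G) v = {}"
  shows "graph_iso (chain G h h' y y' B \<alpha> \<beta> \<gamma>) (chain G h h' y y' B \<gamma> \<beta> \<alpha>) (transpose v u)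
      (\<lambda>k. transpose h y' (transpose h' y k))"
    and "is_coloring \<kappa> G c \<Longrightarrow> change_sign (chain G h h' y y' B \<alpha> \<beta> \<gamma>) (transpose v u)
      (\<lambda>k. transpose h y' (transpose h' y k)) c c = - 1"
proof -
  let ?N = "chain G h h' y y' B \<alpha> \<beta> \<gamma>" and ?N' = "chain G h h' y y' B \<gamma> \<beta> \<alpha>"
  have B: "B = {}"
    using B_subset assms(4) by simp
  have in_abc: "\<alpha> \<in> {x, p, q}" "\<beta> \<in> {x, p, q}" "\<gamma> \<in> {x, p, q}"
    using assms(1) by auto
  have d: "\<alpha> \<noteq> h" "\<alpha> \<noteq> h'" "\<alpha> \<noteq> y" "\<alpha> \<noteq> y'" "\<beta> \<noteq> h" "\<beta> \<noteq> h'" "\<beta> \<noteq> y" "\<beta> \<noteq> y'"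
    "\<gamma> \<noteq> h" "\<gamma> \<noteq> h'" "\<gamma> \<noteq> y" "\<gamma> \<noteq> y'" "\<alpha> \<noteq> \<beta>" "\<alpha> \<noteq> \<gamma>" "\<beta> \<noteq> \<gamma>"
    using in_abc halves_neq assms(2) by auto
  have "att ?N' (transpose h y' (transpose h' y k)) = transpose v u (att ?N k)" if k: "k \<in> \<Union>(edges G)" for k
  proof -
    have "k \<in> {x, p, q} \<longleftrightarrow> k \<in> {\<alpha>, \<beta>, \<gamma>}"
      using assms(1) by simp
    moreover have "k \<noteq> h \<Longrightarrow> att G k \<noteq> v"
      using att_v_iff[OF k] assms(4) by simp
    ultimately consider "k = h" | "k = h'" | "k = y" | "k = y'" | "k = \<alpha>" | "k = \<beta>" | "k = \<gamma>"
      | "k \<notin> {h, h', y, y', \<alpha>, \<beta>, \<gamma>}" "att G k \<noteq> v" "att G k \<noteq> u"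
      using k B by (elim half_cases) auto
    then show ?thesis
      by cases (use B d halves_neq u w(4) in \<open>simp_all add: transpose_def\<close>)
  qed
  then have att: "k \<in> \<Union>(edges ?N) \<Longrightarrow> att ?N' (transpose h y' (transpose h' y k)) = transpose v u (att ?N k)" for k
    by simp
  have e: "{h, h'} \<in> solid ?N" "{y', y} \<in> solid ?N" "{h, h'} \<noteq> {y', y}" "v \<in> ext ?N" "u \<in> ext ?N"
    using halves_neq v by (auto simp: doubleton_eq_iff insert_commute)
  note swap = graph_iso_swap[OF BCR_wf[OF assms(3)] _ _ _ _ e att]
  show "graph_iso ?N ?N' (transpose v u) (\<lambda>k. transpose h y' (transpose h' y k))"
    by (rule swap(1)) simp_all
  show "change_sign ?N (transpose v u) (\<lambda>k. transpose h y' (transpose h' y k)) c c = - 1"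
    if "is_coloring \<kappa> G c"
    by (rule swap(2)[where \<kappa> = \<kappa>]) (use that u is_coloring_cong[of ?N G \<kappa> c] in simp_all)
qed

text \<open>A chain forgets where \<open>x\<close>, \<open>p\<close>, \<open>q\<close> were
  attached, since it reattaches all three. Hence the graphs of the IHX triple lead to the same six
  chains.\<close>

lemma chain_exch:
  assumes "{\<alpha>, \<beta>, \<gamma>} = {x, p, q}" 
  shows "chain (exch G x p) h h' y y' B \<alpha> \<beta> \<gamma> = chain G h h' y y' B \<alpha> \<beta> \<gamma>"
    "chain' (exch G x p) h h' y y' B \<alpha> \<beta> \<gamma> = chain' G h h' y y' B \<alpha> \<beta> \<gamma>"
proof -
  have a: "att (exch G x p) h = v" "att (exch G x p) h' = w" "att (exch G x p) y' = u"
    using halves_neq by (simp_all add: transpose_def)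
  have "transpose x p k = k" if "k \<notin> {\<alpha>, \<beta>, \<gamma>}" for k
    using that assms by (auto simp: transpose_def)
  then have "att (chain (exch G x p) h h' y y' B \<alpha> \<beta> \<gamma>) k = att (chain G h h' y y' B \<alpha> \<beta> \<gamma>) k"
    "att (chain' (exch G x p) h h' y y' B \<alpha> \<beta> \<gamma>) k = att (chain' G h h' y y' B \<alpha> \<beta> \<gamma>) k" for k
    unfolding chain_simps a by auto
  then have "att (chain (exch G x p) h h' y y' B \<alpha> \<beta> \<gamma>) = att (chain G h h' y y' B \<alpha> \<beta> \<gamma>)"
    "att (chain' (exch G x p) h h' y y' B \<alpha> \<beta> \<gamma>) = att (chain' G h h' y y' B \<alpha> \<beta> \<gamma>)"
    by blast+
  then show "chain (exch G x p) h h' y y' B \<alpha> \<beta> \<gamma> = chain G h h' y y' B \<alpha> \<beta> \<gamma>"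
    "chain' (exch G x p) h h' y y' B \<alpha> \<beta> \<gamma> = chain' G h h' y y' B \<alpha> \<beta> \<gamma>"
    by (auto intro!: graph.equality simp: a[simplified] simp del: chain_simps(9,10))
qed

end


section \<open>Extending weights to all graphs\<close>

text \<open>
  The choice of the leg is proper whenever \<open>G\<close> is a BCR graph with \<open>Suc n\<close> internal vertices.\<close>

primrec resolved_weight :: "(comb \<Rightarrow> rat) \<Rightarrow> nat \<Rightarrow> graph \<Rightarrow> coloring \<Rightarrow> rat" where
  "resolved_weight \<psi> 0 G c = \<psi> (gen (G, c))"
| "resolved_weight \<psi> (Suc n) G c =
     (case SOME (h, h', x, y, B). leg G h h' x y B of
        (h, h', x, y, B) \<Rightarrow> - val (\<lambda>T. resolved_weight \<psi> n T c) G h h' x y B)"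

declare resolved_weight.simps(2) [simp del]

lemma FourT_relI:
  assumes "card (int_verts (fst S)) = 1" "e \<noteq> e'" "STU \<kappa> S e H" "STU \<kappa> S e' H'"
  shows "H - H' \<in> FourT_rel \<kappa>"
  using assms unfolding FourT_rel_def by blast

text \<open>An element of the dual of the chord diagram quotient, given as a functional on all
  formal combinations. Its extension is compared with it only on \<open>Dc_BCR\<close>.\<close>

locale weight_system =
  fixes \<kappa> :: parity_case and \<psi> :: "comb \<Rightarrow> rat"
  assumes add: "\<psi> (a + b) = \<psi> a + \<psi> b" and scale: "\<psi> (scale r a) = r * \<psi> a"
    and orientation: "a \<in> orientation_rel (colored_chord \<kappa>) \<Longrightarrow> \<psi> a = 0"
    and FourT: "a \<in> FourT_rel \<kappa> \<Longrightarrow> \<psi> a = 0"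
begin

abbreviation "\<Phi> \<equiv> resolved_weight \<psi>"

lemma minus: "\<psi> (- a) = - \<psi> a" "\<psi> (a - b) = \<psi> a - \<psi> b" "\<psi> 0 = 0"
proof -
  show m: "\<psi> (- a) = - \<psi> a" for a
    using scale[of "- 1" a] by simp
  show "\<psi> (a - b) = \<psi> a - \<psi> b"
    using add[of a "- b"] m[of b] by simp
  show "\<psi> 0 = 0"
    using scale[of 0 0] by simp
qed

definition invariant :: "nat \<Rightarrow> bool" where
  "invariant n \<longleftrightarrow> (\<forall>G G' f g c c'. BCR_graph G \<longrightarrow> BCR_graph G' \<longrightarrow> card (int_verts G) = n \<longrightarrow>
     is_coloring \<kappa> G c \<longrightarrow> is_coloring \<kappa> G' c' \<longrightarrow> graph_iso G G' f g \<longrightarrow>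
     \<Phi> n G c = of_int (change_sign G f g c c') * \<Phi> n G' c')"

definition resolvable :: "nat \<Rightarrow> bool" where
  "resolvable n \<longleftrightarrow> (\<forall>G c h h' x y B. BCR_leg G h h' x y B \<longrightarrow> card (int_verts G) = Suc n \<longrightarrow>
     is_coloring \<kappa> G c \<longrightarrow> \<Phi> (Suc n) G c = - val (\<lambda>T. \<Phi> n T c) G h h' x y B)"

lemma invariantD:
  assumes "invariant n" "BCR_graph G" "BCR_graph G'" "card (int_verts G) = n"
    "is_coloring \<kappa> G c" "is_coloring \<kappa> G' c'" "graph_iso G G' f g"
  shows "\<Phi> n G c = of_int (change_sign G f g c c') * \<Phi> n G' c'"
  using assms unfolding invariant_def by blast

lemma resolvableD:
  assumes "resolvable n" "BCR_leg G h h' x y B" "card (int_verts G) = Suc n" "is_coloring \<kappa> G c"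
  shows "\<Phi> (Suc n) G c = - val (\<lambda>T. \<Phi> n T c) G h h' x y B"
  using assms unfolding resolvable_def by blast

lemma val_iso:
  assumes "invariant n" "BCR_leg G h h' x y B" "BCR_graph G'" "card (int_verts G) = Suc n"
    and "is_coloring \<kappa> G c" "is_coloring \<kappa> G' c'" "graph_iso G G' f g"
  shows "val (\<lambda>T. \<Phi> n T c) G h h' x y B =
    of_int (change_sign G f g c c') * val (\<lambda>T. \<Phi> n T c') G' (g h) (g h') (g x) (g y) (g ` B)"
proof -
  interpret BCR_leg G h h' x y B
    by (rule assms(2))
  interpret sw: BCR_leg G h h' y x B
    by (rule swap)
  note iso = leg_iso[OF assms(7,3)] and iso' = sw.leg_iso[OF assms(7,3)]
  have l: "BCR_leg G' (g h) (g h') (g x) (g y) (g ` B)" "BCR_leg G' (g h) (g h') (g y) (g x) (g ` B)"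
    using iso(1) iso'(1) assms(3) by (auto intro: BCR_leg.intro)
  have "\<Phi> n (res G h h' x B) c =
      of_int (change_sign G f g c c') * \<Phi> n (res G' (g h) (g h') (g x) (g ` B)) c'"
    using invariantD[OF assms(1) BCR_res BCR_leg.BCR_res[OF l(1)] _ _ _ iso(2), of c c']
      assms(4-6) card_int_res is_coloring_cong[of "res G h h' x B" G \<kappa> c]
      is_coloring_cong[of "res G' (g h) (g h') (g x) (g ` B)" G' \<kappa> c']
      change_sign_cong[of "res G h h' x B" G f g c c'] by simp
  moreover have "\<Phi> n (res G h h' y B) c =
      of_int (change_sign G f g c c') * \<Phi> n (res G' (g h) (g h') (g y) (g ` B)) c'"
    using invariantD[OF assms(1) sw.BCR_res BCR_leg.BCR_res[OF l(2)] _ _ _ iso'(2), of c c']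
      assms(4-6) sw.card_int_res is_coloring_cong[of "res G h h' y B" G \<kappa> c]
      is_coloring_cong[of "res G' (g h) (g h') (g y) (g ` B)" G' \<kappa> c']
      change_sign_cong[of "res G h h' y B" G f g c c'] by simp
  ultimately show ?thesis
    unfolding val_def using iso(3) by (simp add: distrib_left)
qed

lemma flip:
  assumes "invariant n" "BCR_leg G h h' x y B" "leg G h h' y x B'" "card (int_verts G) = Suc n"
    and "is_coloring \<kappa> G c" "B' = halves_at G (solid G) (att G h) - B"
  shows "\<Phi> n (res G h h' x B) c = \<Phi> n (res G h h' y B') c"
proof -
  interpret BCR_leg G h h' x y B
    by (rule assms(2))
  interpret sw: BCR_leg G h h' y x B'
    using BCR assms(3) by (rule BCR_leg.intro)
  let ?T = "res G h h' x B"
  have a: "att ?T h = v" "att ?T h' = w"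
    using h_neq halves_w B_props(4,5) by simp_all
  have col: "is_coloring \<kappa> ?T c" "is_coloring \<kappa> (res G h h' y B') c"
    using assms(5) is_coloring_cong[of ?T G] is_coloring_cong[of "res G h h' y B'" G] by simp_all
  have "change_sign ?T (transpose v w) (transpose h h') c c = 1"
    using change_sign_flip[OF BCR_wf[OF BCR_res] _ _ col(1), of h h', unfolded a] edge(2) w(4) by simp
  then show ?thesis
    using invariantD[OF assms(1) BCR_res sw.BCR_res _ col flip_iso[OF assms(6)]] card_int_res assms(4)
    by simp
qed

text \<open>If there are solid edges at the external vertex, the two summands trade places.
  Otherwise there is a single summand, and reversing the new edge shows that both orders give it the
  same value.\<close>

lemma val_swap:
  assumes "invariant n" "BCR_leg G h h' x y B" "card (int_verts G) = Suc n" "is_coloring \<kappa> G c"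
  shows "val (\<lambda>T. \<Phi> n T c) G h h' x y B = val (\<lambda>T. \<Phi> n T c) G h h' y x B"
proof -
  interpret BCR_leg G h h' x y B
    by (rule assms(2))
  show ?thesis
  proof (cases "halves_at G (solid G) v = {}")
    case True
    then have "B = {}"
      using B_subset by simp
    then show ?thesis
      using flip[OF assms(1,2) leg_swap[OF leg] assms(3,4)] True by (simp add: val_def)
  qed (simp add: val_def)
qed

text \<open>\<open>B\<close> and \<open>B'\<close> can differ only when there are two solid
  half-edges, of which each contains one. Reversing the new edge then matches the summands
  crosswise.\<close>

lemma val_same_leg:
  assumes "invariant n" "BCR_leg G h h' x y B" "leg G h h' x' y' B'"
    and "card (int_verts G) = Suc n" "is_coloring \<kappa> G c"
  shows "val (\<lambda>T. \<Phi> n T c) G h h' x y B = val (\<lambda>T. \<Phi> n T c) G h h' x' y' B'"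
proof -
  interpret BCR_leg G h h' x y B
    by (rule assms(2))
  interpret two: BCR_leg G h h' x' y' B'
    using BCR assms(3) by (rule BCR_leg.intro)
  have "val (\<lambda>T. \<Phi> n T c) G h h' x y B = val (\<lambda>T. \<Phi> n T c) G h h' x y B'"
  proof (cases "B = B'")
    case False
    obtain a b where B: "halves_at G (solid G) v = {a, b}" "B = {b}" "a \<noteq> b"
      by (rule B_cases) (use False two.B_cases in auto)
    have "B' = {a}"
      by (rule two.B_cases) (use False B in \<open>auto simp: doubleton_eq_iff\<close>)
    then have B': "B' = halves_at G (solid G) v - B" "B = halves_at G (solid G) v - B'"
      using B by auto
    have l: "leg G h h' x y B'" "leg G h h' y x B'"
      using leg assms(3) unfolding leg_def by auto
    then have "BCR_leg G h h' x y B'"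
      using BCR by (intro BCR_leg.intro)
    then show ?thesis
      using flip[OF assms(1,2) l(2) assms(4,5) B'(1)]
        flip[OF assms(1) _ leg_swap[OF leg] assms(4,5) B'(2)] B(1) by (simp add: val_def)
  qed simp
  moreover have "x' = x \<and> y' = y \<or> x' = y \<and> y' = x"
    using halves_w two.halves_w by auto
  ultimately show ?thesis
    using val_swap[OF assms(1) two.BCR_leg_axioms assms(4,5)] by auto
qed

text \<open>Every summand is resolved once more at the other leg, as \<open>resolvable m\<close>
  allows; the double resolutions agree by \<open>val_commute\<close>.\<close>

lemma val_far:
  assumes "resolvable m" "two_BCR_legs G h h' x y B k k' p q C"
    and "card (int_verts G) = Suc (Suc m)" "is_coloring \<kappa> G c"
  shows "val (\<lambda>T. \<Phi> (Suc m) T c) G h h' x y B = val (\<lambda>T. \<Phi> (Suc m) T c) G k k' p q C"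
proof -
  have expand: "val (\<lambda>T. \<Phi> (Suc m) T c) G h h' x y B =
      - val (\<lambda>T. val (\<lambda>T. \<Phi> m T c) T k k' p q C) G h h' x y B"
    if "two_BCR_legs G h h' x y B k k' p q C" for h h' x y B k k' p q C
  proof -
    interpret a: two_BCR_legs G h h' x y B k k' p q C
      by (rule that)
    interpret b: two_BCR_legs G h h' y x B k k' p q C
      using a.one.swap a.two.BCR_leg_axioms a.w_neq by (intro two_BCR_legs.intro two_BCR_legs_axioms.intro)
    have "\<Phi> (Suc m) (res G h h' x B) c = - val (\<lambda>T. \<Phi> m T c) (res G h h' x B) k k' p q C"
      using resolvableD[OF assms(1) BCR_leg.intro[OF a.one.BCR_res a.leg_res]] a.one.card_int_res
        assms(3,4) is_coloring_cong[of "res G h h' x B" G] by simp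
    moreover have "\<Phi> (Suc m) (res G h h' y B) c = - val (\<lambda>T. \<Phi> m T c) (res G h h' y B) k k' p q C"
      using resolvableD[OF assms(1) BCR_leg.intro[OF b.one.BCR_res b.leg_res]] b.one.card_int_res
        assms(3,4) is_coloring_cong[of "res G h h' y B" G] by simp
    ultimately show ?thesis
      unfolding val_def[of _ G] by simp
  qed
  show ?thesis
    using expand[OF assms(2)] expand[OF two_BCR_legs.swap[OF assms(2)]]
      two_BCR_legs.val_commute[OF assms(2)] by simp
qed

text \<open>
  Each of the six orders of \<open>x\<close>, \<open>p\<close>, \<open>q\<close> along the chain of three vertices occurs twice, with opposite
  signs. Without solid edges at \<open>v\<close> only half of the terms are there, but reversing the chain changes
  the sign.\<close>

lemma jacobi_val:
  assumes "invariant m" "resolvable m" "jacobi G h h' x y B y' p q"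
    and "card (int_verts G) = Suc (Suc m)" "is_coloring \<kappa> G c"
  shows "val (\<lambda>T. \<Phi> (Suc m) T c) G h h' x y B + val (\<lambda>T. \<Phi> (Suc m) T c) (exch G x p) h h' p y B
    + val (\<lambda>T. \<Phi> (Suc m) T c) (exch G x q) h h' q y B = 0"
proof -
  define N where "N = (\<lambda>\<alpha> \<beta> \<gamma>. \<Phi> m (chain G h h' y y' B \<alpha> \<beta> \<gamma>) c)"
  define N' where "N' = (\<lambda>\<alpha> \<beta> \<gamma>. \<Phi> m (chain' G h h' y y' B \<alpha> \<beta> \<gamma>) c)"
  interpret j: jacobi G h h' x y B y' p q
    by (rule assms(3))
  let ?s = "halves_at G (solid G) (att G h)"
  \<comment> \<open>The second resolution, at \<open>{y, y'}\<close>. It is stated for variable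
    \<open>G\<close>, \<open>x\<close>, \<open>p\<close>, \<open>q\<close> because it is applied to
    each member of the IHX triple.\<close>
  have expand: "\<Phi> (Suc m) (res G h h' x B) c =
        - (\<Phi> m (chain G h h' y y' B x p q) c + \<Phi> m (chain G h h' y y' B x q p) c)"
      "halves_at G (solid G) (att G h) \<noteq> {} \<Longrightarrow> \<Phi> (Suc m) (res G h h' y B) c =
        - (\<Phi> m (chain' G h h' y y' B p q x) c + \<Phi> m (chain' G h h' y y' B q p x) c)"
    if "jacobi G h h' x y B y' p q" "card (int_verts G) = Suc (Suc m)" "is_coloring \<kappa> G c"
    for G x p q
  proof -
    interpret jacobi G h h' x y B y' p q
      by (rule that(1))
    interpret sw: jacobi G h h' x y B y' q p
      by (rule jacobi_swap)
    interpret opp: BCR_leg G h h' y x B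
      by (rule swap)
    have "halves_at (res G h h' x B) (solid (res G h h' x B)) (att (res G h h' x B) y) \<noteq> {}"
      using solid_after(2) halves_neq notin_B by simp
    then show "\<Phi> (Suc m) (res G h h' x B) c =
        - (\<Phi> m (chain G h h' y y' B x p q) c + \<Phi> m (chain G h h' y y' B x q p) c)"
      using resolvableD[OF assms(2) BCR_leg.intro[OF BCR_res leg_T]] card_int_res that(2,3)
        is_coloring_cong[of "res G h h' x B" G \<kappa> c]
      by (simp add: val_def res_T sw.res_T)
    assume s: "halves_at G (solid G) (att G h) \<noteq> {}"
    have "halves_at (res G h h' y B) (solid (res G h h' y B)) (att (res G h h' y B) y) \<noteq> {}"
      using opp.solid_after(1) halves_neq notin_B by simp
    then show "\<Phi> (Suc m) (res G h h' y B) c =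
        - (\<Phi> m (chain' G h h' y y' B p q x) c + \<Phi> m (chain' G h h' y y' B q p x) c)"
      using resolvableD[OF assms(2) BCR_leg.intro[OF opp.BCR_res leg_U[OF s]]] opp.card_int_res that(2,3)
        is_coloring_cong[of "res G h h' y B" G \<kappa> c]
      by (simp add: val_def res_U sw.res_U)
  qed
  interpret jp: jacobi "exch G x p" h h' p y B y' x q
    by (rule j.jacobi_exch)
  interpret js: jacobi G h h' x y B y' q p
    by (rule j.jacobi_swap)
  interpret jq: jacobi "exch G x q" h h' q y B y' x p
    by (rule js.jacobi_exch)
  have col: "is_coloring \<kappa> (exch G x p) c" "is_coloring \<kappa> (exch G x q) c"
    using assms(5) is_coloring_cong[of "exch G x p" G] is_coloring_cong[of "exch G x q" G] by simp_all
  have sh: "halves_at (exch G x p) (solid (exch G x p)) (att (exch G x p) h) = ?s"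
    "halves_at (exch G x q) (solid (exch G x q)) (att (exch G x q) h) = ?s"
  proof -
    have "att (exch G x p) h = att G h" "att (exch G x q) h = att G h"
      using j.halves_neq by (simp_all add: transpose_def)
    then show "halves_at (exch G x p) (solid (exch G x p)) (att (exch G x p) h) = ?s"
      "halves_at (exch G x q) (solid (exch G x q)) (att (exch G x q) h) = ?s"
      using j.tri.halves_exch_solid js.tri.halves_exch_solid by simp_all
  qed
  note cp = j.chain_exch and cq = js.chain_exch
  note E = expand[OF assms(3,4,5)] expand[OF j.jacobi_exch _ col(1)] expand[OF js.jacobi_exch _ col(2)]
  have perm: "{p, x, q} = {x, p, q}" "{p, q, x} = {x, p, q}" "{x, q, p} = {x, p, q}"
    "{q, x, p} = {x, p, q}" "{q, p, x} = {x, p, q}"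
    by auto
  have permq: "{p, x, q} = {x, q, p}" "{p, q, x} = {x, q, p}" "{x, p, q} = {x, q, p}"
    "{q, x, p} = {x, q, p}" "{q, p, x} = {x, q, p}"
    by auto
  have T: "\<Phi> (Suc m) (res G h h' x B) c = - (N x p q + N x q p)"
    "\<Phi> (Suc m) (res (exch G x p) h h' p B) c = - (N p x q + N p q x)"
    "\<Phi> (Suc m) (res (exch G x q) h h' q B) c = - (N q x p + N q p x)"
    using E assms(4) unfolding N_def cp(1)[OF perm(1)] cp(1)[OF perm(2)]
      cq(1)[OF permq(4)] cq(1)[OF permq(5)] by simp_all
  have U: "?s \<noteq> {} \<Longrightarrow> \<Phi> (Suc m) (res G h h' y B) c = - (N' p q x + N' q p x)"
    "?s \<noteq> {} \<Longrightarrow> \<Phi> (Suc m) (res (exch G x p) h h' y B) c = - (N' x q p + N' q x p)"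
    "?s \<noteq> {} \<Longrightarrow> \<Phi> (Suc m) (res (exch G x q) h h' y B) c = - (N' x p q + N' p x q)"
    using E sh assms(4) unfolding N'_def cp(2)[OF perm(3)] cp(2)[OF perm(4)]
      cq(2)[OF permq(3)] cq(2)[OF permq(1)] by simp_all
  interpret jps: jacobi "exch G x p" h h' p y B y' q x
    by (rule jp.jacobi_swap)
  interpret jqs: jacobi "exch G x q" h h' q y B y' p x
    by (rule jq.jacobi_swap)
  define PS where "PS = {(x, p, q), (x, q, p), (p, x, q), (p, q, x), (q, x, p), (q, p, x)}"
  have abc: "{\<alpha>, \<beta>, \<gamma>} = {x, p, q}" "distinct [\<alpha>, \<beta>, \<gamma>]" if "(\<alpha>, \<beta>, \<gamma>) \<in> PS" for \<alpha> \<beta> \<gamma>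
    using that j.halves_neq unfolding PS_def by auto
  \<comment> \<open>Chains that begin with \<open>x\<close>, \<open>p\<close> and \<open>q\<close>
    arise by resolving \<open>G\<close>, \<open>exch G x p\<close> and \<open>exch G x q\<close>
    respectively, hence are BCR graphs.\<close>
  have BCR_N: "BCR_graph (chain G h h' y y' B \<alpha> \<beta> \<gamma>)" if "(\<alpha>, \<beta>, \<gamma>) \<in> PS" for \<alpha> \<beta> \<gamma>
    using that j.BCR_chain js.BCR_chain jp.BCR_chain jps.BCR_chain jq.BCR_chain jqs.BCR_chain
    unfolding cp(1)[OF perm(1)] cp(1)[OF perm(2)] cq(1)[OF permq(4)] cq(1)[OF permq(5)] PS_def by auto
  have colN: "is_coloring \<kappa> (chain G h h' y y' B \<alpha> \<beta> \<gamma>) c"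
    "is_coloring \<kappa> (chain' G h h' y y' B \<alpha> \<beta> \<gamma>) c" for \<alpha> \<beta> \<gamma>
    using assms(5) is_coloring_cong[of "chain G h h' y y' B \<alpha> \<beta> \<gamma>" G]
      is_coloring_cong[of "chain' G h h' y y' B \<alpha> \<beta> \<gamma>" G] by simp_all
  show ?thesis
  proof (cases "?s = {}")
    case True
    have rev: "N \<alpha> \<beta> \<gamma> = - N \<gamma> \<beta> \<alpha>" if t: "(\<alpha>, \<beta>, \<gamma>) \<in> PS" for \<alpha> \<beta> \<gamma>
    proof -
      have "(\<gamma>, \<beta>, \<alpha>) \<in> PS"
        using t by (auto simp: PS_def)
      then show ?thesis
        using invariantD[OF assms(1) BCR_N[OF t] BCR_N _ colN(1,1) j.chain_reverse_iso(1)[OF abc[OF t] BCR_N[OF t] True]]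
          j.chain_reverse_iso(2)[OF abc[OF t] BCR_N[OF t] True assms(5)] j.card_int_chain[OF assms(4)]
        unfolding N_def by simp
    qed
    have "N x p q = - N q p x" "N x q p = - N p q x" "N p x q = - N q x p"
      by (rule rev, simp add: PS_def)+
    then show ?thesis
      using True sh T by (simp add: val_def)
  next
    case False
    have BCR_N': "BCR_graph (chain' G h h' y y' B \<alpha> \<beta> \<gamma>)" if "(\<alpha>, \<beta>, \<gamma>) \<in> PS" for \<alpha> \<beta> \<gamma>
      using that j.BCR_chain' js.BCR_chain' jp.BCR_chain' jps.BCR_chain' jq.BCR_chain' jqs.BCR_chain' False sh
      unfolding cp(2)[OF perm(3)] cp(2)[OF perm(4)] cq(2)[OF permq(3)] cq(2)[OF permq(1)] PS_def by auto
    have "N' \<alpha> \<beta> \<gamma> = - N \<alpha> \<beta> \<gamma>" if t: "(\<alpha>, \<beta>, \<gamma>) \<in> PS" for \<alpha> \<beta> \<gamma>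
      using invariantD[OF assms(1) BCR_N[OF t] BCR_N'[OF t] _ colN j.chain_iso(1)[OF abc[OF t] BCR_N[OF t]]]
        j.chain_iso(2)[OF abc[OF t] BCR_N[OF t] assms(5)] j.card_int_chain[OF assms(4)]
      unfolding N_def N'_def by simp
    then have "N' x p q = - N x p q" "N' x q p = - N x q p" "N' p x q = - N p x q"
      "N' p q x = - N p q x" "N' q x p = - N q x p" "N' q p x = - N q p x"
      by (simp_all add: PS_def)
    then show ?thesis
      using False sh T U by (simp add: val_def)
  qed
qed

text \<open>The other two half-edges at the vertex are already paired with \<open>h\<close> and
  \<open>k\<close>, so the third edge cannot return to it.\<close>

lemma third_half_far:
  assumes "BCR_leg G h h' x y B" "leg G k x h' y C" "{y, y'} \<in> edges G"
  shows "att G y' \<noteq> att G h'"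
proof -
  interpret one: BCR_leg G h h' x y B
    by (rule assms(1))
  interpret two: BCR_leg G k x h' y C
    using one.BCR assms(2) by (rule BCR_leg.intro)
  note two.att_xy [simp del]
  have y'_in: "y' \<in> \<Union>(edges G)"
    using assms(3) by blast
  show "att G y' \<noteq> att G h'"
  proof
    assume "att G y' = att G h'"
    then consider "y' = h'" | "y' = x" | "y' = y"
      using one.att_w_iff[OF y'_in] by auto
    then show False
    proof cases
      case 1
      then have "{y, y'} = {h, h'}"
        using wf_graph_edge_unique[OF one.wf assms(3) one.edge(2), of h'] by simp
      then show False
        using 1 one.h_neq one.halves_w by (auto simp: doubleton_eq_iff)
    next
      case 2
      then have "{y, y'} = {k, x}"
        using wf_graph_edge_unique[OF one.wf assms(3) two.edge(2), of x] by simp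
      then show False
        using 2 two.h_neq two.halves_w by (auto simp: doubleton_eq_iff)
    next
      case 3
      then show False
        using wf_graph_edge_neq[OF one.wf assms(3)] by simp
    qed
  qed
qed

lemma val_near:
  assumes "invariant m" "resolvable m" "invariant (Suc m)"
    and "BCR_leg G h h' x y B" "leg G k x h' y C" "{y, y'} \<in> edges G" "att G y' \<in> int_verts G"
    and "card (int_verts G) = Suc (Suc m)" "is_coloring \<kappa> G c"
  shows "val (\<lambda>T. \<Phi> (Suc m) T c) G h h' x y B = val (\<lambda>T. \<Phi> (Suc m) T c) G k x h' y C"
proof -
  interpret one: BCR_leg G h h' x y B
    by (rule assms(4))
  interpret two: BCR_leg G k x h' y C
    using one.BCR assms(5) by (rule BCR_leg.intro)
  note two.att_xy [simp del]
  let ?w = "att G h'" and ?u = "att G y'"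
  have y'_in: "y' \<in> \<Union>(edges G)"
    using assms(6) by blast
  have uw: "?u \<noteq> ?w"
    using third_half_far[OF assms(4-6)] .
  \<comment> \<open>In \<open>exch G x p\<close> the half-edge \<open>x\<close> sits at
    \<open>u\<close>, so the two legs end at different vertices and \<open>val_far\<close> applies.
    Reversing \<open>{y, y'}\<close> identifies this graph with \<open>exch G h' q\<close>. Thus the
    \<open>p\<close> term of the Jacobi identity at one leg is the \<open>q\<close> term of the
    identity at the other.\<close>
  have far: "val (\<lambda>T. \<Phi> (Suc m) T c) (exch G x p) h h' p y B =
      val (\<lambda>T. \<Phi> (Suc m) T c) (exch G h' q) k x q y C"
    if "jacobi G h h' x y B y' p q" "jacobi G k x h' y C y' p q" for p q
  proof -
    interpret j: jacobi G h h' x y B y' p q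
      by (rule that(1))
    interpret k: jacobi G k x h' y C y' p q
      by (rule that(2))
    interpret ks: jacobi G k x h' y C y' q p
      by (rule k.jacobi_swap)
    interpret jp: jacobi "exch G x p" h h' p y B y' x q
      by (rule j.jacobi_exch)
    have a: "att (exch G x p) k = att G k" "att (exch G x p) x = ?u"
      "att (exch G x p) y = ?w" "att (exch G x p) y' = ?u" "att (exch G x p) h' = ?w"
      using j.halves_neq k.halves_neq j.att_pq one.att_xy by (simp_all add: transpose_def)
    have "{k, x} \<in> dashed G" "?u \<in> int_verts G"
      using two.edge assms(7) by auto
    moreover have "halves_at (exch G x p) (edges G) ?u = {x, q, y'}"
      using jp.tri.halves(4) unfolding a by (simp add: insert_commute)
    moreover have "distinct [x, q, y']"
      using j.halves_neq by simp
    ultimately have "leg (exch G x p) k x q y' C"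
      using two.leg unfolding leg_def a exch_simps(2,3,4,6,7) j.tri.halves_exch_solid by blast
    then have legk: "BCR_leg (exch G x p) k x q y' C"
      using jp.BCR by (intro BCR_leg.intro)
    have two: "two_BCR_legs (exch G x p) h h' p y B k x q y' C"
      using jp.BCR_leg_axioms legk a j.u by (intro two_BCR_legs.intro two_BCR_legs_axioms.intro) auto
    have col: "is_coloring \<kappa> (exch G x p) c" "is_coloring \<kappa> (exch G h' q) c"
      using assms(9) is_coloring_cong[of "exch G x p" G] is_coloring_cong[of "exch G h' q" G] by simp_all
    have card: "card (int_verts (exch G x p)) = Suc (Suc m)"
      using assms(8) by simp
    have g: "transpose y y' k = k" "transpose y y' x = x" "transpose y y' q = q" "transpose y y' y' = y"
      using j.halves_neq k.halves_neq by (simp_all add: transpose_def)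
    have gC: "transpose y y' ` C = C"
      using k.notin_B by simp
    have sgn: "change_sign (exch G x p) (transpose ?w ?u) (transpose y y') c c = 1"
      using change_sign_flip[OF BCR_wf[OF jp.BCR] _ _ col(1), of y y', unfolded a] assms(6) j.u(3) by auto
    have iso: "graph_iso (exch G x p) (exch G h' q) (transpose ?w ?u) (transpose y y')"
      using j.tri.mirror_iso by simp
    have "val (\<lambda>T. \<Phi> (Suc m) T c) (exch G x p) k x q y' C =
        val (\<lambda>T. \<Phi> (Suc m) T c) (exch G h' q) k x q y C"
      using val_iso[OF assms(3) legk ks.tri.BCR_exch card col iso, unfolded g gC] sgn by simp
    then show ?thesis
      using val_far[OF assms(2) two card col(1)] by simp
  qed
  have "card (halves_at G (edges G) ?u) = 3"
    using one.BCR assms(7) halves_at_edges[OF one.wf, of ?u] by (auto simp: BCR_graph_def)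
  then have "card (halves_at G (edges G) ?u - {y'}) = 2"
    using y'_in by (simp add: halves_at_def)
  then obtain p q where "halves_at G (edges G) ?u - {y'} = {p, q}" "p \<noteq> q"
    by (auto simp: card_2_iff)
  moreover have "y' \<in> halves_at G (edges G) ?u"
    using y'_in by (simp add: halves_at_def)
  ultimately have pq: "halves_at G (edges G) ?u = {y', p, q}" "distinct [y', p, q]"
    by auto
  have tri: "BCR_int_edge G y y' h' x p q"
    by unfold_locales
      (use one.BCR assms(6,7) one.w uw one.halves_w pq in \<open>auto simp: insert_commute\<close>)
  interpret tri: BCR_int_edge G y y' h' x p q
    by (rule tri)
  interpret j: jacobi G h h' x y B y' p q
    using assms(4) tri by (rule jacobi.intro)
  interpret k: jacobi G k x h' y C y' p q
    using two.BCR_leg_axioms tri.swap' by (rule jacobi.intro)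
  show ?thesis
    using jacobi_val[OF assms(1,2) j.jacobi_axioms assms(8,9)]
      jacobi_val[OF assms(1,2) k.jacobi_axioms assms(8,9)]
      far[OF j.jacobi_axioms k.jacobi_axioms] far[OF j.jacobi_swap k.jacobi_swap] by linarith
qed

lemma psi_stu: "\<psi> (stu G c h h' x y B) = - val (\<lambda>T. \<Phi> 0 T c) G h h' x y B"
  by (simp add: stu_def val_def minus)

lemma val_indep:
  assumes "invariant n" "n \<noteq> 0 \<Longrightarrow> \<exists>m. n = Suc m \<and> invariant m \<and> resolvable m"
    and "BCR_leg G h h' x y B" "leg G k k' p q C" "card (int_verts G) = Suc n" "is_coloring \<kappa> G c"
  shows "val (\<lambda>T. \<Phi> n T c) G h h' x y B = val (\<lambda>T. \<Phi> n T c) G k k' p q C"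
proof -
  interpret one: BCR_leg G h h' x y B
    by (rule assms(3))
  have leg2: "BCR_leg G k k' p q C"
    using one.BCR assms(4) by (rule BCR_leg.intro)
  note e2 = BCR_leg.edge[OF leg2] and w2 = BCR_leg.w[OF leg2] and v2 = BCR_leg.v[OF leg2]
    and hw2 = BCR_leg.halves_w[OF leg2]
  have nz: "n \<noteq> 0" if "a \<in> int_verts G" "b \<in> int_verts G" "a \<noteq> b" for a b
  proof
    assume "n = 0"
    then obtain z where "int_verts G = {z}"
      using assms(5) by (auto simp: card_1_singleton_iff)
    then show False
      using that by simp
  qed
  have far: "val (\<lambda>T. \<Phi> n T c) G h h' x y B = val (\<lambda>T. \<Phi> n T c) G k k' p q C"
    if L: "BCR_leg G h h' x y B" "BCR_leg G k k' p q C" "att G h' \<noteq> att G k'" for h h' x y B k k' p q C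
  proof -
    obtain m where m: "n = Suc m" "resolvable m"
      using assms(2) nz[OF BCR_leg.w(1)[OF L(1)] BCR_leg.w(1)[OF L(2)] L(3)] by blast
    have "two_BCR_legs G h h' x y B k k' p q C"
      using L by (intro two_BCR_legs.intro two_BCR_legs_axioms.intro)
    then show ?thesis
      using val_far[OF m(2)] assms(5,6) m(1) by blast
  qed
  show ?thesis
  proof (cases "att G h' = att G k'")
    case False
    then show ?thesis
      using far[OF assms(3) leg2] by blast
  next
    case True
    have k'_cases: "k' \<in> {h', x, y}"
      using one.att_w_iff[of k'] e2(2) True by auto
    show ?thesis
    proof (cases "k' = h'")
      case eq: True
      then have "{h, h'} = {k, k'}"
        using wf_graph_edge_unique[OF one.wf one.edge(2) e2(2), of h'] by simp
      then have "k = h"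
        using eq one.h_neq(1) by (auto simp: doubleton_eq_iff)
      then show ?thesis
        using val_same_leg[OF assms(1,3) _ assms(5,6)] assms(4) eq by blast
    next
      case neq: False
      \<comment> \<open>Both legs end at the same vertex through different half-edges;
        \<open>y0\<close> is the third half-edge there.\<close>
      define y0 where "y0 = (if k' = x then y else x)"
      have l1: "leg G h h' k' y0 B"
        using k'_cases neq one.leg leg_swap[OF one.leg] by (auto simp: y0_def)
      then have L1: "BCR_leg G h h' k' y0 B"
        using one.BCR by (intro BCR_leg.intro)
      have "{k', p, q} = {h', k', y0}"
        using hw2(1) BCR_leg.halves_w(1)[OF L1] True by simp
      then have "p \<in> {h', k', y0}" "q \<in> {h', k', y0}"
        by blast+
      then have "p = h' \<and> q = y0 \<or> p = y0 \<and> q = h'"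
        using hw2(2-4) by auto
      then have l2: "leg G k k' h' y0 C"
        using assms(4) leg_swap[OF assms(4)] by auto
      then have L2: "BCR_leg G k k' h' y0 C"
        using one.BCR by (intro BCR_leg.intro)
      obtain y' where y': "{y0, y'} \<in> edges G"
        using wf_graph_edgeE[OF one.wf BCR_leg.in_edges(4)[OF L1]] by blast
      have "val (\<lambda>T. \<Phi> n T c) G h h' k' y0 B = val (\<lambda>T. \<Phi> n T c) G k k' h' y0 C"
      proof (cases "att G y' \<in> int_verts G")
        case int: True
        obtain m where m: "n = Suc m" "invariant m" "resolvable m"
          using assms(2) nz[OF int one.w(1) third_half_far[OF L1 l2 y']] by blast
        then show ?thesis
          using val_near[OF m(2,3) _ L1 l2 y' int] assms(1,5,6) by blast
      next
        case ext: False
        show ?thesis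
        proof (cases n)
          case 0
          have "{h, h'} \<noteq> {k, k'}"
            using neq one.w v2 e2 by (auto simp: doubleton_eq_iff)
          then have "stu G c h h' k' y0 B - stu G c k k' h' y0 C \<in> FourT_rel \<kappa>"
            using FourT_relI[OF _ _ BCR_leg.STU_stu[OF L1 assms(6)] BCR_leg.STU_stu[OF L2 assms(6)]]
              assms(5) 0 by simp
          then have "\<psi> (stu G c h h' k' y0 B - stu G c k k' h' y0 C) = 0"
            by (rule FourT)
          then show ?thesis
            unfolding minus psi_stu 0 by simp
        next
          case (Suc m)
          have "finite (int_verts G)"
            using assms(5) by (intro card_ge_0_finite) simp
          then have "card (int_verts G - {att G h'}) \<noteq> 0"
            using assms(5) one.w(1) Suc by simp
          then have ne: "int_verts G - {att G h'} \<noteq> {}"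
            by (metis card.empty)
          \<comment> \<open>The edges at the common vertex lead to \<open>h\<close>,
            \<open>k\<close> and \<open>y'\<close>, all at external vertices. So an edge leaving the
            set of the other internal vertices cannot end at the common vertex, and a leg elsewhere
            exists.\<close>
          obtain l l' r s D where l: "leg G l l' r s D" "att G l' \<in> int_verts G - {att G h'}"
          proof (rule leg_exists_in[OF one.BCR _ ne])
            fix i j assume ij: "{i, j} \<in> edges G" "att G i \<in> int_verts G - {att G h'}"
              "att G j \<notin> int_verts G - {att G h'}"
            show "att G j \<in> ext G"
            proof (rule ccontr)
              assume "att G j \<notin> ext G"
              then have "att G j = att G h'"
                using ij wf_graph_att[OF one.wf ij(1)] by (auto simp: int_verts_def)
              then have "j \<in> {h', k', y0}"
                using BCR_leg.att_w_iff[OF L1, of j] ij(1) by auto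
              moreover have "{h, h'} = {i, j}" if "j = h'"
                using wf_graph_edge_unique[OF one.wf one.edge(2) ij(1), of h'] that by simp
              moreover have "{k, k'} = {i, j}" if "j = k'"
                using wf_graph_edge_unique[OF one.wf e2(2) ij(1), of k'] that by simp
              moreover have "{y0, y'} = {i, j}" if "j = y0"
                using wf_graph_edge_unique[OF one.wf y' ij(1), of y0] that by simp
              ultimately have "i = h \<or> i = k \<or> i = y' \<or> i = j"
                by (auto simp: doubleton_eq_iff)
              moreover have "i \<noteq> j"
                using wf_graph_edge_neq[OF one.wf ij(1)] .
              ultimately show False
                using ij(2) one.v(3) v2(3) ext by auto
            qed
          qed auto
          have L: "BCR_leg G l l' r s D"
            using one.BCR l(1) by (rule BCR_leg.intro)
          have "att G h' \<noteq> att G l'" "att G k' \<noteq> att G l'"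
            using l(2) True by auto
          then show ?thesis
            using far[OF L1 L] far[OF L2 L] by simp
        qed
      qed
      then show ?thesis
        using val_same_leg[OF assms(1,3) l1 assms(5,6)] val_same_leg[OF assms(1) leg2 l2 assms(5,6)]
        by simp
    qed
  qed
qed

text \<open>The leg picked by \<open>SOME\<close> is compared with an arbitrary one through
  \<open>val_indep\<close>.\<close>

lemma resolvable_step:
  assumes "invariant n" "n \<noteq> 0 \<Longrightarrow> \<exists>m. n = Suc m \<and> invariant m \<and> resolvable m"
  shows "resolvable n"
  unfolding resolvable_def
proof (intro allI impI)
  fix G c h h' x y B
  assume L: "BCR_leg G h h' x y B" and G: "card (int_verts G) = Suc n" "is_coloring \<kappa> G c"
  define s where "s = (SOME (h, h', x, y, B). leg G h h' x y B)"
  obtain k k' p q C where s: "s = (k, k', p, q, C)"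
    by (cases s)
  have "(\<lambda>(h, h', x, y, B). leg G h h' x y B) (h, h', x, y, B)"
    using BCR_leg.leg[OF L] by simp
  then have "(\<lambda>(h, h', x, y, B). leg G h h' x y B) s"
    unfolding s_def by (rule someI)
  then have "leg G k k' p q C"
    by (simp add: s)
  then have "val (\<lambda>T. \<Phi> n T c) G h h' x y B = val (\<lambda>T. \<Phi> n T c) G k k' p q C"
    using val_indep[OF assms L] G by blast
  then show "\<Phi> (Suc n) G c = - val (\<lambda>T. \<Phi> n T c) G h h' x y B"
    using s unfolding s_def by (simp add: resolved_weight.simps(2))
qed

lemma invariant_Suc:
  assumes "invariant n" "resolvable n"
  shows "invariant (Suc n)"
  unfolding invariant_def
proof (intro allI impI)
  fix G G' f g c c'
  assume G: "BCR_graph G" "BCR_graph G'" "card (int_verts G) = Suc n"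
    "is_coloring \<kappa> G c" "is_coloring \<kappa> G' c'" "graph_iso G G' f g"
  have "int_verts G \<noteq> {}"
    using G(3) by auto
  then obtain h h' x y B where "leg G h h' x y B"
    using some_leg_exists[OF G(1)] by blast
  then have L: "BCR_leg G h h' x y B"
    using G(1) by (intro BCR_leg.intro)
  have L': "BCR_leg G' (g h) (g h') (g x) (g y) (g ` B)"
    using BCR_leg.leg_iso(1)[OF L G(6,2)] G(2) by (intro BCR_leg.intro)
  have "card (int_verts G') = Suc n"
    using graph_iso_card_int[OF G(6) BCR_wf[OF G(1)]] G(3) by simp
  then show "\<Phi> (Suc n) G c = of_int (change_sign G f g c c') * \<Phi> (Suc n) G' c'"
    using resolvableD[OF assms(2) L G(3,4)] resolvableD[OF assms(2) L' _ G(5)]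
      val_iso[OF assms(1) L G(2-6)] by simp
qed

lemma invariant_0: "invariant 0"
  unfolding invariant_def
proof (intro allI impI)
  fix G G' f g c c'
  assume G: "BCR_graph G" "BCR_graph G'" "card (int_verts G) = 0"
    "is_coloring \<kappa> G c" "is_coloring \<kappa> G' c'" "graph_iso G G' f g"
  have fin: "finite (int_verts H)" if "BCR_graph H" for H
    using BCR_wf[OF that] by (simp add: wf_graph_def int_verts_def)
  have "card (int_verts G') = 0"
    using graph_iso_card_int[OF G(6) BCR_wf[OF G(1)]] G(3) by simp
  then have "(G, c) \<in> colored_chord \<kappa>" "(G', c') \<in> colored_chord \<kappa>"
    using G fin[OF G(1)] fin[OF G(2)] by (auto simp: colored_chord_def chord_diagram_def)
  then have "gen (G, c) - Defs.scale (of_int (change_sign G f g c c')) (gen (G', c'))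
      \<in> orientation_rel (colored_chord \<kappa>)"
    using G(6) unfolding orientation_rel_def by blast
  from orientation[OF this] show "\<Phi> 0 G c = of_int (change_sign G f g c c') * \<Phi> 0 G' c'"
    by (simp add: minus scale)
qed

lemma invariant_resolvable: "invariant n \<and> resolvable n"
proof (induction n)
  case 0
  then show ?case
    using invariant_0 resolvable_step[of 0] by blast
next
  case (Suc n)
  then show ?case
    using invariant_Suc[of n] resolvable_step[of "Suc n"] by blast
qed

lemmas invariant = invariant_resolvable[THEN conjunct1]
lemmas resolvable = invariant_resolvable[THEN conjunct2]

section \<open>The IHX relation for the extended weight\<close>

lemma weight_mirror:
  assumes "BCR_int_edge G h h' x y z t" "card (int_verts G) = n" "is_coloring \<kappa> G c"
  shows "\<Phi> n (exch G y z) c = \<Phi> n (exch G x t) c"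
proof -
  interpret BCR_int_edge G h h' x y z t
    by (rule assms(1))
  interpret sw: BCR_int_edge G h h' y x t z
    using BCR_int_edge.swap'[OF swap] .
  have a: "att (exch G y z) h = att G h" "att (exch G y z) h' = att G h'"
    using neq by (simp_all add: transpose_def)
  have col: "is_coloring \<kappa> (exch G y z) c" "is_coloring \<kappa> (exch G x t) c"
    using assms(3) is_coloring_cong[of "exch G y z" G] is_coloring_cong[of "exch G x t" G] by simp_all
  have "change_sign (exch G y z) (transpose (att G h) (att G h')) (transpose h h') c c = 1"
    using change_sign_flip[OF BCR_wf[OF BCR_exch] _ _ col(1), of h h', unfolded a] edge int(3) by simp
  then show ?thesis
    using invariantD[OF invariant BCR_exch sw.BCR_exch _ col mirror_iso] assms(2) by simp
qed

text \<open>This is the Jacobi identity for the leg \<open>{k, x}\<close> with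
  \<open>{h, h'}\<close> as the edge leading on. The leg is present in all three graphs, so each
  \<open>val\<close> is minus a weight.\<close>

lemma IHX_first:
  assumes "BCR_int_edge G h h' x y z t" "leg G k x p q C" "card (int_verts G) = n" "is_coloring \<kappa> G c"
  shows "\<Phi> n G c + \<Phi> n (exch G y z) c + \<Phi> n (exch G y t) c = 0"
proof -
  interpret BCR_int_edge G h h' x y z t
    by (rule assms(1))
  have "card {att G h, att G h'} \<le> card (int_verts G)"
    using int wf by (intro card_mono) (auto simp: int_verts_def wf_graph_def)
  then have "2 \<le> n"
    using int(3) assms(3) by simp
  then obtain m where "n = 2 + m"
    using le_Suc_ex by blast
  then have m: "n = Suc (Suc m)"
    by simp
  have L: "BCR_leg G k x p q C"
    using BCR assms(2) by (rule BCR_leg.intro)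
  have "{x, p, q} = {h, x, y}"
    using BCR_leg.halves_w(1)[OF L] halves(2) att_halves(1) by simp
  then have "p \<in> {h, x, y}" "q \<in> {h, x, y}"
    by blast+
  then have "p = y \<and> q = h \<or> p = h \<and> q = y"
    using BCR_leg.halves_w(2-4)[OF L] by auto
  then have "leg G k x y h C"
    using assms(2) leg_swap[OF assms(2)] by auto
  then have "BCR_leg G k x y h C"
    using BCR by (intro BCR_leg.intro)
  then interpret j: jacobi G k x y h C h' z t
    using assms(1) by (rule jacobi.intro)
  interpret jz: jacobi "exch G y z" k x z h C h' y t
    by (rule j.jacobi_exch)
  interpret js: jacobi G k x y h C h' t z
    by (rule j.jacobi_swap)
  interpret jt: jacobi "exch G y t" k x t h C h' y z
    by (rule js.jacobi_exch)
  have card: "card (int_verts G) = Suc (Suc m)" "card (int_verts (exch G y z)) = Suc (Suc m)"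
    "card (int_verts (exch G y t)) = Suc (Suc m)"
    using assms(3) m by simp_all
  have col: "is_coloring \<kappa> (exch G y z) c" "is_coloring \<kappa> (exch G y t) c"
    using assms(4) is_coloring_cong[of "exch G y z" G] is_coloring_cong[of "exch G y t" G] by simp_all
  show ?thesis
    using jacobi_val[OF invariant resolvable j.jacobi_axioms card(1) assms(4)]
      resolvableD[OF resolvable j.BCR_leg_axioms card(1) assms(4)]
      resolvableD[OF resolvable jz.BCR_leg_axioms card(2) col(1)]
      resolvableD[OF resolvable jt.BCR_leg_axioms card(3) col(2)]
    unfolding m by linarith
qed

text \<open>The leg enters through \<open>x\<close> or \<open>y\<close>. In the second case
  \<open>x\<close> and \<open>y\<close> exchange roles, and by \<open>weight_mirror\<close>
  exchanging \<open>x\<close> instead of \<open>y\<close> yields the same two weights in the other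
  order.\<close>

lemma IHX_near:
  assumes "BCR_int_edge G h h' x y z t" "leg G k k' p q C" "att G k' = att G h"
    and "card (int_verts G) = n" "is_coloring \<kappa> G c"
  shows "\<Phi> n G c + \<Phi> n (exch G y z) c + \<Phi> n (exch G y t) c = 0"
proof -
  interpret BCR_int_edge G h h' x y z t
    by (rule assms(1))
  have L: "BCR_leg G k k' p q C"
    using BCR assms(2) by (rule BCR_leg.intro)
  have "k' \<in> halves_at G (edges G) (att G h)"
    using BCR_leg.in_edges(2)[OF L] assms(3) by (simp add: halves_at_def)
  moreover have "k' \<noteq> h"
  proof
    assume "k' = h"
    then have "{k, k'} = {h, h'}"
      using wf_graph_edge_unique[OF wf BCR_leg.edge(2)[OF L] edge, of h] by simp
    then have "k = h'"
      using \<open>k' = h\<close> neq by (auto simp: doubleton_eq_iff)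
    then show False
      using BCR_leg.v(3)[OF L] int(2) by simp
  qed
  ultimately consider "k' = x" | "k' = y"
    using halves(2) by auto
  then show ?thesis
  proof cases
    case 1
    then show ?thesis
      using IHX_first[OF assms(1) _ assms(4,5)] assms(2) by blast
  next
    case 2
    then have "\<Phi> n G c + \<Phi> n (exch G x z) c + \<Phi> n (exch G x t) c = 0"
      using IHX_first[OF swap' _ assms(4,5)] assms(2) by blast
    then show ?thesis
      using weight_mirror[OF assms(1,4,5)] weight_mirror[OF swap assms(4,5)] by linarith
  qed
qed

text \<open>If the leg found ends away from the edge, all three graphs are resolved at it, and the
  relation follows summand by summand from graphs with one internal vertex fewer. If it ends at the
  edge, \<open>IHX_near\<close> applies at the end in question.\<close>

lemma IHX_weight:
  assumes "BCR_int_edge G h h' x y z t" "card (int_verts G) = n" "is_coloring \<kappa> G c"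
  shows "\<Phi> n G c + \<Phi> n (exch G y z) c + \<Phi> n (exch G y t) c = 0"
  using assms
proof (induction n arbitrary: G)
  case 0
  interpret BCR_int_edge G h h' x y z t
    by (rule 0(1))
  have "finite (int_verts G)"
    using wf by (simp add: int_verts_def wf_graph_def)
  then show ?case
    using 0(2) int(1) by auto
next
  case (Suc n)
  interpret BCR_int_edge G h h' x y z t
    by (rule Suc(2))
  have "int_verts G \<noteq> {}"
    using int by auto
  then obtain k k' p q C where leg: "leg G k k' p q C"
    using some_leg_exists[OF BCR] by blast
  have L: "BCR_leg G k k' p q C"
    using BCR leg by (rule BCR_leg.intro)
  consider "att G k' = att G h" | "att G k' = att G h'" | "att G k' \<noteq> att G h" "att G k' \<noteq> att G h'"
    by blast
  then show ?case
  proof cases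
    case 1
    then show ?thesis
      using IHX_near[OF Suc(2) leg] Suc(3,4) by blast
  next
    case 2
    have "BCR_int_edge G h' h z t y x"
      using BCR_int_edge.swap[OF sym] .
    then have "\<Phi> (Suc n) G c + \<Phi> (Suc n) (exch G t y) c + \<Phi> (Suc n) (exch G t x) c = 0"
      using IHX_near[OF _ leg] 2 Suc(3,4) by blast
    moreover have "exch G t y = exch G y t" "exch G t x = exch G x t"
      by (simp_all add: exch_def transpose_commute)
    ultimately show ?thesis
      using weight_mirror[OF Suc(2-4)] by simp
  next
    case 3
    have far: "\<Phi> (Suc n) (exch G y z) c = - (\<Phi> n (exch (res G k k' p C) y z) c +
          (if halves_at G (solid G) (att G k) = {} then 0 else \<Phi> n (exch (res G k k' q C) y z) c))"
      if "BCR_int_edge G h h' x y z t" for z t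
    proof -
      interpret a: BCR_int_edge_leg G h h' x y z t k k' p q C
        using that L 3 by (intro BCR_int_edge_leg.intro BCR_int_edge_leg_axioms.intro)
      interpret b: BCR_int_edge_leg G h h' x y z t k k' q p C
        using that BCR_leg.swap[OF L] 3 by (intro BCR_int_edge_leg.intro BCR_int_edge_leg_axioms.intro)
      have "BCR_leg (exch G y z) k k' p q C"
        using a.BCR_exch a.leg_exch by (rule BCR_leg.intro)
      then show ?thesis
        using resolvableD[OF resolvable, of "exch G y z" k k' p q C n c] Suc(3,4)
          is_coloring_cong[of "exch G y z" G \<kappa> c]
        unfolding val_def a.res_exch b.res_exch a.solid_exch by simp
    qed
    interpret a: BCR_int_edge_leg G h h' x y z t k k' p q C
      using Suc(2) L 3 by (intro BCR_int_edge_leg.intro BCR_int_edge_leg_axioms.intro)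
    interpret b: BCR_int_edge_leg G h h' x y z t k k' q p C
      using Suc(2) BCR_leg.swap[OF L] 3 by (intro BCR_int_edge_leg.intro BCR_int_edge_leg_axioms.intro)
    have col: "is_coloring \<kappa> (res G k k' r C) c" for r
      using Suc(4) is_coloring_cong[of "res G k k' r C" G] by simp
    have card: "card (int_verts (res G k k' r C)) = n" for r
      using BCR_leg.w(1)[OF L] Suc(3) by simp
    show ?thesis
      using far[OF Suc(2)] far[OF swap] resolvableD[OF resolvable L Suc(3,4)]
        Suc(1)[OF a.int_edge_res card col] Suc(1)[OF b.int_edge_res card col]
      unfolding val_def by simp
  qed
qed

end


section \<open>The isomorphism\<close>

lemma graph_iso_refl: "graph_iso G G id id"
  by (simp add: graph_iso_def)

text \<open>Colorings with the same contraction differ by an even change, so invariance under the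
  identity isomorphism gives equal weights. This brings all graphs of a relation to one
  coloring.\<close>

lemma (in weight_system) weight_recolor:
  assumes "BCR_graph G" "BCR_graph G'" "verts G' = verts G" "edges G' = edges G" "card (int_verts G') = n"
    and "is_coloring \<kappa> G c" "is_coloring \<kappa> G' c'" "{h, h'} \<in> edges G" "att G h \<noteq> att G h'"
    and "att G' h = att G h" "att G' h' = att G h'" "same_contraction \<kappa> {h, h'} (G, c) (G', c')"
  shows "\<Phi> n G' c' = \<Phi> n G' c"
proof -
  have "change_sign G id id c c' = 1"
    using same_contractionD[OF BCR_wf[OF assms(1)] assms(3,4,6,7,8) _ _ assms(12)] assms(9-11) by auto
  then have "change_sign G' id id c c' = 1"
    using change_sign_cong[OF assms(3,4)] by metis
  moreover have "is_coloring \<kappa> G' c"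
    using assms(6) is_coloring_cong[OF assms(3,4)] by metis
  ultimately show ?thesis
    using invariantD[OF invariant assms(2,2,5) _ assms(7) graph_iso_refl, of c] by simp
qed

section \<open>Linear functionals on formal combinations\<close>

definition linear_extension :: "(colored_graph \<Rightarrow> rat) \<Rightarrow> comb \<Rightarrow> rat" where
  "linear_extension F p = (\<Sum>X\<in>Poly_Mapping.keys p. Poly_Mapping.lookup p X * F X)"

lemma linear_extension_superset:
  assumes "finite S" "Poly_Mapping.keys p \<subseteq> S"
  shows "linear_extension F p = (\<Sum>X\<in>S. Poly_Mapping.lookup p X * F X)"
  unfolding linear_extension_def using assms
  by (intro sum.mono_neutral_left) (auto simp: in_keys_iff)

lemma linear_extension_add: "linear_extension F (p + q) = linear_extension F p + linear_extension F q"
proof -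
  let ?S = "Poly_Mapping.keys p \<union> Poly_Mapping.keys q"
  have "linear_extension F r = (\<Sum>X\<in>?S. Poly_Mapping.lookup r X * F X)" if "r \<in> {p, q, p + q}" for r
    using that Poly_Mapping.keys_add[of p q] by (intro linear_extension_superset) auto
  then show ?thesis
    by (simp add: lookup_add distrib_right sum.distrib)
qed

lemma linear_extension_scale: "linear_extension F (scale r p) = r * linear_extension F p"
proof -
  have "linear_extension F (scale r p) = (\<Sum>X\<in>Poly_Mapping.keys p. Poly_Mapping.lookup (scale r p) X * F X)"
    by (intro linear_extension_superset) (auto simp: in_keys_iff)
  then show ?thesis
    by (simp add: linear_extension_def sum_distrib_left mult.assoc)
qed

lemma linear_extension_gen: "linear_extension F (gen X) = F X"
  by (simp add: linear_extension_def gen_def)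

lemma linear_extension_minus:
  "linear_extension F (- p) = - linear_extension F p"
  "linear_extension F (p - q) = linear_extension F p - linear_extension F q"
proof -
  show m: "linear_extension F (- p) = - linear_extension F p" for p
    using linear_extension_scale[of F "- 1" p] by simp
  show "linear_extension F (p - q) = linear_extension F p - linear_extension F q"
    using linear_extension_add[of F p "- q"] m[of q] by simp
qed

lemma linear_extension_span:
  assumes "p \<in> comb.span S" "\<And>a. a \<in> S \<Longrightarrow> linear_extension F a = 0"
  shows "linear_extension F p = 0"
  using assms(1)
  by (induction rule: comb.span_induct_alt)
    (auto simp: assms(2) linear_extension_add linear_extension_scale linear_extension_minus
      intro: linear_extension_def[of F 0, simplified])

text \<open>A maximal independent subset of \<open>W\<close> spans \<open>W\<close> and stays
  independent when \<open>z\<close> is added. On this set the functional is prescribed as 1 at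
  \<open>z\<close> and 0 elsewhere.\<close>

lemma separating_functional:
  assumes "comb.subspace W" "z \<notin> W"
  obtains \<psi> :: "comb \<Rightarrow> rat" where "\<And>a b. \<psi> (a + b) = \<psi> a + \<psi> b" "\<And>r a. \<psi> (scale r a) = r * \<psi> a"
    "\<And>a. a \<in> W \<Longrightarrow> \<psi> a = 0" "\<psi> z = 1"
proof -
  interpret vp: vector_space_pair scale "(*) :: rat \<Rightarrow> rat \<Rightarrow> rat"
    by unfold_locales (auto simp: algebra_simps)
  obtain A where A: "A \<subseteq> W" "comb.independent A" "W \<subseteq> comb.span A"
    using comb.maximal_independent_subset by blast
  have z: "z \<notin> comb.span A"
    using comb.span_minimal[OF A(1) assms(1)] assms(2) by blast
  then have ind: "comb.independent (insert z A)"
    using A(2) by (rule comb.independent_insertI)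
  define \<psi> where "\<psi> = vp.construct (insert z A) (\<lambda>b. if b = z then 1 else 0)"
  interpret L: Vector_Spaces.linear scale "(*) :: rat \<Rightarrow> rat \<Rightarrow> rat" \<psi>
    unfolding \<psi>_def using ind by (rule vp.linear_construct)
  have b: "\<psi> b = (if b = z then 1 else 0)" if "b \<in> insert z A" for b
    unfolding \<psi>_def using vp.construct_basis[OF ind that] .
  have "\<psi> a = 0" if a: "a \<in> A" for a
  proof -
    have "a \<noteq> z"
      using a z comb.span_base by blast
    then show ?thesis
      using b[of a] a by simp
  qed
  then have W: "\<psi> a = 0" if "a \<in> W" for a
    using L.eq_0_on_span[of A a] that A(3) by blast
  show ?thesis
  proof (rule that)
    show "\<psi> (a + b) = \<psi> a + \<psi> b" "\<psi> (scale r a) = r * \<psi> a" for a b r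
      by (rule L.add L.scale)+
    show "\<psi> a = 0" if "a \<in> W" for a
      using W[OF that] .
    show "\<psi> z = 1"
      using b[of z] by simp
  qed
qed

lemma colored_chord_subset: "colored_chord \<kappa> \<subseteq> colored_BCR \<kappa>"
  by (auto simp: colored_chord_def colored_BCR_def chord_diagram_def)

lemma Dc_subset: "Dc_BCR \<kappa> \<subseteq> D_BCR \<kappa>"
  unfolding Dc_BCR_def D_BCR_def by (intro comb.span_mono image_mono colored_chord_subset)

lemma subspace_R: "comb.subspace (R_BCR \<kappa>)" "comb.subspace (Rc_BCR \<kappa>)"
  by (simp_all add: R_BCR_def Rc_BCR_def comb.subspace_span)

lemma STU_in_R:
  assumes "STU \<kappa> S e H"
  shows "gen S - H \<in> R_BCR \<kappa>"
proof -
  have "gen S - H \<in> STU_rel \<kappa>"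
    using assms unfolding STU_rel_def by blast
  then show ?thesis
    unfolding R_BCR_def by (intro comb.span_base) auto
qed

lemma orientation_rel_mono:
  assumes "\<X> \<subseteq> \<Y>"
  shows "orientation_rel \<X> \<subseteq> orientation_rel \<Y>"
proof
  fix a assume "a \<in> orientation_rel \<X>"
  then obtain G c G' c' f g where "a = gen (G, c) - scale (of_int (change_sign G f g c c')) (gen (G', c'))"
    "(G, c) \<in> \<X>" "(G', c') \<in> \<X>" "graph_iso G G' f g"
    unfolding orientation_rel_def by blast
  then show "a \<in> orientation_rel \<Y>"
    using assms unfolding orientation_rel_def
    by (intro CollectI exI[of _ G] exI[of _ c] exI[of _ G'] exI[of _ c'] exI[of _ f] exI[of _ g]) auto
qed

lemma Rc_subset: "Rc_BCR \<kappa> \<subseteq> R_BCR \<kappa>"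
  unfolding Rc_BCR_def
proof (rule comb.span_minimal[OF _ subspace_R(1)])
  have "orientation_rel (colored_chord \<kappa>) \<subseteq> R_BCR \<kappa>"
    using orientation_rel_mono[OF colored_chord_subset] unfolding R_BCR_def
    by (intro subsetI comb.span_base) auto
  moreover have "a \<in> R_BCR \<kappa>" if rel: "a \<in> FourT_rel \<kappa>" for a
  proof -
    obtain S e e' H H' where a: "a = H - H'" "STU \<kappa> S e H" "STU \<kappa> S e' H'"
      using rel unfolding FourT_rel_def by blast
    have "(gen S - H') - (gen S - H) \<in> R_BCR \<kappa>"
      using comb.subspace_diff[OF subspace_R(1) STU_in_R[OF a(3)] STU_in_R[OF a(2)]] .
    then show ?thesis
      by (simp add: a(1))
  qed
  ultimately show "orientation_rel (colored_chord \<kappa>) \<union> FourT_rel \<kappa> \<subseteq> R_BCR \<kappa>"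
    by blast
qed

section \<open>The extended functional vanishes on all relations\<close>

context weight_system
begin

abbreviation total_weight :: "colored_graph \<Rightarrow> rat" where
  "total_weight \<equiv> \<lambda>(G, c). \<Phi> (card (int_verts G)) G c"

abbreviation "L \<equiv> linear_extension total_weight"

lemma L_orientation:
  assumes "a \<in> orientation_rel (colored_BCR \<kappa>)"
  shows "L a = 0"
proof -
  obtain G c G' c' f g where a: "a = gen (G, c) - Defs.scale (of_int (change_sign G f g c c')) (gen (G', c'))"
    "(G, c) \<in> colored_BCR \<kappa>" "(G', c') \<in> colored_BCR \<kappa>" "graph_iso G G' f g"
    using assms unfolding orientation_rel_def by blast
  have G: "BCR_graph G" "BCR_graph G'" "is_coloring \<kappa> G c" "is_coloring \<kappa> G' c'"
    using a(2,3) by (auto simp: colored_BCR_def)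
  show ?thesis
    using invariantD[OF invariant G(1,2) refl G(3,4) a(4)] graph_iso_card_int[OF a(4) BCR_wf[OF G(1)]]
    unfolding a(1) by (simp add: linear_extension_minus linear_extension_scale linear_extension_gen)
qed

lemma L_IHX:
  assumes "a \<in> IHX_rel \<kappa>"
  shows "L a = 0"
proof -
  obtain D1 D2 D3 G e h h' u w x y z t where D: "a = gen D1 + gen D2 + gen D3"
    "D1 \<in> colored_BCR \<kappa>" "D2 \<in> colored_BCR \<kappa>" "D3 \<in> colored_BCR \<kappa>"
    and e: "e = {h, h'}" "e \<in> dashed G" "u \<in> int_verts G" "w \<in> int_verts G" "u \<noteq> w"
    "att G h = u" "att G h' = w" "distinct [h, x, y, h', z, t]"
    "halves_at G (edges G) u = {h, x, y}" "halves_at G (edges G) w = {h', z, t}"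
    and f: "fst D1 = G" "fst D2 = reattach G {x, z} u {y, t} w" "fst D3 = reattach G {x, t} u {y, z} w"
    and s: "same_contraction \<kappa> e D1 D2" "same_contraction \<kappa> e D1 D3"
    using assms unfolding IHX_rel_def by blast
  obtain c1 c2 c3 where c: "D1 = (G, c1)" "D2 = (fst D2, c2)" "D3 = (fst D3, c3)"
    using f(1) by (metis prod.collapse)
  have G: "BCR_graph G" "is_coloring \<kappa> G c1"
    using D(2) by (auto simp: c(1) colored_BCR_def)
  interpret BCR_int_edge G h h' x y z t
    using G e by unfold_locales (auto simp: dashed_def)
  interpret sw: BCR_int_edge G h h' x y t z
    by (rule swap)
  have eq: "reattach G {x, z} u {y, t} w = exch G y z" "reattach G {x, t} u {y, z} w = exch G y t"
  proof -
    have "att (reattach G {x, z} u {y, t} w) k = att (exch G y z) k"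
      "att (reattach G {x, t} u {y, z} w) k = att (exch G y t) k" for k
      using att_halves neq e(6,7) by (auto simp: reattach_def transpose_def)
    then have "att (reattach G {x, z} u {y, t} w) = att (exch G y z)"
      "att (reattach G {x, t} u {y, z} w) = att (exch G y t)"
      by blast+
    then show "reattach G {x, z} u {y, t} w = exch G y z" "reattach G {x, t} u {y, z} w = exch G y t"
      by (auto intro!: graph.equality simp: reattach_def exch_def)
  qed
  have c': "D2 = (exch G y z, c2)" "D3 = (exch G y t, c3)"
    using c f eq by auto
  have col: "is_coloring \<kappa> (exch G y z) c2" "is_coloring \<kappa> (exch G y t) c3"
    using D(3,4) by (auto simp: c' colored_BCR_def)
  let ?n = "card (int_verts G)"
  have at: "att (exch G y z) h = att G h" "att (exch G y z) h' = att G h'"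
    "att (exch G y t) h = att G h" "att (exch G y t) h' = att G h'"
    using neq by (simp_all add: transpose_def)
  have "\<Phi> ?n (exch G y z) c2 = \<Phi> ?n (exch G y z) c1"
    by (rule weight_recolor[OF G(1) BCR_exch _ _ _ G(2) col(1) edge int(3) at(1,2)])
      (use s(1) in \<open>simp_all add: c(1) c'(1) e(1)\<close>)
  moreover have "\<Phi> ?n (exch G y t) c3 = \<Phi> ?n (exch G y t) c1"
    by (rule weight_recolor[OF G(1) sw.BCR_exch _ _ _ G(2) col(2) edge int(3) at(3,4)])
      (use s(2) in \<open>simp_all add: c(1) c'(2) e(1)\<close>)
  ultimately show ?thesis
    using IHX_weight[OF BCR_int_edge_axioms refl G(2)]
    unfolding D(1) c(1) c' by (simp add: linear_extension_add linear_extension_gen)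
qed

text \<open>The coloring of \<open>T\<close> in an STU relation is fixed only up to an even change;
  here it is replaced by the coloring of \<open>G\<close>, for which \<open>resolvable\<close> is
  stated.\<close>

lemma L_resolved:
  assumes "BCR_leg G h h' x y B" "is_coloring \<kappa> G c" "T \<in> colored_BCR \<kappa>" "fst T = res G h h' x B"
    and "card (int_verts G) = Suc n" "same_contraction \<kappa> {h, h'} (G, c) T"
  shows "total_weight T = \<Phi> n (res G h h' x B) c"
proof -
  interpret BCR_leg G h h' x y B
    by (rule assms(1))
  obtain d where T: "T = (res G h h' x B, d)"
    using assms(4) by (metis prod.collapse)
  have col: "is_coloring \<kappa> (res G h h' x B) d"
    using assms(3) by (simp add: T colored_BCR_def)
  have card: "card (int_verts (res G h h' x B)) = n"
    using card_int_res assms(5) by simp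
  have at: "att (res G h h' x B) h = v" "att (res G h h' x B) h' = w"
    using h_neq halves_w B_props(4,5) by simp_all
  have "\<Phi> n (res G h h' x B) d = \<Phi> n (res G h h' x B) c"
    by (rule weight_recolor[OF BCR BCR_res _ _ card assms(2) col edge(2) w(4) at])
      (use assms(6) in \<open>simp_all add: T\<close>)
  then show ?thesis
    using card by (simp add: T)
qed

lemma L_STU:
  assumes "STU \<kappa> S e H"
  shows "L (gen S - H) = 0"
  using assms
proof cases
  case (STU_I T U v w x y a B)
  obtain G c where S: "S = (G, c)"
    by (cases S)
  have G: "BCR_graph G" "is_coloring \<kappa> G c"
    using STU_I(2) by (auto simp: S colored_BCR_def)
  obtain h h' where h: "e = {h, h'}" "att G h = v" "att G h' = w" "distinct [h', x, y]"
    "halves_at G (edges G) w = {h', x, y}" "e \<in> dashed G" "v \<in> ext G" "w \<in> int_verts G"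
    using STU_I(5) unfolding STU_leg_def S by auto
  have "leg G h h' x y B"
    using h STU_I(6,7) unfolding leg_def S by auto
  then have lg: "BCR_leg G h h' x y B"
    using G(1) by (intro BCR_leg.intro)
  interpret BCR_leg G h h' x y B
    by (rule lg)
  interpret sw: BCR_leg G h h' y x B
    by (rule swap)
  have a: "att G a = att G h" "halves_at G (solid G) (att G h) \<noteq> {}"
    using STU_I(6) h(2) by (auto simp: S halves_at_def)
  have T: "fst T = res G h h' x B" "fst U = res G h h' y B"
    using STU_I(7,9,10) STU_resolve_eq[of "{a}" a] sw.STU_resolve_eq[of "{a}" a] a(1) h(1-3)
    by (simp_all add: S insert_commute)
  obtain n where n: "card (int_verts G) = Suc n"
    using w(1) wf by (cases "card (int_verts G)") (auto simp: int_verts_def wf_graph_def)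
  have "total_weight T = \<Phi> n (res G h h' x B) c" "total_weight U = \<Phi> n (res G h h' y B) c"
    using L_resolved[OF lg G(2) STU_I(3) T(1) n] L_resolved[OF swap G(2) STU_I(4) T(2) n]
      STU_I(11,12) by (simp_all add: S h(1))
  then show ?thesis
    unfolding STU_I(1) S using resolvableD[OF resolvable lg n G(2)] a(2) n
    by (simp add: linear_extension_minus linear_extension_gen val_def)
next
  case (STU_II T v w x y)
  obtain G c where S: "S = (G, c)"
    by (cases S)
  have G: "BCR_graph G" "is_coloring \<kappa> G c"
    using STU_II(2) by (auto simp: S colored_BCR_def)
  obtain h h' where h: "e = {h, h'}" "att G h = v" "att G h' = w" "distinct [h', x, y]"
    "halves_at G (edges G) w = {h', x, y}" "e \<in> dashed G" "v \<in> ext G" "w \<in> int_verts G"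
    using STU_II(4) unfolding STU_leg_def S by auto
  have sh: "halves_at G (solid G) (att G h) = {}"
    using STU_II(5) h(2) by (simp add: S)
  have "leg G h h' x y {}"
    using h sh unfolding leg_def S by auto
  then have lg: "BCR_leg G h h' x y {}"
    using G(1) by (intro BCR_leg.intro)
  interpret BCR_leg G h h' x y "{}"
    by (rule lg)
  have T: "fst T = res G h h' x {}"
    using STU_II(6) STU_resolve_eq[of "{}"] h(1-3) by (simp add: S)
  obtain n where n: "card (int_verts G) = Suc n"
    using w(1) wf by (cases "card (int_verts G)") (auto simp: int_verts_def wf_graph_def)
  have "total_weight T = \<Phi> n (res G h h' x {}) c"
    using L_resolved[OF lg G(2) STU_II(3) T(1) n] STU_II(7) by (simp add: S h(1))
  then show ?thesis
    unfolding STU_II(1) S using resolvableD[OF resolvable lg n G(2)] sh n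
    by (simp add: linear_extension_add linear_extension_minus linear_extension_gen val_def)
qed

lemma L_R: "a \<in> R_BCR \<kappa> \<Longrightarrow> L a = 0"
  unfolding R_BCR_def
  by (erule linear_extension_span) (auto simp: L_orientation L_IHX L_STU STU_rel_def)

lemma L_Dc:
  assumes "a \<in> Dc_BCR \<kappa>"
  shows "L a = \<psi> a"
  using assms unfolding Dc_BCR_def
proof (induction rule: comb.span_induct_alt)
  case base
  then show ?case
    using linear_extension_scale[of total_weight 0 0] minus(3) by simp
next
  case (step r p q)
  then obtain G c where p: "p = gen (G, c)" "int_verts G = {}"
    by (auto simp: colored_chord_def chord_diagram_def)
  then show ?case
    using step by (simp add: linear_extension_add linear_extension_scale linear_extension_gen add scale)
qed

end

text \<open>A functional that is 0 on \<open>Rc_BCR\<close> and 1 at \<open>a\<close> would extend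
  to one that vanishes on \<open>R_BCR\<close>, hence at \<open>a\<close>, although both agree on
  \<open>Dc_BCR\<close>.\<close>

lemma Dc_R_subset_Rc:
  assumes "a \<in> Dc_BCR \<kappa>" "a \<in> R_BCR \<kappa>"
  shows "a \<in> Rc_BCR \<kappa>"
proof (rule ccontr)
  assume "a \<notin> Rc_BCR \<kappa>"
  then obtain \<psi> :: "comb \<Rightarrow> rat" where \<psi>: "\<And>a b. \<psi> (a + b) = \<psi> a + \<psi> b"
    "\<And>r a. \<psi> (scale r a) = r * \<psi> a" "\<And>a. a \<in> Rc_BCR \<kappa> \<Longrightarrow> \<psi> a = 0" "\<psi> a = 1"
    using separating_functional[OF subspace_R(2)] by metis
  have "orientation_rel (colored_chord \<kappa>) \<union> FourT_rel \<kappa> \<subseteq> Rc_BCR \<kappa>"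
    unfolding Rc_BCR_def by (rule comb.span_superset)
  then interpret weight_system \<kappa> \<psi>
    using \<psi> by unfold_locales auto
  show False
    using L_R[OF assms(2)] L_Dc[OF assms(1)] \<psi>(4) by simp
qed

section \<open>Every graph is equivalent to a combination of chord diagrams\<close>

lemma gen_equiv_chord:
  assumes "X \<in> colored_BCR \<kappa>"
  shows "\<exists>d\<in>Dc_BCR \<kappa>. gen X - d \<in> R_BCR \<kappa>"
  using assms
proof (induction "card (int_verts (fst X))" arbitrary: X)
  case 0
  obtain G c where X: "X = (G, c)"
    by (cases X)
  have "BCR_graph G"
    using 0(2) by (simp add: X colored_BCR_def)
  then have "finite (int_verts G)"
    using BCR_wf by (auto simp: wf_graph_def int_verts_def)
  then have "X \<in> colored_chord \<kappa>"
    using 0 by (auto simp: X colored_chord_def colored_BCR_def chord_diagram_def)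
  then have "gen X \<in> Dc_BCR \<kappa>"
    unfolding Dc_BCR_def by (intro comb.span_base) simp
  then show ?case
    using comb.subspace_0[OF subspace_R(1)] by (intro bexI[of _ "gen X"]) simp_all
next
  case (Suc n)
  obtain G c where X: "X = (G, c)"
    by (cases X)
  have G: "BCR_graph G" "is_coloring \<kappa> G c" "card (int_verts G) = Suc n"
    using Suc(2,3) by (auto simp: X colored_BCR_def)
  then have "int_verts G \<noteq> {}"
    by auto
  then obtain h h' x y B where "leg G h h' x y B"
    using some_leg_exists[OF G(1)] by blast
  then interpret BCR_leg G h h' x y B
    using G(1) by (intro BCR_leg.intro)
  interpret sw: BCR_leg G h h' y x B
    by (rule swap)
  have "(res G h h' x B, c) \<in> colored_BCR \<kappa>" "(res G h h' y B, c) \<in> colored_BCR \<kappa>"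
    using BCR_res sw.BCR_res G(2) is_coloring_cong[of "res G h h' x B" G] is_coloring_cong[of "res G h h' y B" G]
    by (simp_all add: colored_BCR_def)
  then obtain d d' where d: "d \<in> Dc_BCR \<kappa>" "gen (res G h h' x B, c) - d \<in> R_BCR \<kappa>"
    and d': "d' \<in> Dc_BCR \<kappa>" "gen (res G h h' y B, c) - d' \<in> R_BCR \<kappa>"
    using Suc(1)[of "(res G h h' x B, c)"] Suc(1)[of "(res G h h' y B, c)"] card_int_res sw.card_int_res G(3)
    by auto
  have sub: "comb.subspace (Dc_BCR \<kappa>)"
    by (simp add: Dc_BCR_def)
  have S: "gen X - stu G c h h' x y B \<in> R_BCR \<kappa>"
    unfolding X by (rule STU_in_R[OF STU_stu[OF G(2)]])
  show ?case
  proof (cases "halves_at G (solid G) v = {}")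
    case True
    have "(gen X - stu G c h h' x y B) - (gen (res G h h' x B, c) - d) \<in> R_BCR \<kappa>"
      by (intro comb.subspace_diff subspace_R S d)
    then have "gen X - (- d) \<in> R_BCR \<kappa>"
      using True by (simp add: stu_def algebra_simps)
    then show ?thesis
      using comb.subspace_neg[OF sub d(1)] by blast
  next
    case False
    have "(gen X - stu G c h h' x y B) - (gen (res G h h' x B, c) - d) - (gen (res G h h' y B, c) - d') \<in> R_BCR \<kappa>"
      by (intro comb.subspace_diff subspace_R S d d')
    then have "gen X - (- d - d') \<in> R_BCR \<kappa>"
      using False by (simp add: stu_def algebra_simps)
    then show ?thesis
      using comb.subspace_diff[OF sub comb.subspace_neg[OF sub d(1)] d'(1)] by blast
  qed
qed

lemma D_equiv_Dc:
  assumes "a \<in> D_BCR \<kappa>"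
  shows "\<exists>d\<in>Dc_BCR \<kappa>. a - d \<in> R_BCR \<kappa>"
  using assms unfolding D_BCR_def
proof (induction rule: comb.span_induct_alt)
  case base
  show ?case
    using comb.subspace_0[OF subspace_R(1)] comb.span_zero
    by (intro bexI[of _ 0]) (auto simp: Dc_BCR_def)
next
  case (step r p q)
  obtain X where "p = gen X" "X \<in> colored_BCR \<kappa>"
    using step(1) by blast
  then obtain d where d: "d \<in> Dc_BCR \<kappa>" "p - d \<in> R_BCR \<kappa>"
    using gen_equiv_chord by blast
  obtain d' where d': "d' \<in> Dc_BCR \<kappa>" "q - d' \<in> R_BCR \<kappa>"
    using step(2) by blast
  have "scale r (p - d) + (q - d') \<in> R_BCR \<kappa>"
    by (intro comb.subspace_add comb.subspace_scale subspace_R d d')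
  then have "scale r p + q - (scale r d + d') \<in> R_BCR \<kappa>"
    by (simp add: comb.scale_right_diff_distrib algebra_simps)
  moreover have "scale r d + d' \<in> Dc_BCR \<kappa>"
    using d(1) d'(1) unfolding Dc_BCR_def by (intro comb.span_add comb.span_scale)
  ultimately show ?case
    by blast
qed

section \<open>Cosets and the induced isomorphism\<close>

lemma coset_eq_iff:
  assumes "comb.subspace W"
  shows "a +o W = b +o W \<longleftrightarrow> a - b \<in> W"
proof
  assume "a +o W = b +o W"
  moreover have "a \<in> a +o W"
    using comb.subspace_0[OF assms] unfolding elt_set_plus_def by force
  ultimately obtain r where "r \<in> W" "a = b + r"
    unfolding elt_set_plus_def by blast
  then show "a - b \<in> W"
    by simp
next
  assume ab: "a - b \<in> W"
  have "a + r = b + ((a - b) + r)" "b + r = a + (r - (a - b))" for r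
    by simp_all
  then show "a +o W = b +o W"
    using comb.subspace_add[OF assms ab] comb.subspace_diff[OF assms _ ab]
    unfolding elt_set_plus_def by (auto, blast+)
qed

theorem theorem0p2:
  fixes \<kappa> :: parity_case
  shows "Dc_BCR \<kappa> \<subseteq> D_BCR \<kappa> \<and>
    (\<exists>iota_star :: comb set \<Rightarrow> comb set.
       (\<forall>x\<in>Dc_BCR \<kappa>. iota_star (x +o Rc_BCR \<kappa>) = x +o R_BCR \<kappa>) \<and>
       linear_iso (Ac_BCR \<kappa>) (coset_scale (Rc_BCR \<kappa>)) (A_BCR \<kappa>) (coset_scale (R_BCR \<kappa>)) iota_star)"
proof (intro conjI exI)
  let ?R = "R_BCR \<kappa>" and ?Rc = "Rc_BCR \<kappa>"
  \<comment> \<open>The induced map needs no representatives: \<open>Rc_BCR\<close> lies in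
    \<open>R_BCR\<close>, so adding \<open>R_BCR\<close> enlarges a coset of the former to the coset
    of the latter through the same element.\<close>
  let ?\<iota> = "\<lambda>C. C + ?R"
  note sub = subspace_R(1)[of \<kappa>] and subc = subspace_R(2)[of \<kappa>]
  show "Dc_BCR \<kappa> \<subseteq> D_BCR \<kappa>"
    by (rule Dc_subset)
  have "?Rc + ?R = ?R"
  proof
    show "?Rc + ?R \<subseteq> ?R"
      using Rc_subset comb.subspace_add[OF sub] by (auto elim!: set_plus_elim)
    show "?R \<subseteq> ?Rc + ?R"
      using comb.subspace_0[OF subc] by (rule set_zero_plus2)
  qed
  then have \<iota>: "?\<iota> (a +o ?Rc) = a +o ?R" for a
    by (simp add: set_plus_rearrange3)
  then show "\<forall>x\<in>Dc_BCR \<kappa>. ?\<iota> (x +o ?Rc) = x +o ?R"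
    by simp
  have Dc: "comb.subspace (Dc_BCR \<kappa>)"
    by (simp add: Dc_BCR_def)
  show "linear_iso (Ac_BCR \<kappa>) (coset_scale ?Rc) (A_BCR \<kappa>) (coset_scale ?R) ?\<iota>"
    unfolding linear_iso_def
  proof (intro conjI ballI allI)
    show "bij_betw ?\<iota> (Ac_BCR \<kappa>) (A_BCR \<kappa>)"
      unfolding bij_betw_def
    proof
      show "inj_on ?\<iota> (Ac_BCR \<kappa>)"
      proof (rule inj_onI)
        fix A B assume "A \<in> Ac_BCR \<kappa>" "B \<in> Ac_BCR \<kappa>" and eq: "?\<iota> A = ?\<iota> B"
        then obtain a b where ab: "a \<in> Dc_BCR \<kappa>" "b \<in> Dc_BCR \<kappa>" "A = a +o ?Rc" "B = b +o ?Rc"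
          by (auto simp: Ac_BCR_def quotient_space_def)
        then have "a - b \<in> ?R"
          using eq \<iota> coset_eq_iff[OF sub] by simp
        then have "a - b \<in> ?Rc"
          using Dc_R_subset_Rc comb.subspace_diff[OF Dc ab(1,2)] by blast
        then show "A = B"
          unfolding ab using coset_eq_iff[OF subc] by simp
      qed
      show "?\<iota> ` Ac_BCR \<kappa> = A_BCR \<kappa>"
      proof
        show "?\<iota> ` Ac_BCR \<kappa> \<subseteq> A_BCR \<kappa>"
        proof (rule image_subsetI)
          fix A assume "A \<in> Ac_BCR \<kappa>"
          then obtain a where "a \<in> Dc_BCR \<kappa>" "A = a +o ?Rc"
            by (auto simp: Ac_BCR_def quotient_space_def)
          then show "?\<iota> A \<in> A_BCR \<kappa>"
            using \<iota> Dc_subset unfolding A_BCR_def quotient_space_def by blast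
        qed
        show "A_BCR \<kappa> \<subseteq> ?\<iota> ` Ac_BCR \<kappa>"
        proof
          fix A assume "A \<in> A_BCR \<kappa>"
          then obtain a where a: "a \<in> D_BCR \<kappa>" "A = a +o ?R"
            by (auto simp: A_BCR_def quotient_space_def)
          obtain d where d: "d \<in> Dc_BCR \<kappa>" "a - d \<in> ?R"
            using D_equiv_Dc[OF a(1)] by blast
          have "A = ?\<iota> (d +o ?Rc)"
            using d(2) a(2) \<iota> coset_eq_iff[OF sub] by simp
          then show "A \<in> ?\<iota> ` Ac_BCR \<kappa>"
            using d(1) by (auto simp: Ac_BCR_def quotient_space_def)
        qed
      qed
    qed
    show "?\<iota> (A + B) = ?\<iota> A + ?\<iota> B" if AB: "A \<in> Ac_BCR \<kappa>" "B \<in> Ac_BCR \<kappa>" for A B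
    proof -
      obtain a b where "A = a +o ?Rc" "B = b +o ?Rc"
        using AB by (auto simp: Ac_BCR_def quotient_space_def)
      then show ?thesis
        using \<iota> coset_add[OF sub] coset_add[OF subc] by simp
    qed
    show "?\<iota> (coset_scale ?Rc r A) = coset_scale ?R r (?\<iota> A)" if A: "A \<in> Ac_BCR \<kappa>" for r A
    proof -
      obtain a where "A = a +o ?Rc"
        using A by (auto simp: Ac_BCR_def quotient_space_def)
      then show ?thesis
        using \<iota> coset_scale_coset[OF sub] coset_scale_coset[OF subc] by simp
    qed
  qed
qed

end
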